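(* Consider the $T$-periodic discontinuous piecewise smooth differential system $$\mathbf{x}'=\begin{cases}F^+(\theta,\mathbf{x},\varepsilon)&\text{if }0\le\theta\le\phi,\\ F^-(\theta,\mathbf{x},\varepsilon)&\text{if }\phi\le\theta\le T,\end{cases}\qquad F^{\pm}=F_0^{\pm}+\varepsilon F_1^{\pm}+\varepsilon^2F_2^{\pm}+\varepsilon^3R^{\pm},\qquad( * )$$ with the data and notation of the context. Assume that (H) $\mathcal Z=\{\mathbf{z}_\nu=(\nu,\sigma(\nu)):\nu\in\overline V\}\subset D$, and for each $\nu\in\overline V$ the unique solution $\varphi(\theta,\mathbf{z}_\nu)$ of the unperturbed system ($\varepsilon=0$ in $( * )$) with $\varphi(0,\mathbf{z}_\nu)=\mathbf{z}_\nu$ is $T$-periodic. Assume in addition that for every $\nu\in\overline V$ the $p\times p$ matrix $Y^+(\phi,\mathbf{z}_\nu)-Y^-(\phi-T,\mathbf{z}_\nu)$ has the null $q\times(p-q)$ matrix in its upper right corner, and in its lower right corner has a $(p-q)\times(p-q)$ matrix $\Delta_\nu$ with $\det(\Delta_\nu)\ne0$. Let $f_1,f_2:\overline V\to\mathbb{R}^q$ be the bifurcation functions of order $1$ and $2$ defined in the context. Then the following statements hold. (a) If there exists $\nu^*\in V$ such that $f_1(\nu^* )=0$ and $\det(f_1'(\nu^* ))\neq0$, then for $|\varepsilon|>0$ sufficiently small there exists a $T$-periodic solution $\mathbf{x}(\theta,\varepsilon)$ of system $( * )$ such that $\mathbf{x}(0,\varepsilon)\to\mathbf{z}_{\nu^*}$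 as $\varepsilon\to0$. (b) Assume that $f_1\equiv0$. If there exists $\nu^*\in V$ such that $f_2(\nu^* )=0$ and $\det(f_2'(\nu^* ))\neq0$, then for $|\varepsilon|>0$ sufficiently small there exists a $T$-periodic solution $\mathbf{x}(\theta,\varepsilon)$ of system $( * )$ such that $\mathbf{x}(0,\varepsilon)\to\mathbf{z}_{\nu^*}$ as $\varepsilon\to0$.
   Context: Data. $T>0$, $\phi\in(0,T]$, $\varepsilon_0>0$, $\mathbb{S}^1=\mathbb{R}/(T\mathbb{Z})$; $p=d+1$; $D\subset\mathbb{R}^{p}$ is open and bounded; $F_i^\pm:\mathbb{S}^1\times D\to\mathbb{R}^{p}$ ($i=0,1,2$) and $R^\pm:\mathbb{S}^1\times D\times(-\varepsilon_0,\varepsilon_0)\to\mathbb{R}^{p}$ are $C^3$ functions (so they are $T$-periodic in $\theta$). The right-hand side of $( * )$ is extended $T$-periodically in $\theta$; a solution is a continuous function which satisfies the corresponding smooth equation on each of the pieces $[kT,kT+\phi]$, $[kT+\phi,(k+1)T]$, $k\in\mathbb{Z}$. The prime in $( * )$ denotes $d/d\theta$. $q\le p$ is a positive integer, $V\subset\mathbb{R}^q$ is open and bounded, and $\sigma:\overline V\to\mathbb{R}^{p-q}$ is $C^3$. Notation. $\varphi^\pm(\theta,\mathbf{z})$ is the solution of $\mathbf{x}'=F_0^\pm(\theta,\mathbf{x})$ with $\varphi^\pm(0,\mathbf{z})=\mathbf{z}$. $Y^\pm(\theta,\mathbf{z})$ is the fundamental matrix, normalized by $Y^\pm(0,\mathbf{z})=\mathrm{Id}$,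 of the variational equation $Y'=D_{\mathbf{x}}F_0^\pm(\theta,\varphi^\pm(\theta,\mathbf{z}))\,Y$. Put $$y_0^\pm(\theta,\mathbf{z})=\varphi^\pm(\theta,\mathbf{z}),\qquad y_1^\pm(\theta,\mathbf{z})=Y^\pm(\theta,\mathbf{z})\int_0^\theta Y^\pm(s,\mathbf{z})^{-1}F_1^\pm(s,\varphi^\pm(s,\mathbf{z}))\,ds,$$ $$y_2^\pm(\theta,\mathbf{z})=Y^\pm(\theta,\mathbf{z})\int_0^\theta Y^\pm(s,\mathbf{z})^{-1}\Big(2F_2^\pm(s,\varphi^\pm(s,\mathbf{z}))+2\tfrac{\partial F_1^\pm}{\partial\mathbf{x}}(s,\varphi^\pm(s,\mathbf{z}))\,y_1^\pm(s,\mathbf{z})+\tfrac{\partial^2F_0^\pm}{\partial\mathbf{x}^2}(s,\varphi^\pm(s,\mathbf{z}))\,y_1^\pm(s,\mathbf{z})^2\Big)ds,$$ where the second derivative is a bilinear form applied to the pair $(y_1^\pm,y_1^\pm)$. Define $$g_i(\mathbf{z})=y_i^+(\phi,\mathbf{z})-y_i^-(\phi-T,\mathbf{z}),\qquad i=0,1,2.$$ Write $\mathbf{z}=(u,v)\in\mathbb{R}^q\times\mathbb{R}^{p-q}$ and let $\xi$, $\xi^\perp$ be the orthogonal projections onto the first $q$ and the last $p-q$ coordinates. Put $\gamma(\nu)=-\Delta_\nu^{-1}\,\xi^\perp g_1(\mathbf{z}_\nu)$ and $$f_1(\nu)=\xi g_1(\mathbf{z}_\nu),\qquad f_2(\nu)=2\frac{\partial\,\xi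 g_1}{\partial v}(\mathbf{z}_\nu)\gamma(\nu)+\frac{\partial^2\xi g_0}{\partial v^2}(\mathbf{z}_\nu)\gamma(\nu)^2+2\,\xi g_2(\mathbf{z}_\nu),$$ where $\frac{\partial^2\xi g_0}{\partial v^2}$ is a bilinear form applied to $(\gamma(\nu),\gamma(\nu))$. If $q=p$, the terms involving $v$ and $\gamma$ are absent.
   Formalization: The formal statement takes g_2 = (y_2^+ − y_2^-)/2 instead of y_2^+ − y_2^-; with the literal g_2 part (b) fails, e.g. for u' = εv + ε²u, v' = −v + ε with φ = T = 1; g_0, g_1, f_1 and the formula for f_2 are kept. *)

theory Defs
  imports "HOL-Analysis.Analysis"
begin

text \<open>
  \<open>Ck_on k S f\<close> is meant for open sets \<open>S\<close> in finite dimension: all iterated directional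
  derivatives of \<open>f\<close> up to order \<open>k\<close> exist on \<open>S\<close> and are continuous there.
\<close>

primrec Ck_on :: "nat \<Rightarrow> 'a::euclidean_space set \<Rightarrow> ('a \<Rightarrow> 'b::euclidean_space) \<Rightarrow> bool" where
  "Ck_on 0 S f \<longleftrightarrow> continuous_on S f"
| "Ck_on (Suc k) S f \<longleftrightarrow>
     (\<forall>x\<in>S. f differentiable (at x)) \<and>
     (\<forall>h. Ck_on k S (\<lambda>x. frechet_derivative f (at x) h))"

text \<open>
  The usual space of functions that are \<open>C\<^sup>k\<close> up to the boundary of the open set \<open>V\<close>: all
  derivatives up to order \<open>k\<close> extend continuously from \<open>V\<close> to its closure.
\<close>

primrec Ck_closure :: "nat \<Rightarrow> 'a::euclidean_space set \<Rightarrow> ('a \<Rightarrow> 'b::euclidean_space) \<Rightarrow> bool" where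
  "Ck_closure 0 V f \<longleftrightarrow> continuous_on (closure V) f"
| "Ck_closure (Suc k) V f \<longleftrightarrow>
     continuous_on (closure V) f \<and>
     (\<forall>x\<in>V. f differentiable (at x)) \<and>
     (\<forall>h. \<exists>g. (\<forall>x\<in>V. g x = frechet_derivative f (at x) h) \<and> Ck_closure k V g)"

text \<open>
  Coordinates. An injection \<open>e :: 'q \<Rightarrow> 'p\<close> between index types tells which coordinates of
  \<open>real ^ 'p\<close> are the first \<open>q\<close>; the last \<open>p - q\<close> are those indexed outside \<open>range e\<close>.
  Since index types are nonempty but \<open>q = p\<close> is allowed, the space of the last \<open>p - q\<close>
  coordinates is represented by the subspace \<open>{v. \<forall>i. v $ e i = 0}\<close> of \<open>real ^ 'p\<close>.
  In \<open>pair_vec e u v\<close>, the vector \<open>(u, v)\<close>, the coordinates of \<open>v\<close> in \<open>range e\<close> are ignored.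
\<close>

definition pair_vec :: "('q::finite \<Rightarrow> 'p::finite) \<Rightarrow> real ^ 'q \<Rightarrow> real ^ 'p \<Rightarrow> real ^ 'p" where
  "pair_vec e u v = (\<chi> i. if i \<in> range e then u $ inv e i else v $ i)"

definition \<xi> :: "('q::finite \<Rightarrow> 'p::finite) \<Rightarrow> real ^ 'p \<Rightarrow> real ^ 'q" where
  "\<xi> e z = (\<chi> i. z $ e i)"

definition \<xi>_perp :: "('q::finite \<Rightarrow> 'p::finite) \<Rightarrow> real ^ 'p \<Rightarrow> real ^ 'p" where
  "\<xi>_perp e z = (\<chi> i. if i \<in> range e then 0 else z $ i)"

text \<open>
  The lower right \<open>(p-q) \<times> (p-q)\<close> corner \<open>\<Delta>\<close> of \<open>M\<close>, padded to the block diagonal matrix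
  \<open>diag(Id, \<Delta>)\<close>. It has the determinant of \<open>\<Delta>\<close> and, on the last \<open>p - q\<close>
  coordinates, the inverse of \<open>\<Delta>\<close>; the next two lemmas confirm this (\<open>det \<Delta> = 1\<close>
  if \<open>q = p\<close>).
\<close>

definition lower_corner :: "('q::finite \<Rightarrow> 'p::finite) \<Rightarrow> real ^ 'p ^ 'p \<Rightarrow> real ^ 'p ^ 'p" where
  "lower_corner e M =
     (\<chi> i j. if i \<notin> range e \<and> j \<notin> range e then M $ i $ j else if i = j then 1 else 0)"

lemma det_lower_corner:
  fixes e :: "'q::finite \<Rightarrow> 'p::finite"
  shows "det (lower_corner e M) =
    (\<Sum>\<pi> | \<pi> permutes (- range e). of_int (sign \<pi>) * (\<Prod>i\<in>- range e. M $ i $ \<pi> i))"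
proof -
  let ?S = "- range e" and ?L = "lower_corner e M"
  have "det ?L = (\<Sum>\<pi> | \<pi> permutes UNIV. of_int (sign \<pi>) * (\<Prod>i\<in>UNIV. ?L $ i $ \<pi> i))"
    by (simp add: det_def)
  also have "\<dots> = (\<Sum>\<pi> | \<pi> permutes ?S. of_int (sign \<pi>) * (\<Prod>i\<in>UNIV. ?L $ i $ \<pi> i))"
  proof (rule sum.mono_neutral_right)
    show "finite {\<pi>. \<pi> permutes (UNIV :: 'p set)}" by (simp add: finite_permutations)
    show "{\<pi>. \<pi> permutes ?S} \<subseteq> {\<pi>. \<pi> permutes UNIV}"
      using permutes_subset by blast
    show "\<forall>\<pi>\<in>{\<pi>. \<pi> permutes UNIV} - {\<pi>. \<pi> permutes ?S}.
            of_int (sign \<pi>) * (\<Prod>i\<in>UNIV. ?L $ i $ \<pi> i) = (0 :: real)"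
    proof
      fix \<pi> assume \<pi>: "\<pi> \<in> {\<pi>. \<pi> permutes UNIV} - {\<pi>. \<pi> permutes ?S}"
      then have "\<exists>i. i \<notin> ?S \<and> \<pi> i \<noteq> i"
        by (auto simp: permutes_def)
      then obtain i where i: "i \<in> range e" "\<pi> i \<noteq> i" by auto
      then have "?L $ i $ \<pi> i = 0" by (auto simp: lower_corner_def)
      then have "(\<Prod>i\<in>UNIV. ?L $ i $ \<pi> i) = 0"
        by (meson finite prod_zero UNIV_I)
      then show "of_int (sign \<pi>) * (\<Prod>i\<in>UNIV. ?L $ i $ \<pi> i) = (0 :: real)" by simp
    qed
  qed
  also have "\<dots> = (\<Sum>\<pi> | \<pi> permutes ?S. of_int (sign \<pi>) * (\<Prod>i\<in>?S. M $ i $ \<pi> i))"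
  proof (rule sum.cong[OF refl])
    fix \<pi> assume "\<pi> \<in> {\<pi>. \<pi> permutes ?S}"
    then have \<pi>: "\<pi> permutes ?S" by simp
    have "(\<Prod>i\<in>UNIV. ?L $ i $ \<pi> i) = (\<Prod>i\<in>?S. ?L $ i $ \<pi> i)"
    proof (rule prod.mono_neutral_right)
      show "\<forall>i\<in>UNIV - ?S. ?L $ i $ \<pi> i = 1"
        using permutes_not_in[OF \<pi>] by (auto simp: lower_corner_def)
    qed auto
    also have "\<dots> = (\<Prod>i\<in>?S. M $ i $ \<pi> i)"
      using permutes_in_image[OF \<pi>] by (intro prod.cong) (auto simp: lower_corner_def)
    finally show "of_int (sign \<pi>) * (\<Prod>i\<in>UNIV. ?L $ i $ \<pi> i) =
        of_int (sign \<pi>) * (\<Prod>i\<in>?S. M $ i $ \<pi> i)" by simp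
  qed
  finally show ?thesis .
qed

lemma matrix_inv_lower_corner:
  fixes e :: "'q::finite \<Rightarrow> 'p::finite"
  assumes "det (lower_corner e M) \<noteq> 0"
  shows "x = matrix_inv (lower_corner e M) *v \<xi>_perp e w \<longleftrightarrow>
    \<xi>_perp e x = x \<and> (\<forall>i\<in>- range e. (\<Sum>j\<in>- range e. M $ i $ j * x $ j) = w $ i)"
proof -
  let ?L = "lower_corner e M"
  have "invertible ?L" using assms by (simp add: invertible_det_nz)
  then have inv: "?L ** matrix_inv ?L = mat 1" "matrix_inv ?L ** ?L = mat 1"
    unfolding matrix_inv_def invertible_def by (metis (mono_tags, lifting) someI_ex)+
  have "x = matrix_inv ?L *v \<xi>_perp e w \<longleftrightarrow> ?L *v x = \<xi>_perp e w"
    by (metis inv matrix_vector_mul_assoc matrix_vector_mul_lid)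
  also have "\<dots> \<longleftrightarrow> (\<forall>i. (\<Sum>j\<in>UNIV. ?L $ i $ j * x $ j) = \<xi>_perp e w $ i)"
    by (simp add: vec_eq_iff matrix_vector_mult_def)
  also have "(\<lambda>i. \<Sum>j\<in>UNIV. ?L $ i $ j * x $ j) =
      (\<lambda>i. if i \<in> range e then x $ i else \<Sum>j\<in>- range e. M $ i $ j * x $ j)"
  proof
    fix i
    show "(\<Sum>j\<in>UNIV. ?L $ i $ j * x $ j) =
        (if i \<in> range e then x $ i else \<Sum>j\<in>- range e. M $ i $ j * x $ j)"
    proof (cases "i \<in> range e")
      case True
      then have "(\<Sum>j\<in>UNIV. ?L $ i $ j * x $ j) = (\<Sum>j\<in>UNIV. if j = i then x $ j else 0)"
        by (intro sum.cong) (auto simp: lower_corner_def)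
      then show ?thesis using True by simp
    next
      case False
      then have "(\<Sum>j\<in>UNIV. ?L $ i $ j * x $ j) = (\<Sum>j\<in>- range e. ?L $ i $ j * x $ j)"
        by (intro sum.mono_neutral_right) (auto simp: lower_corner_def)
      also have "\<dots> = (\<Sum>j\<in>- range e. M $ i $ j * x $ j)"
        using False by (intro sum.cong) (auto simp: lower_corner_def)
      finally show ?thesis using False by simp
    qed
  qed
  then have "(\<forall>i. (\<Sum>j\<in>UNIV. ?L $ i $ j * x $ j) = \<xi>_perp e w $ i) \<longleftrightarrow>
      (\<forall>i. (if i \<in> range e then x $ i else \<Sum>j\<in>- range e. M $ i $ j * x $ j) = \<xi>_perp e w $ i)"
    by (simp add: fun_eq_iff)
  also have "\<dots> \<longleftrightarrow>
      \<xi>_perp e x = x \<and> (\<forall>i\<in>- range e. (\<Sum>j\<in>- range e. M $ i $ j * x $ j) = w $ i)"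
    by (auto simp: vec_eq_iff \<xi>_perp_def split: if_splits)
  finally show ?thesis .
qed

text \<open>
  In the following definitions the time \<open>\<theta>\<close> may be negative: solutions live on the segment
  between \<open>0\<close> and \<open>\<theta>\<close> and stay in \<open>D\<close>, and the integral \<open>LBINT s=0..\<theta>\<close> is oriented.
  The value of \<open>flow F D \<theta> z\<close> is unspecified if the solution through \<open>z\<close> leaves \<open>D\<close>
  before time \<open>\<theta>\<close>.
\<close>

definition flow ::
  "(real \<Rightarrow> real ^ 'p \<Rightarrow> real ^ 'p) \<Rightarrow> (real ^ 'p::finite) set \<Rightarrow> real \<Rightarrow> real ^ 'p \<Rightarrow> real ^ 'p" where
  "flow F D \<theta> z = (THE w. \<exists>x. x 0 = z \<and> x \<theta> = w \<and>
     (\<forall>s\<in>closed_segment 0 \<theta>. x s \<in> D \<and>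
        (x has_vector_derivative F s (x s)) (at s within closed_segment 0 \<theta>)))"

definition fund_matrix ::
  "(real \<Rightarrow> real ^ 'p \<Rightarrow> real ^ 'p) \<Rightarrow> (real ^ 'p::finite) set \<Rightarrow> real \<Rightarrow> real ^ 'p \<Rightarrow> real ^ 'p ^ 'p"
where
  "fund_matrix F D \<theta> z = (THE M. \<exists>Y. Y 0 = mat 1 \<and> Y \<theta> = M \<and>
     (\<forall>s\<in>closed_segment 0 \<theta>.
        (Y has_vector_derivative jacobian (F s) (at (flow F D s z)) ** Y s)
          (at s within closed_segment 0 \<theta>)))"

definition second_derivative ::
  "('a::real_normed_vector \<Rightarrow> 'b::real_normed_vector) \<Rightarrow> 'a \<Rightarrow> 'a \<Rightarrow> 'a \<Rightarrow> 'b" where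
  "second_derivative f x h k = frechet_derivative (\<lambda>y. frechet_derivative f (at y) h) (at x) k"

definition y0 ::
  "(nat \<Rightarrow> real \<Rightarrow> real ^ 'p \<Rightarrow> real ^ 'p) \<Rightarrow> (real ^ 'p::finite) set \<Rightarrow> real \<Rightarrow> real ^ 'p \<Rightarrow> real ^ 'p"
where
  "y0 F D \<theta> z = flow (F 0) D \<theta> z"

definition y1 ::
  "(nat \<Rightarrow> real \<Rightarrow> real ^ 'p \<Rightarrow> real ^ 'p) \<Rightarrow> (real ^ 'p::finite) set \<Rightarrow> real \<Rightarrow> real ^ 'p \<Rightarrow> real ^ 'p"
where
  "y1 F D \<theta> z = fund_matrix (F 0) D \<theta> z *v
     (LBINT s=ereal 0..ereal \<theta>.
        matrix_inv (fund_matrix (F 0) D s z) *v F 1 s (flow (F 0) D s z))"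

definition y2 ::
  "(nat \<Rightarrow> real \<Rightarrow> real ^ 'p \<Rightarrow> real ^ 'p) \<Rightarrow> (real ^ 'p::finite) set \<Rightarrow> real \<Rightarrow> real ^ 'p \<Rightarrow> real ^ 'p"
where
  "y2 F D \<theta> z = fund_matrix (F 0) D \<theta> z *v
     (LBINT s=ereal 0..ereal \<theta>.
        matrix_inv (fund_matrix (F 0) D s z) *v
          (2 *\<^sub>R F 2 s (flow (F 0) D s z)
           + 2 *\<^sub>R frechet_derivative (F 1 s) (at (flow (F 0) D s z)) (y1 F D s z)
           + second_derivative (F 0 s) (flow (F 0) D s z) (y1 F D s z) (y1 F D s z)))"

text \<open>
  The coefficients of \<open>\<epsilon>\<^sup>i\<close> in the Taylor expansion of the displacement
  \<open>x\<^sup>+(\<phi>, z, \<epsilon>) - x\<^sup>-(\<phi> - T, z, \<epsilon>)\<close>. As \<open>y2\<close> is the second \<open>\<epsilon>\<close>-derivative of the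
  solution at \<open>\<epsilon> = 0\<close>, the second coefficient carries a factor \<open>1/2\<close>. It is this
  normalization that goes with the term \<open>2 \<xi> g2\<close> of the second bifurcation function \<open>f2\<close>
  below; without the factor \<open>1/2\<close>, simple zeros of \<open>f2\<close> need not give periodic solutions.
\<close>

definition g0 where
  "g0 Fp Fm D T \<phi> z = y0 Fp D \<phi> z - y0 Fm D (\<phi> - T) z"

definition g1 where
  "g1 Fp Fm D T \<phi> z = y1 Fp D \<phi> z - y1 Fm D (\<phi> - T) z"

definition g2 where
  "g2 Fp Fm D T \<phi> z = (1 / 2) *\<^sub>R (y2 Fp D \<phi> z - y2 Fm D (\<phi> - T) z)"

definition Ydiff where
  "Ydiff Fp Fm D T \<phi> z = fund_matrix (Fp 0) D \<phi> z - fund_matrix (Fm 0) D (\<phi> - T) z"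

definition \<gamma> where
  "\<gamma> Fp Fm D T \<phi> e \<sigma> \<nu> =
     - (matrix_inv (lower_corner e (Ydiff Fp Fm D T \<phi> (pair_vec e \<nu> (\<sigma> \<nu>)))) *v
          \<xi>_perp e (g1 Fp Fm D T \<phi> (pair_vec e \<nu> (\<sigma> \<nu>))))"

definition f1 where
  "f1 Fp Fm D T \<phi> e \<sigma> \<nu> = \<xi> e (g1 Fp Fm D T \<phi> (pair_vec e \<nu> (\<sigma> \<nu>)))"

text \<open>
  The partial derivatives with respect to \<open>v\<close> are those of \<open>v \<mapsto> \<xi> g(\<nu>, v)\<close> at \<open>v = \<sigma> \<nu>\<close>.
  If \<open>q = p\<close>, this map is constant and \<open>\<gamma>\<close> is zero.
\<close>

definition f2 where
  "f2 Fp Fm D T \<phi> e \<sigma> \<nu> =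
     2 *\<^sub>R frechet_derivative (\<lambda>v. \<xi> e (g1 Fp Fm D T \<phi> (pair_vec e \<nu> v))) (at (\<sigma> \<nu>))
            (\<gamma> Fp Fm D T \<phi> e \<sigma> \<nu>)
     + second_derivative (\<lambda>v. \<xi> e (g0 Fp Fm D T \<phi> (pair_vec e \<nu> v))) (\<sigma> \<nu>)
         (\<gamma> Fp Fm D T \<phi> e \<sigma> \<nu>) (\<gamma> Fp Fm D T \<phi> e \<sigma> \<nu>)
     + 2 *\<^sub>R \<xi> e (g2 Fp Fm D T \<phi> (pair_vec e \<nu> (\<sigma> \<nu>)))"

definition rhs ::
  "(nat \<Rightarrow> real \<Rightarrow> real ^ 'p \<Rightarrow> real ^ 'p) \<Rightarrow> (real \<Rightarrow> real ^ 'p \<Rightarrow> real \<Rightarrow> real ^ 'p) \<Rightarrow>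
   real \<Rightarrow> real ^ 'p::finite \<Rightarrow> real \<Rightarrow> real ^ 'p" where
  "rhs F R \<theta> x \<epsilon> =
     F 0 \<theta> x + \<epsilon> *\<^sub>R F 1 \<theta> x + \<epsilon>\<^sup>2 *\<^sub>R F 2 \<theta> x + \<epsilon> ^ 3 *\<^sub>R R \<theta> x \<epsilon>"

text \<open>
  Solutions of the discontinuous system with parameter \<open>\<epsilon>\<close>, defined for all times. The
  extension of the right-hand side to all \<open>\<theta>\<close> needs no reduction modulo \<open>T\<close>, because the
  coefficient functions will be assumed to be \<open>T\<close>-periodic.
\<close>

definition pw_solution ::
  "(nat \<Rightarrow> real \<Rightarrow> real ^ 'p \<Rightarrow> real ^ 'p) \<Rightarrow> (nat \<Rightarrow> real \<Rightarrow> real ^ 'p \<Rightarrow> real ^ 'p) \<Rightarrow>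
   (real \<Rightarrow> real ^ 'p \<Rightarrow> real \<Rightarrow> real ^ 'p) \<Rightarrow> (real \<Rightarrow> real ^ 'p \<Rightarrow> real \<Rightarrow> real ^ 'p) \<Rightarrow>
   (real ^ 'p::finite) set \<Rightarrow> real \<Rightarrow> real \<Rightarrow> real \<Rightarrow> (real \<Rightarrow> real ^ 'p) \<Rightarrow> bool" where
  "pw_solution Fp Fm Rp Rm D T \<phi> \<epsilon> x \<longleftrightarrow>
     continuous_on UNIV x \<and> range x \<subseteq> D \<and>
     (\<forall>k::int.
        (\<forall>\<theta>\<in>{of_int k * T .. of_int k * T + \<phi>}.
           (x has_vector_derivative rhs Fp Rp \<theta> (x \<theta>) \<epsilon>)
             (at \<theta> within {of_int k * T .. of_int k * T + \<phi>})) \<and>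
        (\<forall>\<theta>\<in>{of_int k * T + \<phi> .. (of_int k + 1) * T}.
           (x has_vector_derivative rhs Fm Rm \<theta> (x \<theta>) \<epsilon>)
             (at \<theta> within {of_int k * T + \<phi> .. (of_int k + 1) * T})))"

definition periodic :: "real \<Rightarrow> (real \<Rightarrow> 'a) \<Rightarrow> bool" where
  "periodic T x \<longleftrightarrow> (\<forall>\<theta>. x (\<theta> + T) = x \<theta>)"

end

theory Submission
  imports Defs
begin

text \<open>
  With time and \<open>\<epsilon>\<close> added to the state, each half of the system is autonomous and its flow is
  \<open>C\<^sup>3\<close>; the derivatives of the flow at \<open>\<epsilon> = 0\<close> solve variational equations, and variation of
  constants identifies them with \<open>Y\<close>, \<open>y\<^sub>1\<close> and \<open>y\<^sub>2\<close>. Periodic solutions correspond to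
  zeros of the displacement, the difference of the two half flows, which for \<open>\<epsilon> = 0\<close> vanishes on
  the manifold of the \<open>z\<^sub>\<nu>\<close>. At points within \<open>O(\<epsilon>)\<close> of the manifold, the displacement
  divided by \<open>\<epsilon>\<close> (by \<open>\<epsilon>\<^sup>2\<close> in the second order case, about \<open>z\<^sub>\<nu> + \<epsilon> \<gamma>(\<nu>)\<close>) converges uniformly
  to a map with a simple zero. Brouwer's fixed point theorem makes this zero persist, so no implicit
  function theorem is needed.
\<close>

text \<open>At \<open>\<epsilon> = 0\<close> the displacement vanishes along a manifold, so its
  derivative is degenerate there and zeros have to be found after rescaling. A single unknown
  \<zeta> carries both scales: its first q coordinates are the parameter \<nu> of a point of the
  manifold, the others describe a transversal shift, which is multiplied by \<epsilon>, in the
  second order case by the square of \<epsilon>. With the inverse of \<Delta> the shift is prepared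
  so that the rescaled displacement tends to the pair of f(\<nu>) and the transversal part of
  \<zeta>, where f is the first bifurcation function or half of the second one; a simple zero of f
  makes this limit nondegenerate. The vector \<gamma> is the part of the shift that cancels the
  order \<epsilon> of the transversal equations, and the second bifurcation function consists of the
  first q coordinates of the second derivative of the displacement in the direction (\<gamma>, 1).
  Brouwer yields a zero for each \<epsilon> separately, without continuity in \<epsilon>. The
  convergence of the initial values is therefore secured by choosing, among the zeros, one that is
  almost nearest to the limit.\<close>

lemma has_vector_derivative_continuous_on:
  assumes "\<And>t. t \<in> S \<Longrightarrow> (f has_vector_derivative f' t) (at t within S)"
  shows "continuous_on S f"
  unfolding continuous_on_eq_continuous_within
  by (intro ballI has_vector_derivative_continuous[OF assms])

lemma frechet_derivative_eqI:
  "(f has_derivative f') (at x) \<Longrightarrow> frechet_derivative f (at x) = f'"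
  by (metis frechet_derivative_at)

lemma frechet_derivative_eq_sum_Basis:
  fixes f :: "'a::euclidean_space \<Rightarrow> 'b::real_normed_vector"
  assumes "f differentiable at x"
  shows "frechet_derivative f (at x) h = (\<Sum>b\<in>Basis. (h \<bullet> b) *\<^sub>R frechet_derivative f (at x) b)"
proof -
  interpret linear "frechet_derivative f (at x)"
    using linear_frechet_derivative[OF assms] .
  have "frechet_derivative f (at x) (\<Sum>b\<in>Basis. (h \<bullet> b) *\<^sub>R b) = (\<Sum>b\<in>Basis. (h \<bullet> b) *\<^sub>R frechet_derivative f (at x) b)"
    by (simp add: sum scaleR)
  then show ?thesis by (simp add: euclidean_representation)
qed

section \<open>Calculus of functions of class \<open>C\<^sup>k\<close>\<close>

text \<open>A derivative at a point depends only on nearby values, and \<open>S\<close> is open; so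
  equality on \<open>S\<close> passes to all directional derivatives, with which the induction
  continues.\<close>

lemma Ck_on_cong:
  assumes "open S" "\<And>x. x \<in> S \<Longrightarrow> f x = g x" "Ck_on k S f"
  shows "Ck_on k S g"
  using assms(2,3)
proof (induction k arbitrary: f g)
  case 0
  then show ?case using continuous_on_cong[of S S f g] by simp
next
  case (Suc k)
  have der: "(g has_derivative frechet_derivative f (at x)) (at x)" if "x \<in> S" for x
    using Suc.prems that assms(1)
    by (metis Ck_on.simps(2) frechet_derivative_works has_derivative_transform_within_open)
  then have "frechet_derivative f (at x) h = frechet_derivative g (at x) h" if "x \<in> S" for x h
    using frechet_derivative_eqI that by metis
  then have "Ck_on k S (\<lambda>x. frechet_derivative g (at x) h)" for h
    using Suc.IH[of "\<lambda>x. frechet_derivative f (at x) h" "\<lambda>x. frechet_derivative g (at x) h"] Suc.prems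
    by auto
  then show ?case using der by (auto simp: differentiable_def)
qed

text \<open>Lets any known derivative \<open>f'\<close> stand in for the choice made by
  \<open>frechet_derivative\<close>, so that each closure rule below only has to exhibit
  one.\<close>

lemma Ck_on_SucI:
  assumes "open S" "\<And>x. x \<in> S \<Longrightarrow> (f has_derivative f' x) (at x)" "\<And>h. Ck_on k S (\<lambda>x. f' x h)"
  shows "Ck_on (Suc k) S f"
proof -
  have "Ck_on k S (\<lambda>x. frechet_derivative f (at x) h)" for h
    by (rule Ck_on_cong[OF assms(1) _ assms(3)[of h]])
      (use frechet_derivative_eqI[OF assms(2)] in auto)
  then show ?thesis using assms(2) by (auto simp: differentiable_def)
qed

lemma Ck_on_has_derivative:
  assumes "Ck_on (Suc k) S f" "x \<in> S"
  shows "(f has_derivative frechet_derivative f (at x)) (at x)"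
  using assms frechet_derivative_works by auto

lemma Ck_on_derivative:
  "Ck_on (Suc k) S f \<Longrightarrow> Ck_on k S (\<lambda>x. frechet_derivative f (at x) h)"
  by simp

lemma Ck_on_subset:
  assumes "Ck_on k S f" "T \<subseteq> S"
  shows "Ck_on k T f"
  using assms
  by (induction k arbitrary: f) (auto intro: continuous_on_subset)

text \<open>For the places where smoothness of a flow is available only on a ball that depends on
  the point.\<close>

lemma Ck_on_local:
  assumes "\<And>x. x \<in> S \<Longrightarrow> \<exists>U. open U \<and> x \<in> U \<and> Ck_on k U f"
  shows "Ck_on k S f"
  using assms
proof (induction k arbitrary: f)
  case 0
  then show ?case
    by (metis Ck_on.simps(1) continuous_at_imp_continuous_on continuous_on_eq_continuous_at)
next
  case (Suc k)
  then show ?case by (simp, metis)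
qed

lemma Ck_on_continuous: "Ck_on k S f \<Longrightarrow> continuous_on S f"
proof (cases k)
  case (Suc n)
  assume "Ck_on k S f"
  then have "\<And>x. x \<in> S \<Longrightarrow> f differentiable at x" using Suc by auto
  then show "continuous_on S f"
    by (simp add: continuous_at_imp_continuous_on differentiable_imp_continuous_within)
qed auto

lemma Ck_on_Suc_imp: "Ck_on (Suc k) S f \<Longrightarrow> Ck_on k S f"
proof (induction k arbitrary: f)
  case 0
  then show ?case using Ck_on_continuous[of "Suc 0" S f] by simp
next
  case (Suc k)
  show ?case unfolding Ck_on.simps(2)[of k]
  proof (intro conjI allI)
    show "\<forall>x\<in>S. f differentiable at x" using Suc.prems by simp
    show "Ck_on k S (\<lambda>x. frechet_derivative f (at x) h)" for h
      using Suc.prems by (intro Suc.IH) simp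
  qed
qed

lemma Ck_on_mono: "Ck_on k S f \<Longrightarrow> j \<le> k \<Longrightarrow> Ck_on j S f"
  by (induction k) (auto simp: le_Suc_eq simp del: Ck_on.simps dest: Ck_on_Suc_imp)

lemma Ck_on_const [simp]: "Ck_on k S (\<lambda>x. c)"
  by (induction k arbitrary: c) auto

lemma Ck_on_bounded_linear:
  assumes "bounded_linear L" "open S"
  shows "Ck_on k S L"
proof (cases k)
  case 0
  then show ?thesis using assms(1) by (auto intro!: linear_continuous_on)
next
  case (Suc n)
  then show ?thesis using assms
    by (auto intro!: Ck_on_SucI[where f'="\<lambda>_. L"] bounded_linear_imp_has_derivative simp del: Ck_on.simps)
qed

lemma Ck_on_linear_compose:
  assumes "bounded_linear L" "open S" "Ck_on k S f"
  shows "Ck_on k S (\<lambda>x. L (f x))"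
  using assms(3)
proof (induction k arbitrary: f)
  case 0
  then show ?case using bounded_linear.continuous_on[OF assms(1)] by simp
next
  case (Suc k)
  show ?case
  proof (rule Ck_on_SucI[OF assms(2), where f'="\<lambda>x h. L (frechet_derivative f (at x) h)"])
    show "((\<lambda>x. L (f x)) has_derivative (\<lambda>h. L (frechet_derivative f (at x) h))) (at x)" if "x \<in> S" for x
      by (rule bounded_linear.has_derivative[OF assms(1)]) (rule Ck_on_has_derivative[OF Suc.prems that])
    show "Ck_on k S (\<lambda>x. L (frechet_derivative f (at x) h))" for h
      using Suc.prems by (intro Suc.IH) simp
  qed
qed

lemma Ck_on_add:
  assumes "open S" "Ck_on k S f" "Ck_on k S g"
  shows "Ck_on k S (\<lambda>x. f x + g x)"
  using assms(2,3)
proof (induction k arbitrary: f g)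
  case 0
  then show ?case by (auto intro: continuous_intros)
next
  case (Suc k)
  show ?case
  proof (rule Ck_on_SucI[OF assms(1), where f'="\<lambda>x h. frechet_derivative f (at x) h + frechet_derivative g (at x) h"])
    show "((\<lambda>x. f x + g x) has_derivative (\<lambda>h. frechet_derivative f (at x) h + frechet_derivative g (at x) h)) (at x)"
      if "x \<in> S" for x
      by (intro has_derivative_add Ck_on_has_derivative[OF Suc.prems(1) that] Ck_on_has_derivative[OF Suc.prems(2) that])
    show "Ck_on k S (\<lambda>x. frechet_derivative f (at x) h + frechet_derivative g (at x) h)" for h
      using Suc.prems by (intro Suc.IH) simp_all
  qed
qed

lemma Ck_on_sum:
  assumes "open S" "\<And>i. i \<in> I \<Longrightarrow> Ck_on k S (f i)"
  shows "Ck_on k S (\<lambda>x. \<Sum>i\<in>I. f i x)"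
  using assms(2)
  by (induction I rule: infinite_finite_induct) (simp_all add: Ck_on_add[OF assms(1)])

lemma Ck_on_diff:
  assumes "open S" "Ck_on k S f" "Ck_on k S g"
  shows "Ck_on k S (\<lambda>x. f x - g x)"
  using Ck_on_add[OF assms(1,2) Ck_on_linear_compose[OF _ assms(1,3), of uminus]]
  by (simp add: bounded_linear_minus[OF bounded_linear_ident])

lemma Ck_on_scaleR:
  fixes f :: "_ \<Rightarrow> real"
  assumes "open S" "Ck_on k S f" "Ck_on k S g"
  shows "Ck_on k S (\<lambda>x. f x *\<^sub>R g x)"
  using assms(2,3)
proof (induction k arbitrary: f g)
  case 0
  then show ?case by (auto intro: continuous_intros)
next
  case (Suc k)
  show ?case
  proof (rule Ck_on_SucI[OF assms(1),
        where f'="\<lambda>x h. f x *\<^sub>R frechet_derivative g (at x) h + frechet_derivative f (at x) h *\<^sub>R g x"])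
    show "((\<lambda>x. f x *\<^sub>R g x) has_derivative
        (\<lambda>h. f x *\<^sub>R frechet_derivative g (at x) h + frechet_derivative f (at x) h *\<^sub>R g x)) (at x)"
      if "x \<in> S" for x
      by (intro has_derivative_scaleR Ck_on_has_derivative[OF Suc.prems(1) that] Ck_on_has_derivative[OF Suc.prems(2) that])
    show "Ck_on k S (\<lambda>x. f x *\<^sub>R frechet_derivative g (at x) h + frechet_derivative f (at x) h *\<^sub>R g x)" for h
      using Suc.prems Ck_on_Suc_imp[OF Suc.prems(1)] Ck_on_Suc_imp[OF Suc.prems(2)]
      by (intro Ck_on_add[OF assms(1)] Suc.IH) simp_all
  qed
qed

lemma Ck_on_Pair:
  assumes "open S" "Ck_on k S f" "Ck_on k S g"
  shows "Ck_on k S (\<lambda>x. (f x, g x))"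
proof -
  have "Ck_on k S (\<lambda>x. (f x, 0) + (0, g x))"
    by (intro Ck_on_add[OF assms(1)] Ck_on_linear_compose[OF _ assms(1,2)]
        Ck_on_linear_compose[OF _ assms(1,3)] bounded_linear_Pair
        bounded_linear_ident bounded_linear_zero)
  then show ?thesis by simp
qed

text \<open>The class is defined by derivatives in fixed directions, while the chain rule
  differentiates \<open>f\<close> in the direction \<open>frechet_derivative g (at x) h\<close>,
  which moves with \<open>x\<close>. Expanding this direction in the basis leaves scalar
  coefficients times derivatives of \<open>f\<close> in fixed directions, to which the induction
  hypothesis applies because \<open>f\<close> is generalised.\<close>

lemma Ck_on_compose:
  assumes "open S" "open T" "g ` S \<subseteq> T" "Ck_on k T f" "Ck_on k S g"
  shows "Ck_on k S (\<lambda>x. f (g x))"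
  using assms(4,5)
proof (induction k arbitrary: f)
  case 0
  then show ?case using assms(3) by (auto intro: continuous_on_compose2)
next
  case (Suc k)
  let ?f' = "\<lambda>x h. \<Sum>b\<in>Basis. (frechet_derivative g (at x) h \<bullet> b) *\<^sub>R frechet_derivative f (at (g x)) b"
  show ?case
  proof (rule Ck_on_SucI[OF assms(1), where f'="?f'"])
    show "((\<lambda>x. f (g x)) has_derivative ?f' x) (at x)" if "x \<in> S" for x
    proof -
      have g: "g x \<in> T" using assms(3) that by auto
      have fd: "f differentiable at (g x)" using Suc.prems(1) g by simp
      have "((\<lambda>x. f (g x)) has_derivative
          (\<lambda>h. frechet_derivative f (at (g x)) (frechet_derivative g (at x) h))) (at x)"
        using has_derivative_compose[OF Ck_on_has_derivative[OF Suc.prems(2) that]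
            Ck_on_has_derivative[OF Suc.prems(1) g]] .
      then show ?thesis
        unfolding frechet_derivative_eq_sum_Basis[OF fd, of "frechet_derivative g (at x) _"] .
    qed
    fix h
    have "Ck_on k S g" using Ck_on_Suc_imp[OF Suc.prems(2)] .
    moreover have "Ck_on k S (\<lambda>x. frechet_derivative g (at x) h)" using Suc.prems(2) by simp
    ultimately show "Ck_on k S (\<lambda>x. ?f' x h)"
      using Suc.prems(1)
      by (intro Ck_on_sum[OF assms(1)] Ck_on_scaleR[OF assms(1)] Suc.IH
          Ck_on_linear_compose[OF bounded_linear_inner_left assms(1)]) simp_all
  qed
qed

lemma Ck_on_derivative_apply:
  assumes "open S" "open U" "Ck_on (Suc k) U f" "Ck_on k S g" "Ck_on k S h" "g ` S \<subseteq> U"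
  shows "Ck_on k S (\<lambda>x. frechet_derivative f (at (g x)) (h x))"
proof -
  have "Ck_on k S (\<lambda>x. \<Sum>b\<in>Basis. (h x \<bullet> b) *\<^sub>R frechet_derivative f (at (g x)) b)"
    using assms(3)
    by (intro Ck_on_sum Ck_on_scaleR Ck_on_linear_compose[OF bounded_linear_inner_left _ assms(5)]
        Ck_on_compose[OF assms(1,2,6) _ assms(4)] assms(1)) simp
  then show ?thesis
    by (rule Ck_on_cong[OF assms(1), rotated])
      (rule frechet_derivative_eq_sum_Basis[symmetric], use assms(3,6) in auto)
qed

section \<open>Taylor expansions that are uniform on compact sets\<close>

text \<open>The point \<open>x + y\<close> may leave \<open>K\<close>, so uniform continuity is used
  on the closed \<open>\<rho>/2\<close>-neighbourhood \<open>K'\<close>, which is compact and still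
  inside \<open>U\<close>.\<close>

lemma uniform_continuity_near_compact:
  fixes w :: "'a::euclidean_space \<Rightarrow> 'b::real_normed_vector"
  assumes "open U" "compact K" "K \<subseteq> U" "continuous_on U w" "\<eta> > 0"
  shows "\<exists>\<delta>>0. \<forall>x\<in>K. \<forall>y. norm y < \<delta> \<longrightarrow> x + y \<in> U \<and> norm (w (x + y) - w x) \<le> \<eta>"
proof (cases "K = {}")
  case False
  obtain \<rho> where \<rho>: "\<rho> > 0" "(\<Union>x\<in>K. ball x \<rho>) \<subseteq> U"
    using compact_subset_open_imp_ball_epsilon_subset[OF assms(2,1,3)] by blast
  define K' where "K' = {x + y | x y. x \<in> K \<and> y \<in> cball 0 (\<rho>/2)}"
  have sub: "K' \<subseteq> U"
  proof
    fix a assume "a \<in> K'"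
    then obtain x y where xy: "a = x + y" "x \<in> K" "norm y \<le> \<rho>/2" by (auto simp: K'_def)
    then have "a \<in> ball x \<rho>" using \<rho>(1) by (simp add: dist_norm)
    then show "a \<in> U" using \<rho>(2) xy by blast
  qed
  have "uniformly_continuous_on K' w"
    using compact_uniformly_continuous[OF continuous_on_subset[OF assms(4) sub]]
      compact_sums[OF assms(2) compact_cball[of 0 "\<rho>/2"]] unfolding K'_def by blast
  then obtain d where d: "d > 0" "\<And>x y. x \<in> K' \<Longrightarrow> y \<in> K' \<Longrightarrow> dist y x < d \<Longrightarrow> dist (w y) (w x) < \<eta>"
    unfolding uniformly_continuous_on_def using assms(5) by blast
  show ?thesis
  proof (intro exI[of _ "min d (\<rho>/2)"] conjI ballI allI impI)
    fix x y :: 'a assume x: "x \<in> K" and y: "norm y < min d (\<rho>/2)"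
    have y': "y \<in> cball 0 (\<rho>/2)" "0 \<in> cball 0 (\<rho>/2)" using y \<rho>(1) by auto
    have K: "x + y \<in> K'" "x + 0 \<in> K'" using x y' unfolding K'_def by blast+
    then show "x + y \<in> U" using sub by blast
    show "norm (w (x + y) - w x) \<le> \<eta>"
      using d(2)[of x "x + y"] K y by (simp add: dist_norm)
  qed (use d \<rho> in auto)
qed (auto intro: exI[of _ 1])

lemma uniform_derivative_near_compact:
  fixes f :: "'a::euclidean_space \<Rightarrow> 'b::euclidean_space"
  assumes "open U" "compact K" "K \<subseteq> U" "Ck_on 1 U f" "\<eta> > 0"
  shows "\<exists>\<delta>>0. \<forall>x\<in>K. \<forall>y. norm y < \<delta> \<longrightarrow> x + y \<in> U \<and>
    (\<forall>v. norm (frechet_derivative f (at (x + y)) v - frechet_derivative f (at x) v) \<le> \<eta> * norm v)"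
proof -
  let ?D = "\<lambda>x v. frechet_derivative f (at x) v"
  \<comment> \<open>Each basis direction may contribute the error \<open>\<eta> / DIM('a)\<close>,
    since the coordinates of \<open>v\<close> are bounded by its norm.\<close>
  have "\<exists>\<delta>>0. \<forall>x\<in>K. \<forall>y. norm y < \<delta> \<longrightarrow> x + y \<in> U \<and> norm (?D (x + y) b - ?D x b) \<le> \<eta> / DIM('a)"
    for b :: 'a
    using assms by (intro uniform_continuity_near_compact) auto
  then obtain \<delta> where \<delta>: "\<And>b. \<delta> b > 0" "\<And>b x y. x \<in> K \<Longrightarrow> norm y < \<delta> b \<Longrightarrow> x + y \<in> U"
    "\<And>b x y. x \<in> K \<Longrightarrow> norm y < \<delta> b \<Longrightarrow> norm (?D (x + y) b - ?D x b) \<le> \<eta> / DIM('a)"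
    by metis
  let ?d = "Min (\<delta> ` (Basis :: 'a set))"
  show ?thesis
  proof (intro exI[of _ ?d] conjI ballI allI impI)
    show "?d > 0" using \<delta>(1) by (subst Min_gr_iff) auto
    fix x y :: 'a assume x: "x \<in> K" and y: "norm y < ?d"
    then have yb: "norm y < \<delta> b" if "b \<in> Basis" for b
      using that by (subst (asm) Min_gr_iff) auto
    show U: "x + y \<in> U" using \<delta>(2)[OF x yb] SOME_Basis by blast
    fix v
    have "?D (x + y) v - ?D x v = (\<Sum>b\<in>Basis. (v \<bullet> b) *\<^sub>R (?D (x + y) b - ?D x b))"
      using frechet_derivative_eq_sum_Basis[of f "x+y" v] frechet_derivative_eq_sum_Basis[of f x v] assms U x
      by (auto simp: sum_subtractf scaleR_diff_right subset_iff)
    also have "norm \<dots> \<le> (\<Sum>b\<in>(Basis::'a set). norm v * (\<eta> / DIM('a)))"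
    proof (rule sum_norm_le)
      fix b :: 'a assume "b \<in> Basis"
      then show "norm ((v \<bullet> b) *\<^sub>R (?D (x + y) b - ?D x b)) \<le> norm v * (\<eta> / DIM('a))"
        using \<delta>(3)[OF x yb] Basis_le_norm[of b v] unfolding norm_scaleR by (intro mult_mono) auto
    qed
    also have "\<dots> = \<eta> * norm v" by simp
    finally show "norm (?D (x + y) v - ?D x v) \<le> \<eta> * norm v" .
  qed
qed

text \<open>The mean value inequality in the form in which the Taylor estimates and the second
  differences below use it along a segment.\<close>

lemma norm_increment_le:
  fixes f :: "real \<Rightarrow> 'a::real_normed_vector"
  assumes "\<And>t. t \<in> {0..1} \<Longrightarrow> (f has_vector_derivative f' t) (at t)" "\<And>t. t \<in> {0..1} \<Longrightarrow> norm (f' t) \<le> B"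
    "t \<in> {0..1}"
  shows "norm (f t - f 0) \<le> B"
proof -
  have "norm (f t - f 0) \<le> B * norm (t - 0)"
  proof (rule differentiable_bound[of "{0..1}" f "\<lambda>s h. h *\<^sub>R f' s" B])
    show "(f has_derivative (\<lambda>h. h *\<^sub>R f' x)) (at x within {0..1})" if "x \<in> {0..1}" for x
      using assms(1)[OF that] has_derivative_at_withinI unfolding has_vector_derivative_def by blast
    show "onorm (\<lambda>h. h *\<^sub>R f' x) \<le> B" if "x \<in> {0..1}" for x
      using assms(2)[OF that] by (intro onorm_le) (metis abs_ge_zero mult.commute mult_left_mono norm_scaleR real_norm_def)
  qed (use assms(3) in auto)
  also have "\<dots> \<le> B"
    using assms(3) order_trans[OF norm_ge_zero assms(2)[of 0]] by (auto simp: mult_left_le)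
  finally show ?thesis .
qed

lemma has_vector_derivative_scaleR_const: "((\<lambda>t. t *\<^sub>R c) has_vector_derivative c) (at t within S)"
  by (auto intro!: derivative_eq_intros simp: has_vector_derivative_def)

lemma has_vector_derivative_line:
  assumes "(f has_derivative f') (at (x + t *\<^sub>R y))"
  shows "((\<lambda>t. f (x + t *\<^sub>R y)) has_vector_derivative f' y) (at t)"
proof -
  have "((\<lambda>t. f (x + t *\<^sub>R y)) has_derivative (\<lambda>s. f' (s *\<^sub>R y))) (at t)"
    by (rule has_derivative_compose[where g=f and f="\<lambda>t. x + t *\<^sub>R y", OF _ assms])
      (auto intro!: derivative_eq_intros)
  then show ?thesis
    using has_derivative_linear[OF assms]
    by (simp add: has_vector_derivative_def linear.scaleR linear_scale)
qed

text \<open>Along the segment, \<open>f (x + t *\<^sub>R y) - t *\<^sub>R ?D x y\<close> has a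
  derivative of norm at most \<open>\<eta> * norm y\<close>, so the mean value inequality suffices.
  The radius is that of the estimate for the derivatives, hence uniform in \<open>x\<close>.\<close>

lemma Taylor_first_order_uniform:
  fixes f :: "'a::euclidean_space \<Rightarrow> 'b::euclidean_space"
  assumes "open U" "compact K" "K \<subseteq> U" "Ck_on 1 U f" "\<eta> > 0"
  shows "\<exists>\<delta>>0. \<forall>x\<in>K. \<forall>y. norm y < \<delta> \<longrightarrow> x + y \<in> U \<and>
    norm (f (x + y) - f x - frechet_derivative f (at x) y) \<le> \<eta> * norm y"
proof -
  let ?D = "\<lambda>x v. frechet_derivative f (at x) v"
  obtain \<delta> where \<delta>: "\<delta> > 0" "\<And>x y. x \<in> K \<Longrightarrow> norm y < \<delta> \<Longrightarrow> x + y \<in> U"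
    "\<And>x y v. x \<in> K \<Longrightarrow> norm y < \<delta> \<Longrightarrow> norm (?D (x + y) v - ?D x v) \<le> \<eta> * norm v"
    using uniform_derivative_near_compact[OF assms] by blast
  show ?thesis
  proof (intro exI[of _ \<delta>] conjI ballI allI impI)
    fix x y :: 'a assume x: "x \<in> K" and y: "norm y < \<delta>"
    then show "x + y \<in> U" by (rule \<delta>)
    have y': "norm (t *\<^sub>R y) < \<delta>" if "t \<in> {0..1}" for t
      using that mult_left_le_one_le[of "norm y" "\<bar>t\<bar>"] y by auto
    have "norm ((f (x + 1 *\<^sub>R y) - 1 *\<^sub>R ?D x y) - (f (x + 0 *\<^sub>R y) - 0 *\<^sub>R ?D x y)) \<le> \<eta> * norm y"
    proof (rule norm_increment_le[where f'="\<lambda>t. ?D (x + t *\<^sub>R y) y - ?D x y"])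
      fix t :: real assume t: "t \<in> {0..1}"
      have "f differentiable at (x + t *\<^sub>R y)" using assms(4) \<delta>(2)[OF x y'[OF t]] by simp
      then have "(f has_derivative ?D (x + t *\<^sub>R y)) (at (x + t *\<^sub>R y))"
        by (simp add: frechet_derivative_works)
      from has_vector_derivative_diff[OF has_vector_derivative_line[OF this] has_vector_derivative_scaleR_const]
      show "((\<lambda>t. f (x + t *\<^sub>R y) - t *\<^sub>R ?D x y) has_vector_derivative ?D (x + t *\<^sub>R y) y - ?D x y) (at t)" .
      show "norm (?D (x + t *\<^sub>R y) y - ?D x y) \<le> \<eta> * norm y" using \<delta>(3)[OF x y'[OF t]] .
    qed auto
    then show "norm (f (x + y) - f x - ?D x y) \<le> \<eta> * norm y"
      by (simp add: algebra_simps)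
  qed (rule \<delta>)
qed

text \<open>Linearity in the first direction is not built into the definition. It comes from the
  basis expansion of the first derivative, which holds on all of \<open>U\<close> and can therefore
  be differentiated term by term.\<close>

lemma second_derivative_eq_sum_Basis:
  fixes f :: "'a::euclidean_space \<Rightarrow> 'b::euclidean_space"
  assumes "open U" "Ck_on 2 U f" "x \<in> U"
  shows "second_derivative f x h k =
    (\<Sum>b\<in>Basis. (h \<bullet> b) *\<^sub>R second_derivative f x b k)"
proof -
  have f: "Ck_on (Suc 1) U f" using assms(2) by (simp add: numeral_2_eq_2)
  have "((\<lambda>y. \<Sum>b\<in>Basis. (h \<bullet> b) *\<^sub>R frechet_derivative f (at y) b) has_derivative
      (\<lambda>k. \<Sum>b\<in>Basis. (h \<bullet> b) *\<^sub>R second_derivative f x b k)) (at x)"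
    unfolding second_derivative_def using f assms(3)
    by (intro has_derivative_sum has_derivative_scaleR_right Ck_on_has_derivative[where k=0 and S=U]) auto
  then have "((\<lambda>y. frechet_derivative f (at y) h) has_derivative
      (\<lambda>k. \<Sum>b\<in>Basis. (h \<bullet> b) *\<^sub>R second_derivative f x b k)) (at x)"
    by (rule has_derivative_transform_within_open[OF _ assms(1,3)])
      (rule frechet_derivative_eq_sum_Basis[symmetric], use f in simp)
  then show ?thesis
    unfolding second_derivative_def by (subst frechet_derivative_eqI) simp_all
qed

text \<open>Two mean value estimates in a row: closeness of the second derivatives along the segment
  bounds the remainder \<open>D1\<close> of the first derivative, and this bounds the remainder of
  \<open>f\<close>. Keeping the same bound both times loses only a constant, and
  \<open>\<eta>\<close> is arbitrary.\<close>

lemma Taylor_second_order_uniform: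
  fixes f :: "'a::euclidean_space \<Rightarrow> 'b::euclidean_space"
  assumes "open U" "compact K" "K \<subseteq> U" "Ck_on 2 U f" "\<eta> > 0"
  shows "\<exists>\<delta>>0. \<forall>x\<in>K. \<forall>y. norm y < \<delta> \<longrightarrow> x + y \<in> U \<and>
    norm (f (x + y) - f x - frechet_derivative f (at x) y - (1/2) *\<^sub>R second_derivative f x y y) \<le> \<eta> * (norm y)\<^sup>2"
proof -
  let ?D = "\<lambda>x v. frechet_derivative f (at x) v"
  have f: "Ck_on (Suc 1) U f" using assms(4) by (simp add: numeral_2_eq_2)
  have "\<exists>\<delta>>0. \<forall>x\<in>K. \<forall>y. norm y < \<delta> \<longrightarrow> x + y \<in> U \<and>
      (\<forall>v. norm (second_derivative f (x + y) b v - second_derivative f x b v) \<le> \<eta> / DIM('a) * norm v)" for b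
    unfolding second_derivative_def
    by (rule uniform_derivative_near_compact) (use assms f in auto)
  then obtain \<delta> where \<delta>: "\<And>b. \<delta> b > 0" "\<And>b x y. x \<in> K \<Longrightarrow> norm y < \<delta> b \<Longrightarrow> x + y \<in> U"
    "\<And>b x y v. x \<in> K \<Longrightarrow> norm y < \<delta> b \<Longrightarrow>
      norm (second_derivative f (x + y) b v - second_derivative f x b v) \<le> \<eta> / DIM('a) * norm v"
    by metis
  let ?d = "Min (\<delta> ` (Basis :: 'a set))"
  show ?thesis
  proof (intro exI[of _ ?d] conjI ballI allI impI)
    show "?d > 0" using \<delta>(1) by (subst Min_gr_iff) auto
    fix x y :: 'a assume x: "x \<in> K" and y: "norm y < ?d"
    then have yb: "norm y < \<delta> b" if "b \<in> Basis" for b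
      using that by (subst (asm) Min_gr_iff) auto
    have y': "norm (t *\<^sub>R y) < \<delta> b" if "t \<in> {0..1}" "b \<in> Basis" for t b
      using that(1) mult_left_le_one_le[of "norm y" "\<bar>t\<bar>"] yb[OF that(2)] by auto
    have U: "x + t *\<^sub>R y \<in> U" if "t \<in> {0..1}" for t
      using \<delta>(2)[OF x y'[OF that]] SOME_Basis by blast
    show "x + y \<in> U" using U[of 1] by simp
    let ?B = "second_derivative f x y y"
    have D2: "norm (second_derivative f (x + t *\<^sub>R y) y y - ?B) \<le> \<eta> * (norm y)\<^sup>2" if t: "t \<in> {0..1}" for t
    proof -
      have "second_derivative f (x + t *\<^sub>R y) y y - ?B =
          (\<Sum>b\<in>Basis. (y \<bullet> b) *\<^sub>R (second_derivative f (x + t *\<^sub>R y) b y - second_derivative f x b y))"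
        unfolding second_derivative_eq_sum_Basis[OF assms(1,4) U[OF t], of y]
          second_derivative_eq_sum_Basis[OF assms(1,4) U[of 0, simplified], of y]
        by (simp add: sum_subtractf scaleR_diff_right)
      also have "norm \<dots> \<le> (\<Sum>b\<in>(Basis::'a set). norm y * (\<eta> / DIM('a) * norm y))"
      proof (rule sum_norm_le)
        fix b :: 'a assume "b \<in> Basis"
        then show "norm ((y \<bullet> b) *\<^sub>R (second_derivative f (x + t *\<^sub>R y) b y - second_derivative f x b y))
            \<le> norm y * (\<eta> / DIM('a) * norm y)"
          using \<delta>(3)[OF x y'[OF t]] Basis_le_norm[of b y] unfolding norm_scaleR by (intro mult_mono) auto
      qed
      also have "\<dots> = \<eta> * (norm y)\<^sup>2" by (simp add: power2_eq_square)
      finally show ?thesis .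
    qed
    have D1: "norm (?D (x + t *\<^sub>R y) y - ?D x y - t *\<^sub>R ?B) \<le> \<eta> * (norm y)\<^sup>2" if "t \<in> {0..1}" for t
    proof -
      have "norm ((?D (x + t *\<^sub>R y) y - t *\<^sub>R ?B) - (?D (x + 0 *\<^sub>R y) y - 0 *\<^sub>R ?B)) \<le> \<eta> * (norm y)\<^sup>2"
      proof (rule norm_increment_le[OF _ _ that, where f'="\<lambda>t. second_derivative f (x + t *\<^sub>R y) y y - ?B"])
        fix t :: real assume t: "t \<in> {0..1}"
        have "((\<lambda>z. ?D z y) has_derivative second_derivative f (x + t *\<^sub>R y) y) (at (x + t *\<^sub>R y))"
          unfolding second_derivative_def using f U[OF t]
          by (intro Ck_on_has_derivative[where k=0 and S=U]) auto
        from has_vector_derivative_diff[OF has_vector_derivative_line[OF this] has_vector_derivative_scaleR_const]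
        show "((\<lambda>t. ?D (x + t *\<^sub>R y) y - t *\<^sub>R ?B) has_vector_derivative
            second_derivative f (x + t *\<^sub>R y) y y - ?B) (at t)" .
      qed (rule D2)
      then show ?thesis by (simp add: algebra_simps)
    qed
    let ?r = "\<lambda>t. f (x + t *\<^sub>R y) - t *\<^sub>R ?D x y - (t\<^sup>2 / 2) *\<^sub>R ?B"
    have "norm (?r 1 - ?r 0) \<le> \<eta> * (norm y)\<^sup>2"
    proof (rule norm_increment_le[where f'="\<lambda>t. ?D (x + t *\<^sub>R y) y - ?D x y - t *\<^sub>R ?B"])
      fix t :: real assume t: "t \<in> {0..1}"
      have "(f has_derivative ?D (x + t *\<^sub>R y)) (at (x + t *\<^sub>R y))"
        using Ck_on_has_derivative[OF f U[OF t]] .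
      note 1 = has_vector_derivative_line[OF this]
      have "((\<lambda>t. t\<^sup>2 / 2) has_real_derivative t) (at t)"
        by (auto intro!: derivative_eq_intros)
      then have "((\<lambda>t. (t\<^sup>2 / 2) *\<^sub>R ?B) has_vector_derivative t *\<^sub>R ?B) (at t)"
        by (intro bounded_linear.has_vector_derivative[OF bounded_linear_scaleR_left])
          (simp add: has_real_derivative_iff_has_vector_derivative)
      then show "(?r has_vector_derivative ?D (x + t *\<^sub>R y) y - ?D x y - t *\<^sub>R ?B) (at t)"
        by (intro has_vector_derivative_diff 1 has_vector_derivative_scaleR_const)
    next
      show "norm (?D (x + t *\<^sub>R y) y - ?D x y - t *\<^sub>R ?B) \<le> \<eta> * (norm y)\<^sup>2" if "t \<in> {0..1}" for t
        using D1[OF that] .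
    qed simp
    then show "norm (f (x + y) - f x - ?D x y - (1/2) *\<^sub>R ?B) \<le> \<eta> * (norm y)\<^sup>2"
      by (simp add: algebra_simps)
  qed
qed

section \<open>Ordinary differential equations on the unit interval\<close>

text \<open>Let \<open>s\<close> maximise the weighted norm \<open>?w\<close>, with value
  \<open>m\<close>. The weight has twice the rate \<open>L\<close>, so integrating the bound for
  \<open>u'\<close> up to \<open>s\<close> produces only \<open>m / 2\<close> times the exponential;
  half of the maximum remains and can be absorbed on the left.\<close>

lemma gronwall_bound:
  fixes u :: "real \<Rightarrow> 'a::real_normed_vector"
  assumes u: "\<And>t. t \<in> {0..1} \<Longrightarrow> (u has_vector_derivative u' t) (at t within {0..1})"
    and bound: "\<And>t. t \<in> {0..1} \<Longrightarrow> norm (u' t) \<le> L * norm (u t) + \<eta>"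
    and L: "L > 0" and \<eta>: "\<eta> \<ge> 0" and t: "t \<in> {0..1}"
  shows "norm (u t) \<le> 2 * exp (2 * L) * (norm (u 0) + \<eta>)"
proof -
  have cu: "continuous_on {0..1} u"
    by (rule has_vector_derivative_continuous_on[OF u])
  let ?w = "\<lambda>t. exp (- (2 * L * t)) * norm (u t)"
  obtain s where s: "s \<in> {0..1}" "\<And>t. t \<in> {0..1} \<Longrightarrow> ?w t \<le> ?w s"
  proof -
    have "continuous_on {0..1} ?w" by (intro continuous_intros cu)
    then show ?thesis using that continuous_attains_sup[of "{0..1::real}" ?w] by fastforce
  qed
  define m where "m = ?w s"
  have m0: "m \<ge> 0" by (simp add: m_def)
  have um: "norm (u t) \<le> m * exp (2 * L * t)" if "t \<in> {0..1}" for t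
  proof -
    have "norm (u t) = ?w t * exp (2 * L * t)" by (simp add: exp_minus)
    also have "\<dots> \<le> m * exp (2 * L * t)" using s(2)[OF that] by (simp add: m_def)
    finally show ?thesis .
  qed
  have ms: "norm (u s) = m * exp (2 * L * s)" by (simp add: m_def exp_minus)
  have inc: "norm (u s - u 0) \<le> \<eta> * s + m / 2 * (exp (2 * L * s) - 1)"
  proof (cases "s = 0")
    case False
    then have s0: "0 < s" using s(1) by auto
    let ?\<phi> = "\<lambda>t. \<eta> * t + m / 2 * exp (2 * L * t)"
    have "norm (u s - u 0) \<le> ?\<phi> s - ?\<phi> 0"
    proof (rule differentiable_bound_general[OF s0])
      show "continuous_on {0..s} u" using cu s(1) by (auto intro: continuous_on_subset)
      show "continuous_on {0..s} ?\<phi>" by (intro continuous_intros)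
      fix t assume t: "0 < t" "t < s"
      then have t1: "t \<in> {0..1}" "t \<in> {0<..<1}" using s(1) by auto
      then show "(u has_vector_derivative u' t) (at t)"
        using u[OF t1(1)] at_within_interior[of t "{0..1}"] by simp
      show "(?\<phi> has_vector_derivative \<eta> + L * (m * exp (2 * L * t))) (at t)"
        unfolding has_real_derivative_iff_has_vector_derivative[symmetric]
        by (auto intro!: derivative_eq_intros)
      show "norm (u' t) \<le> \<eta> + L * (m * exp (2 * L * t))"
        using bound[OF t1(1)] mult_left_mono[OF um[OF t1(1)], of L] L by linarith
    qed
    then show ?thesis by (simp add: algebra_simps)
  qed simp
  have "m * exp (2 * L * s) \<le> norm (u 0) + norm (u s - u 0)"
    using norm_triangle_ineq[of "u 0" "u s - u 0"] ms by simp
  also have "\<dots> \<le> norm (u 0) + (\<eta> + m / 2 * exp (2 * L * s))"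
    using inc m0 mult_left_mono[of s 1 \<eta>] s(1) \<eta> by (auto simp: algebra_simps)
  finally have "m * exp (2 * L * s) \<le> 2 * (norm (u 0) + \<eta>)" by (simp add: algebra_simps)
  moreover have "m * 1 \<le> m * exp (2 * L * s)" using m0 L s(1) by (intro mult_left_mono) auto
  ultimately have m: "m \<le> 2 * (norm (u 0) + \<eta>)" by simp
  have "norm (u t) \<le> m * exp (2 * L * t)" using um[OF t] .
  also have "\<dots> \<le> (2 * (norm (u 0) + \<eta>)) * exp (2 * L)"
    using m m0 L t \<eta> by (intro mult_mono) auto
  finally show ?thesis by (simp add: algebra_simps)
qed

text \<open>The weight \<open>exp (- 2 * L * t)\<close> makes the Picard operator a contraction on the whole interval.\<close>

lemma picard_global:
  fixes g :: "real \<Rightarrow> 'a \<Rightarrow> 'a::euclidean_space"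
  assumes cont: "\<And>x. continuous_on {0..1} x \<Longrightarrow> continuous_on {0..1} (\<lambda>t. g t (x t))"
    and lip: "\<And>t x y. t \<in> {0..1} \<Longrightarrow> norm (g t x - g t y) \<le> L * norm (x - y)"
    and L: "L > 0"
  shows "\<exists>x. x 0 = x0 \<and> (\<forall>t\<in>{0..1}. (x has_vector_derivative g t (x t)) (at t within {0..1}))"
proof -
  \<comment> \<open>Clamping time to the unit interval lets the operator act on bounded continuous
    functions on the whole line, a complete space to which \<open>banach_fix_type\<close>
    applies.\<close>
  define c where "c t = max 0 (min 1 t)" for t :: real
  have c: "c t \<in> {0..1}" "t \<in> {0..1} \<Longrightarrow> c t = t" for t by (auto simp: c_def)
  have cc: "continuous_on UNIV c" unfolding c_def by (intro continuous_intros)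
  \<comment> \<open>The unknown \<open>y\<close> is the solution multiplied by the decaying weight,
    so that the plain supremum distance of \<open>y\<close> is the weighted distance of the
    solution.\<close>
  define h where "h y s = g s (exp (2 * L * s) *\<^sub>R y s)" for y :: "real \<Rightarrow> 'a" and s
  define J where "J y t = integral {0..t} (h y)" for y t
  have ch: "continuous_on {0..1} (h y)" if "continuous_on UNIV y" for y
    unfolding h_def using that by (intro cont continuous_intros) (auto intro: continuous_on_subset)
  have J: "(J y has_vector_derivative h y t) (at t within {0..1})"
    if "continuous_on UNIV y" "t \<in> {0..1}" for y t
    unfolding J_def using integral_has_vector_derivative[OF ch[OF that(1)] that(2)] .
  have cJ: "continuous_on {0..1} (J y)" if "continuous_on UNIV y" for y
    by (rule has_vector_derivative_continuous_on[OF J[OF that]])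
  define Q where "Q y t = exp (- (2 * L * c t)) *\<^sub>R (x0 + J y (c t))" for y t
  have Q: "Q y \<in> bcontfun" if "continuous_on UNIV y" for y
  proof -
    let ?q = "\<lambda>t. exp (- (2 * L * t)) *\<^sub>R (x0 + J y t)"
    have cq: "continuous_on {0..1} ?q" using cJ[OF that] by (intro continuous_intros)
    have "Q y = ?q \<circ> c" by (auto simp: Q_def)
    moreover have "continuous_on UNIV (?q \<circ> c)"
      by (rule continuous_on_compose[OF cc]) (use cq c in \<open>auto intro: continuous_on_subset\<close>)
    moreover have "bounded (?q ` {0..1})"
      using compact_continuous_image[OF cq] compact_imp_bounded by blast
    then have "bounded (range (?q \<circ> c))"
      by (rule bounded_subset) (use c in auto)
    ultimately show ?thesis by (simp add: bcontfun_def)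
  qed
  define P where "P Y = Bcontfun (Q (apply_bcontfun Y))" for Y
  have P: "apply_bcontfun (P Y) = Q (apply_bcontfun Y)" for Y
    unfolding P_def by (rule Bcontfun_inverse, rule Q) simp
  have "dist (P Y1) (P Y2) \<le> 1/2 * dist Y1 Y2" for Y1 Y2
  proof (rule dist_bound)
    fix t
    let ?y1 = "apply_bcontfun Y1" and ?y2 = "apply_bcontfun Y2" and ?d = "dist Y1 Y2"
    have cy: "continuous_on UNIV ?y1" "continuous_on UNIV ?y2" by auto
    let ?f = "\<lambda>t. J ?y1 t - J ?y2 t" and ?\<phi> = "\<lambda>t. ?d / 2 * exp (2 * L * t)"
    have "norm (?f (c t)) \<le> ?d / 2 * exp (2 * L * c t)"
    proof (cases "c t = 0")
      case True
      then show ?thesis by (simp add: J_def)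
    next
      case False
      then have c0: "0 < c t" using c(1)[of t] by auto
      have "norm (?f (c t) - ?f 0) \<le> ?\<phi> (c t) - ?\<phi> 0"
      proof (rule differentiable_bound_general[OF c0])
        show "continuous_on {0..c t} ?f"
          using c(1)[of t] by (intro continuous_on_subset[OF continuous_on_diff[OF cJ[OF cy(1)] cJ[OF cy(2)]]]) auto
        show "continuous_on {0..c t} ?\<phi>" by (intro continuous_intros)
        fix s assume s: "0 < s" "s < c t"
        then have s1: "s \<in> {0..1}" "s \<in> {0<..<1}" using c(1)[of t] by auto
        show "(?f has_vector_derivative h ?y1 s - h ?y2 s) (at s)"
          using has_vector_derivative_diff[OF J[OF cy(1) s1(1)] J[OF cy(2) s1(1)]] s1
            at_within_interior[of s "{0..1}"] by simp
        show "(?\<phi> has_vector_derivative L * exp (2 * L * s) * ?d) (at s)"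
          unfolding has_real_derivative_iff_has_vector_derivative[symmetric]
          by (auto intro!: derivative_eq_intros)
        have "norm (h ?y1 s - h ?y2 s) \<le> L * norm (exp (2 * L * s) *\<^sub>R ?y1 s - exp (2 * L * s) *\<^sub>R ?y2 s)"
          unfolding h_def by (rule lip[OF s1(1)])
        also have "\<dots> = L * exp (2 * L * s) * norm (?y1 s - ?y2 s)"
          by (simp add: scaleR_diff_right[symmetric])
        also have "\<dots> \<le> L * exp (2 * L * s) * ?d"
          using dist_bounded[of Y1 s Y2] L by (intro mult_left_mono) (auto simp: dist_norm)
        finally show "norm (h ?y1 s - h ?y2 s) \<le> L * exp (2 * L * s) * ?d" .
      qed
      also have "\<dots> \<le> ?\<phi> (c t)" by simp
      finally show ?thesis by (simp add: J_def)
    qed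
    then have "exp (- (2 * L * c t)) * norm (?f (c t)) \<le> exp (- (2 * L * c t)) * (?d / 2 * exp (2 * L * c t))"
      by (intro mult_left_mono) auto
    also have "\<dots> = 1/2 * ?d" by (simp add: exp_minus)
    finally show "dist (apply_bcontfun (P Y1) t) (apply_bcontfun (P Y2) t) \<le> 1/2 * ?d"
      by (simp add: P Q_def dist_norm scaleR_diff_right[symmetric])
  qed
  then obtain Y where Y: "P Y = Y" using banach_fix_type[of "1/2" P] by auto
  let ?y = "apply_bcontfun Y"
  have cy: "continuous_on UNIV ?y" by simp
  have y: "exp (2 * L * t) *\<^sub>R ?y t = x0 + J ?y t" if "t \<in> {0..1}" for t
  proof -
    have "?y t = Q ?y t" using P[of Y] Y by simp
    then show ?thesis using c(2)[OF that] by (simp add: Q_def exp_minus)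
  qed
  show ?thesis
  proof (intro exI[of _ "\<lambda>t. x0 + J ?y t"] conjI ballI)
    show "x0 + J ?y 0 = x0" by (simp add: J_def)
    fix t :: real assume t: "t \<in> {0..1}"
    have "((\<lambda>t. x0 + J ?y t) has_vector_derivative 0 + h ?y t) (at t within {0..1})"
      by (rule has_vector_derivative_add[OF has_vector_derivative_const J[OF cy t]])
    moreover have "h ?y t = g t (x0 + J ?y t)" by (simp add: h_def y[OF t])
    ultimately show "((\<lambda>t. x0 + J ?y t) has_vector_derivative g t (x0 + J ?y t)) (at t within {0..1})" by simp
  qed
qed

section \<open>Linear equations with continuous coefficients\<close>

lemma linear_eq_sum_Basis:
  fixes A :: "'a::euclidean_space \<Rightarrow> 'b::real_vector"
  assumes "linear A"
  shows "A v = (\<Sum>b\<in>Basis. (v \<bullet> b) *\<^sub>R A b)"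
proof -
  have "A (\<Sum>b\<in>Basis. (v \<bullet> b) *\<^sub>R b) = (\<Sum>b\<in>Basis. (v \<bullet> b) *\<^sub>R A b)"
    by (simp add: linear_sum[OF assms] linear_scale[OF assms])
  then show ?thesis by (simp add: euclidean_representation)
qed

lemma linear_family_bounded:
  fixes A :: "'t::topological_space \<Rightarrow> 'a::euclidean_space \<Rightarrow> 'b::real_normed_vector"
  assumes "compact K" "\<And>t. t \<in> K \<Longrightarrow> linear (A t)" "\<And>b. b \<in> Basis \<Longrightarrow> continuous_on K (\<lambda>t. A t b)"
  shows "\<exists>L>0. \<forall>t\<in>K. \<forall>v. norm (A t v) \<le> L * norm v"
proof -
  have "\<exists>B. \<forall>t\<in>K. norm (A t b) \<le> B" if "b \<in> Basis" for b
    using compact_imp_bounded[OF compact_continuous_image[OF assms(3)[OF that] assms(1)]]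
    by (auto simp: bounded_iff)
  then obtain B where B: "\<And>b t. b \<in> Basis \<Longrightarrow> t \<in> K \<Longrightarrow> norm (A t b) \<le> B b" by metis
  have "norm (A t v) \<le> (1 + (\<Sum>b\<in>Basis. \<bar>B b\<bar>)) * norm v" if t: "t \<in> K" for t v
  proof -
    have "norm (A t v) \<le> (\<Sum>b\<in>Basis. norm v * \<bar>B b\<bar>)"
      unfolding linear_eq_sum_Basis[OF assms(2)[OF t], of v]
    proof (rule sum_norm_le)
      fix b :: 'a assume b: "b \<in> Basis"
      have "norm (A t b) \<le> \<bar>B b\<bar>" using B[OF b t] by simp
      then show "norm ((v \<bullet> b) *\<^sub>R A t b) \<le> norm v * \<bar>B b\<bar>"
        using Basis_le_norm[OF b, of v] unfolding norm_scaleR by (intro mult_mono) auto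
    qed
    also have "\<dots> \<le> (1 + (\<Sum>b\<in>Basis. \<bar>B b\<bar>)) * norm v"
      by (simp add: sum_distrib_left[symmetric] algebra_simps)
    finally show ?thesis .
  qed
  then show ?thesis
    by (intro exI[of _ "1 + (\<Sum>b\<in>Basis. \<bar>B b\<bar>)"]) (auto intro!: add_pos_nonneg sum_nonneg)
qed

lemma linear_ode_exists:
  fixes A :: "real \<Rightarrow> 'a \<Rightarrow> 'a::euclidean_space"
  assumes "\<And>t. t \<in> {0..1} \<Longrightarrow> linear (A t)" "\<And>b. b \<in> Basis \<Longrightarrow> continuous_on {0..1} (\<lambda>t. A t b)"
  shows "\<exists>y. y 0 = a \<and> (\<forall>t\<in>{0..1}. (y has_vector_derivative A t (y t)) (at t within {0..1}))"
proof -
  obtain L where L: "L > 0" "\<And>t v. t \<in> {0..1} \<Longrightarrow> norm (A t v) \<le> L * norm v"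
    using linear_family_bounded[of "{0..1}" A] assms by auto
  show ?thesis
  proof (rule picard_global[OF _ _ L(1)])
    fix x :: "real \<Rightarrow> 'a" assume "continuous_on {0..1} x"
    then have "continuous_on {0..1} (\<lambda>t. \<Sum>b\<in>Basis. (x t \<bullet> b) *\<^sub>R A t b)"
      using assms(2) by (intro continuous_intros)
    then show "continuous_on {0..1} (\<lambda>t. A t (x t))"
      by (rule continuous_on_eq) (rule linear_eq_sum_Basis[symmetric, OF assms(1)])
  next
    fix t :: real and x y :: 'a assume t: "t \<in> {0..1}"
    then show "norm (A t x - A t y) \<le> L * norm (x - y)"
      using L(2)[OF t, of "x - y"] by (simp add: linear_diff[OF assms(1)])
  qed
qed

lemma linear_ode_unique:
  fixes A :: "real \<Rightarrow> 'a \<Rightarrow> 'a::euclidean_space"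
  assumes A: "\<And>t. t \<in> {0..1} \<Longrightarrow> linear (A t)" "\<And>b. b \<in> Basis \<Longrightarrow> continuous_on {0..1} (\<lambda>t. A t b)"
    and y: "\<And>t. t \<in> {0..1} \<Longrightarrow> (y has_vector_derivative A t (y t) + b t) (at t within {0..1})"
    and z: "\<And>t. t \<in> {0..1} \<Longrightarrow> (z has_vector_derivative A t (z t) + b t) (at t within {0..1})"
    and 0: "y 0 = z 0" and t: "t \<in> {0..1}"
  shows "y t = z t"
proof -
  obtain L where L: "L > 0" "\<And>t v. t \<in> {0..1} \<Longrightarrow> norm (A t v) \<le> L * norm v"
    using linear_family_bounded[of "{0..1}" A] A by auto
  have "norm (y t - z t) \<le> 2 * exp (2 * L) * (norm (y 0 - z 0) + 0)"
  proof (rule gronwall_bound[OF _ _ L(1) order_refl t])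
    fix t :: real assume t: "t \<in> {0..1}"
    show "((\<lambda>t. y t - z t) has_vector_derivative A t (y t - z t)) (at t within {0..1})"
      using has_vector_derivative_diff[OF y[OF t] z[OF t]] by (simp add: linear_diff[OF A(1)[OF t]])
    show "norm (A t (y t - z t)) \<le> L * norm (y t - z t) + 0" using L(2)[OF t] by simp
  qed
  then show ?thesis using 0 by simp
qed

section \<open>Lipschitz bounds and local flows of autonomous systems\<close>

lemma Ck_on_Lipschitz_compact:
  fixes f :: "'a::euclidean_space \<Rightarrow> 'b::euclidean_space"
  assumes "open U" "compact K" "K \<subseteq> U" "Ck_on 1 U f"
  shows "\<exists>L>0. (\<forall>x\<in>K. \<forall>y\<in>K. norm (f x - f y) \<le> L * norm (x - y)) \<and>
    (\<forall>x\<in>K. \<forall>v. norm (frechet_derivative f (at x) v) \<le> L * norm v)"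
proof -
  let ?D = "\<lambda>x v. frechet_derivative f (at x) v"
  have "\<exists>L>0. \<forall>x\<in>K. \<forall>v. norm (?D x v) \<le> L * norm v"
    using assms by (intro linear_family_bounded linear_frechet_derivative) (auto intro: continuous_on_subset)
  then obtain M where M: "M > 0" "\<And>x v. x \<in> K \<Longrightarrow> norm (?D x v) \<le> M * norm v" by blast
  obtain \<delta> where \<delta>: "\<delta> > 0" "\<And>x y. x \<in> K \<Longrightarrow> norm y < \<delta> \<Longrightarrow> norm (f (x + y) - f x - ?D x y) \<le> 1 * norm y"
    using Taylor_first_order_uniform[OF assms zero_less_one] by blast
  obtain B where B: "\<And>x. x \<in> K \<Longrightarrow> norm (f x) \<le> B"
    using compact_imp_bounded[OF compact_continuous_image[OF continuous_on_subset[OF Ck_on_continuous[OF assms(4)] assms(3)] assms(2)]]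
    by (auto simp: bounded_iff)
  \<comment> \<open>\<open>K\<close> need not be convex, so segments are avoided: points closer than
    \<open>\<delta>\<close> are compared by the Taylor estimate, and for points farther apart the
    bound of \<open>f\<close> on \<open>K\<close> gives the quotient
    \<open>2 * \<bar>B\<bar> / \<delta>\<close>.\<close>
  have lip: "norm (f x - f y) \<le> (M + 1 + 2 * \<bar>B\<bar> / \<delta>) * norm (x - y)" if "x \<in> K" "y \<in> K" for x y
  proof (cases "norm (x - y) < \<delta>")
    case True
    have "norm (f (y + (x - y)) - f y) \<le> norm (f (y + (x - y)) - f y - ?D y (x - y)) + norm (?D y (x - y))"
      using norm_triangle_sub[of "f (y + (x - y)) - f y" "?D y (x - y)"] by simp
    also have "\<dots> \<le> 1 * norm (x - y) + M * norm (x - y)"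
      using \<delta>(2)[OF that(2) True] M(2)[OF that(2)] by (intro add_mono) auto
    also have "\<dots> \<le> (M + 1 + 2 * \<bar>B\<bar> / \<delta>) * norm (x - y)"
      using \<delta>(1) by (simp add: algebra_simps)
    finally show ?thesis by simp
  next
    case False
    have "norm (f x - f y) \<le> 2 * \<bar>B\<bar>"
      using norm_triangle_ineq4[of "f x" "f y"] B[OF that(1)] B[OF that(2)] by linarith
    also have "\<dots> \<le> 2 * \<bar>B\<bar> / \<delta> * norm (x - y)"
      using False \<delta>(1) mult_left_mono[of \<delta> "norm (x - y)" "\<bar>B\<bar>"] by (simp add: field_simps)
    also have "\<dots> \<le> (M + 1 + 2 * \<bar>B\<bar> / \<delta>) * norm (x - y)"
      using M(1) by (intro mult_right_mono) auto
    finally show ?thesis .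
  qed
  have "M * norm v \<le> (M + 1 + 2 * \<bar>B\<bar> / \<delta>) * norm v" for v :: 'a
    using M(1) \<delta>(1) by (intro mult_right_mono) auto
  then have "norm (?D x v) \<le> (M + 1 + 2 * \<bar>B\<bar> / \<delta>) * norm v" if "x \<in> K" for x v
    using M(2)[OF that] order_trans by blast
  moreover have "M + 1 + 2 * \<bar>B\<bar> / \<delta> > 0" using M(1) \<delta>(1) by (intro add_pos_nonneg) auto
  ultimately show ?thesis using lip by blast
qed

lemma compact_tube:
  fixes K :: "'a::euclidean_space set"
  assumes "open U" "compact K" "K \<subseteq> U" 
  shows "\<exists>\<rho>>0. \<exists>K'. compact K' \<and> K' \<subseteq> U \<and> (\<forall>x\<in>K. cball x \<rho> \<subseteq> K')"
proof (cases "K = {}")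
  case False
  obtain \<rho> where \<rho>: "\<rho> > 0" "(\<Union>x\<in>K. ball x \<rho>) \<subseteq> U"
    using compact_subset_open_imp_ball_epsilon_subset[OF assms(2,1,3)] by blast
  define K' where "K' = {x + y | x y. x \<in> K \<and> y \<in> cball 0 (\<rho>/2)}"
  have "K' \<subseteq> U"
  proof
    fix a assume "a \<in> K'"
    then obtain x y where xy: "a = x + y" "x \<in> K" "norm y \<le> \<rho>/2" by (auto simp: K'_def)
    then have "a \<in> ball x \<rho>" using \<rho>(1) by (simp add: dist_norm)
    then show "a \<in> U" using \<rho>(2) xy by blast
  qed
  moreover have "compact K'"
    using compact_sums[OF assms(2) compact_cball[of 0 "\<rho>/2"]] unfolding K'_def by blast
  moreover have "cball x (\<rho>/2) \<subseteq> K'" if "x \<in> K" for x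
  proof
    fix y assume "y \<in> cball x (\<rho>/2)"
    then have "y = x + (y - x)" "y - x \<in> cball 0 (\<rho>/2)" by (auto simp: dist_norm norm_minus_commute)
    then show "y \<in> K'" unfolding K'_def using that by blast
  qed
  ultimately show ?thesis using \<rho>(1) by (intro exI[of _ "\<rho>/2"]) auto
qed (auto intro: exI[of _ 1])

text \<open>Time is always the unit interval. An end time \<open>\<theta>\<close>, of either sign or
  zero, enters later as a factor of the vector field, so that one local theory serves both halves of
  the system.\<close>

definition solves :: "('a::real_normed_vector \<Rightarrow> 'a) \<Rightarrow> 'a set \<Rightarrow> (real \<Rightarrow> 'a) \<Rightarrow> bool" where
  "solves f U X \<longleftrightarrow>
    (\<forall>t\<in>{0..1}. X t \<in> U \<and> (X has_vector_derivative f (X t)) (at t within {0..1}))"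

lemma solves_continuous: "solves f U X \<Longrightarrow> continuous_on {0..1} X"
  unfolding solves_def by (rule has_vector_derivative_continuous_on) blast

lemma solves_unique:
  fixes f :: "'a::euclidean_space \<Rightarrow> 'a"
  assumes "open U" "Ck_on 1 U f" "solves f U X" "solves f U Y" "X 0 = Y 0" "t \<in> {0..1}"
  shows "X t = Y t"
proof -
  let ?K = "X ` {0..1} \<union> Y ` {0..1}"
  have "compact ?K" "?K \<subseteq> U"
    using solves_continuous[OF assms(3)] solves_continuous[OF assms(4)] assms(3,4)
    by (auto simp: solves_def intro!: compact_continuous_image)
  then obtain L where L: "L > 0" "\<And>x y. x \<in> ?K \<Longrightarrow> y \<in> ?K \<Longrightarrow> norm (f x - f y) \<le> L * norm (x - y)"
    using Ck_on_Lipschitz_compact[OF assms(1) _ _ assms(2)] by metis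
  have "norm (X t - Y t) \<le> 2 * exp (2 * L) * (norm (X 0 - Y 0) + 0)"
  proof (rule gronwall_bound[OF _ _ L(1) order_refl assms(6)])
    fix t :: real assume t: "t \<in> {0..1}"
    show "((\<lambda>t. X t - Y t) has_vector_derivative f (X t) - f (Y t)) (at t within {0..1})"
      using assms(3,4) t by (auto simp: solves_def intro!: has_vector_derivative_diff)
    show "norm (f (X t) - f (Y t)) \<le> L * norm (X t - Y t) + 0"
      using L(2)[of "X t" "Y t"] t by auto
  qed
  then show ?thesis using assms(5) by simp
qed

text \<open>The field is replaced by \<open>g\<close>, which evaluates \<open>f\<close> at the point
  of the \<open>\<rho>\<close>-ball about \<open>X0 t\<close> nearest to \<open>x\<close>. This
  retraction does not increase distances, so \<open>g\<close> is Lipschitz everywhere and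
  \<open>picard_global\<close> solves it. By Gronwall a start within \<open>\<rho> / C\<close> keeps
  the solution in the tube, where \<open>g\<close> agrees with \<open>f\<close>.\<close>

lemma solves_neighbourhood:
  fixes f :: "'a::euclidean_space \<Rightarrow> 'a"
  assumes U: "open U" and f: "Ck_on 1 U f" and X0: "solves f U X0"
  shows "\<exists>\<delta>>0. \<exists>X K C. compact K \<and> K \<subseteq> U \<and> 0 < C \<and>
    (\<forall>z\<in>ball (X0 0) \<delta>. X z 0 = z \<and> solves f K (X z)) \<and>
    (\<forall>z\<in>ball (X0 0) \<delta>. \<forall>z'\<in>ball (X0 0) \<delta>. \<forall>t\<in>{0..1}. norm (X z t - X z' t) \<le> C * norm (z - z'))"
proof -
  have cX0: "continuous_on {0..1} X0" using solves_continuous[OF X0] .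
  have "compact (X0 ` {0..1})" "X0 ` {0..1} \<subseteq> U"
    using cX0 X0 by (auto simp: solves_def intro!: compact_continuous_image)
  then obtain \<rho> K where \<rho>: "\<rho> > 0" and K: "compact K" "K \<subseteq> U" "\<And>t. t \<in> {0..1} \<Longrightarrow> cball (X0 t) \<rho> \<subseteq> K"
    using compact_tube[OF U] by (metis imageI)
  obtain L where L: "L > 0" "\<And>x y. x \<in> K \<Longrightarrow> y \<in> K \<Longrightarrow> norm (f x - f y) \<le> L * norm (x - y)"
    using Ck_on_Lipschitz_compact[OF U K(1,2) f] by metis
  define p where "p = closest_point (cball (0::'a) \<rho>)"
  have cb: "convex (cball (0::'a) \<rho>)" "closed (cball (0::'a) \<rho>)" "cball (0::'a) \<rho> \<noteq> {}"
    using \<rho> by auto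
  have pin: "norm (p x) \<le> \<rho>" for x
    using closest_point_in_set[OF cb(2,3), of x] by (simp add: p_def)
  have pid: "p x = x" if "norm x \<le> \<rho>" for x
    using that closest_point_self[of x "cball 0 \<rho>"] by (simp add: p_def)
  have plip: "norm (p x - p y) \<le> norm (x - y)" for x y
    using closest_point_lipschitz[OF cb, of x y] by (simp add: p_def dist_norm)
  have pcont: "continuous_on S p" for S
    unfolding p_def using cb by (intro continuous_on_closest_point)
  define g where "g t x = f (X0 t + p (x - X0 t))" for t x
  have gK: "X0 t + p (x - X0 t) \<in> K" if "t \<in> {0..1}" for t x
  proof -
    have "X0 t + p (x - X0 t) \<in> cball (X0 t) \<rho>" using pin by (simp add: dist_norm)
    then show ?thesis using K(3)[OF that] by blast
  qed
  have glip: "norm (g t x - g t y) \<le> L * norm (x - y)" if "t \<in> {0..1}" for t x y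
  proof -
    have "norm (g t x - g t y) \<le> L * norm (p (x - X0 t) - p (y - X0 t))"
      using L(2)[OF gK[OF that] gK[OF that], of x y] by (simp add: g_def)
    also have "\<dots> \<le> L * norm (x - y)"
      using plip[of "x - X0 t" "y - X0 t"] L(1) by simp
    finally show ?thesis .
  qed
  have gcont: "continuous_on {0..1} (\<lambda>t. g t (x t))" if "continuous_on {0..1} x" for x
    unfolding g_def
  proof (rule continuous_on_compose2[OF Ck_on_continuous[OF f]])
    show "continuous_on {0..1} (\<lambda>t. X0 t + p (x t - X0 t))"
      by (intro continuous_intros cX0 that continuous_on_compose2[OF pcont[of UNIV]]) auto
    show "(\<lambda>t. X0 t + p (x t - X0 t)) ` {0..1} \<subseteq> U" using gK K(2) by blast
  qed
  obtain X where X: "\<And>z. X z 0 = z"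
    "\<And>z t. t \<in> {0..1} \<Longrightarrow> (X z has_vector_derivative g t (X z t)) (at t within {0..1})"
    using picard_global[OF gcont glip L(1)] by metis
  define C where "C = 2 * exp (2 * L)"
  have C: "C > 0" by (simp add: C_def)
  have gX0: "g t (X0 t) = f (X0 t)" for t using \<rho> by (simp add: g_def pid)
  have near: "norm (X z t - X0 t) \<le> \<rho>" if z: "z \<in> ball (X0 0) (\<rho> / C)" and t: "t \<in> {0..1}" for z t
  proof -
    have "norm (X z t - X0 t) \<le> C * (norm (X z 0 - X0 0) + 0)" unfolding C_def
    proof (rule gronwall_bound[OF _ _ L(1) order_refl t])
      fix t :: real assume t: "t \<in> {0..1}"
      show "((\<lambda>t. X z t - X0 t) has_vector_derivative g t (X z t) - f (X0 t)) (at t within {0..1})"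
        using X0 t by (auto simp: solves_def intro!: has_vector_derivative_diff X)
      show "norm (g t (X z t) - f (X0 t)) \<le> L * norm (X z t - X0 t) + 0"
        using glip[OF t, of "X z t" "X0 t"] by (simp add: gX0)
    qed
    also have "\<dots> \<le> \<rho>" using z C by (simp add: X(1) dist_norm norm_minus_commute field_simps)
    finally show ?thesis .
  qed
  have sol: "solves f K (X z)" if z: "z \<in> ball (X0 0) (\<rho> / C)" for z
    unfolding solves_def
  proof (intro ballI conjI)
    fix t :: real assume t: "t \<in> {0..1}"
    show "X z t \<in> K" using near[OF z t] gK[OF t, of "X z t"] by (simp add: pid)
    show "(X z has_vector_derivative f (X z t)) (at t within {0..1})"
      using X(2)[OF t, of z] near[OF z t] by (simp add: g_def pid)
  qed
  have lip: "norm (X z t - X z' t) \<le> C * norm (z - z')" if t: "t \<in> {0..1}" for z z' t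
  proof -
    have "norm (X z t - X z' t) \<le> C * (norm (X z 0 - X z' 0) + 0)" unfolding C_def
    proof (rule gronwall_bound[OF _ _ L(1) order_refl t])
      fix t :: real assume t: "t \<in> {0..1}"
      show "((\<lambda>t. X z t - X z' t) has_vector_derivative g t (X z t) - g t (X z' t)) (at t within {0..1})"
        using t by (auto intro!: has_vector_derivative_diff X)
      show "norm (g t (X z t) - g t (X z' t)) \<le> L * norm (X z t - X z' t) + 0"
        using glip[OF t] by simp
    qed
    then show ?thesis by (simp add: X(1))
  qed
  show ?thesis
    by (intro exI[of _ "\<rho> / C"] conjI exI[of _ X] exI[of _ K] exI[of _ C] ballI K C)
      (use \<rho> C X(1) sol lip in auto)
qed

text \<open>The candidate derivative \<open>Y z h\<close> solves the linearised equation. The error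
  \<open>X z' t - X z t - Y z (z' - z) t\<close> solves the same equation up to a Taylor remainder
  that is uniform along the orbits, and Gronwall turns this into differentiability. Continuity of
  \<open>Y\<close> in \<open>z\<close> follows in the same way.\<close>

lemma flow_variational:
  fixes f :: "'a::euclidean_space \<Rightarrow> 'a"
  assumes U: "open U" and f: "Ck_on 1 U f" and X0: "solves f U X0"
  obtains \<delta> X Y where "\<delta> > 0"
    "\<And>z. z \<in> ball (X0 0) \<delta> \<Longrightarrow> X z 0 = z"
    "\<And>z. z \<in> ball (X0 0) \<delta> \<Longrightarrow> solves f U (X z)"
    "\<And>z h. z \<in> ball (X0 0) \<delta> \<Longrightarrow> Y z h 0 = h"
    "\<And>z h t. z \<in> ball (X0 0) \<delta> \<Longrightarrow> t \<in> {0..1} \<Longrightarrow>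
      (Y z h has_vector_derivative frechet_derivative f (at (X z t)) (Y z h t)) (at t within {0..1})"
    "\<And>z t. z \<in> ball (X0 0) \<delta> \<Longrightarrow> t \<in> {0..1} \<Longrightarrow> ((\<lambda>z. X z t) has_derivative (\<lambda>h. Y z h t)) (at z)"
    "\<And>z h t. z \<in> ball (X0 0) \<delta> \<Longrightarrow> t \<in> {0..1} \<Longrightarrow> isCont (\<lambda>z. Y z h t) z"
proof -
  let ?D = "\<lambda>x v. frechet_derivative f (at x) v"
  obtain \<delta> X K C where \<delta>: "\<delta> > 0" and K: "compact K" "K \<subseteq> U" and C: "C > 0"
    and X0: "\<And>z. z \<in> ball (X0 0) \<delta> \<Longrightarrow> X z 0 = z"
    and Xs: "\<And>z. z \<in> ball (X0 0) \<delta> \<Longrightarrow> solves f K (X z)"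
    and Xl: "\<And>z z' t. z \<in> ball (X0 0) \<delta> \<Longrightarrow> z' \<in> ball (X0 0) \<delta> \<Longrightarrow> t \<in> {0..1} \<Longrightarrow>
      norm (X z t - X z' t) \<le> C * norm (z - z')"
    using solves_neighbourhood[OF U f X0] by metis
  let ?B = "ball (X0 0) \<delta>"
  have XK: "X z t \<in> K" "X z t \<in> U" if "z \<in> ?B" "t \<in> {0..1}" for z t
    using Xs[OF that(1)] that(2) K(2) by (auto simp: solves_def)
  obtain L where L: "L > 0" "\<And>x y. x \<in> K \<Longrightarrow> y \<in> K \<Longrightarrow> norm (f x - f y) \<le> L * norm (x - y)"
    "\<And>x v. x \<in> K \<Longrightarrow> norm (?D x v) \<le> L * norm v"
    using Ck_on_Lipschitz_compact[OF U K f] by metis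
  have lin: "linear (?D (X z t))" if "z \<in> ?B" "t \<in> {0..1}" for z t
    using f XK(2)[OF that] by (intro linear_frechet_derivative) simp
  have cont: "continuous_on {0..1} (\<lambda>t. ?D (X z t) b)" if "z \<in> ?B" for z b
    by (rule continuous_on_compose2[of U "\<lambda>x. ?D x b"])
      (use f XK(2)[OF that] solves_continuous[OF Xs[OF that]] in auto)
  have "\<exists>y. y 0 = h \<and> (\<forall>t\<in>{0..1}. (y has_vector_derivative ?D (X z t) (y t)) (at t within {0..1}))"
    if "z \<in> ?B" for z h
    by (rule linear_ode_exists[OF lin[OF that] cont[OF that]])
  then obtain Y where Y0: "\<And>z h. z \<in> ?B \<Longrightarrow> Y z h 0 = h"
    and Yd: "\<And>z h t. z \<in> ?B \<Longrightarrow> t \<in> {0..1} \<Longrightarrow>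
      (Y z h has_vector_derivative ?D (X z t) (Y z h t)) (at t within {0..1})"
    by metis
  have Ylin: "linear (\<lambda>h. Y z h t)" if z: "z \<in> ?B" and t: "t \<in> {0..1}" for z t
  proof (rule linearI)
    fix h k
    show "Y z (h + k) t = Y z h t + Y z k t"
    proof (rule linear_ode_unique[OF lin[OF z] cont[OF z], where b="\<lambda>_. 0" and t=t])
      show "((\<lambda>t. Y z h t + Y z k t) has_vector_derivative ?D (X z t) (Y z h t + Y z k t) + 0) (at t within {0..1})"
        if "t \<in> {0..1}" for t
        using has_vector_derivative_add[OF Yd[OF z that] Yd[OF z that]] by (simp add: linear_add[OF lin[OF z that]])
    qed (use Yd z t Y0 in auto)
  next
    fix c h
    show "Y z (c *\<^sub>R h) t = c *\<^sub>R Y z h t"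
    proof (rule linear_ode_unique[OF lin[OF z] cont[OF z], where b="\<lambda>_. 0" and t=t])
      show "((\<lambda>t. c *\<^sub>R Y z h t) has_vector_derivative ?D (X z t) (c *\<^sub>R Y z h t) + 0) (at t within {0..1})"
        if "t \<in> {0..1}" for t
        using bounded_linear.has_vector_derivative[OF bounded_linear_scaleR_right Yd[OF z that], of c]
        by (simp add: linear_scale[OF lin[OF z that]])
    qed (use Yd z t Y0 in auto)
  qed
  have near: "\<exists>d>0. \<forall>z'. norm (z' - z) < d \<longrightarrow> z' \<in> ?B" if "z \<in> ?B" for z
    using open_ball[of "X0 0" \<delta>] that unfolding open_dist by (auto simp: dist_norm)
  have der: "((\<lambda>z. X z t) has_derivative (\<lambda>h. Y z h t)) (at z)" if z: "z \<in> ?B" and t: "t \<in> {0..1}" for z t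
    unfolding has_derivative_at_alt
  proof (intro conjI allI impI)
    show "bounded_linear (\<lambda>h. Y z h t)" using Ylin[OF z t] linear_conv_bounded_linear by blast
    fix \<eta> :: real assume \<eta>: "\<eta> > 0"
    \<comment> \<open>Gronwall multiplies the remainder by \<open>2 * exp (2 * L)\<close>, and
      orbits are at most \<open>C\<close> times as far apart as their starting points.\<close>
    let ?\<eta> = "\<eta> / (2 * exp (2 * L) * C)"
    have \<eta>': "?\<eta> > 0" using \<eta> C by simp
    obtain d1 where d1: "d1 > 0" "\<And>x y. x \<in> K \<Longrightarrow> norm y < d1 \<Longrightarrow> norm (f (x + y) - f x - ?D x y) \<le> ?\<eta> * norm y"
      using Taylor_first_order_uniform[OF U K f \<eta>'] by metis
    obtain d2 where d2: "d2 > 0" "\<And>z'. norm (z' - z) < d2 \<Longrightarrow> z' \<in> ?B" using near[OF z] by blast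
    show "\<exists>d>0. \<forall>z'. norm (z' - z) < d \<longrightarrow> norm (X z' t - X z t - Y z (z' - z) t) \<le> \<eta> * norm (z' - z)"
    proof (intro exI[of _ "min d2 (d1 / C)"] conjI allI impI)
      fix z' assume z': "norm (z' - z) < min d2 (d1 / C)"
      then have zB: "z' \<in> ?B" and zd: "C * norm (z' - z) < d1" using d2(2) C by (auto simp: field_simps)
      let ?u = "\<lambda>t. X z' t - X z t - Y z (z' - z) t"
      have "norm (?u t) \<le> 2 * exp (2 * L) * (norm (?u 0) + ?\<eta> * (C * norm (z' - z)))"
      proof (rule gronwall_bound[OF _ _ L(1) _ t])
        fix t :: real assume t: "t \<in> {0..1}"
        show "(?u has_vector_derivative f (X z' t) - f (X z t) - ?D (X z t) (Y z (z' - z) t)) (at t within {0..1})"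
          using Xs[OF z] Xs[OF zB] t Yd[OF z t] by (intro has_vector_derivative_diff) (auto simp: solves_def)
        let ?w = "X z' t - X z t"
        have w: "norm ?w \<le> C * norm (z' - z)" using Xl[OF zB z t] .
        have "f (X z' t) - f (X z t) - ?D (X z t) (Y z (z' - z) t) =
            ?D (X z t) (?u t) + (f (X z t + ?w) - f (X z t) - ?D (X z t) ?w)"
          by (simp add: linear_diff[OF lin[OF z t]])
        also have "norm \<dots> \<le> L * norm (?u t) + ?\<eta> * norm ?w"
          using L(3)[OF XK(1)[OF z t]] d1(2)[OF XK(1)[OF z t], of ?w] w zd
          by (intro norm_triangle_le add_mono) auto
        also have "\<dots> \<le> L * norm (?u t) + ?\<eta> * (C * norm (z' - z))"
          using w \<eta>' by (intro add_left_mono mult_left_mono) auto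
        finally show "norm (f (X z' t) - f (X z t) - ?D (X z t) (Y z (z' - z) t)) \<le>
            L * norm (?u t) + ?\<eta> * (C * norm (z' - z))" .
      next
        show "0 \<le> ?\<eta> * (C * norm (z' - z))" using \<eta>' C by (intro mult_nonneg_nonneg) auto
      qed
      also have "\<dots> = \<eta> * norm (z' - z)" using C by (simp add: X0[OF z] X0[OF zB] Y0[OF z])
      finally show "norm (?u t) \<le> \<eta> * norm (z' - z)" .
    qed (use d1 d2 C in auto)
  qed
  have cY: "isCont (\<lambda>z. Y z h t) z" if z: "z \<in> ?B" and t: "t \<in> {0..1}" for z t h
    unfolding continuous_at_eps_delta
  proof (intro allI impI)
    fix \<eta> :: real assume \<eta>: "\<eta> > 0"
    have "continuous_on {0..1} (Y z h)"
      by (rule has_vector_derivative_continuous_on[OF Yd[OF z]])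
    then obtain M where M: "M > 0" "\<And>t. t \<in> {0..1} \<Longrightarrow> norm (Y z h t) \<le> M"
      using compact_imp_bounded[OF compact_continuous_image[of "{0..1}" "Y z h"]]
      unfolding bounded_pos by auto
    \<comment> \<open>Chosen so that Gronwall yields \<open>\<eta> / 2\<close>, which is strictly
      below \<open>\<eta>\<close>.\<close>
    let ?\<eta> = "\<eta> / (4 * exp (2 * L) * M)"
    have \<eta>': "?\<eta> > 0" using \<eta> M by simp
    obtain d1 where d1: "d1 > 0" "\<And>x y v. x \<in> K \<Longrightarrow> norm y < d1 \<Longrightarrow> norm (?D (x + y) v - ?D x v) \<le> ?\<eta> * norm v"
      using uniform_derivative_near_compact[OF U K f \<eta>'] by metis
    obtain d2 where d2: "d2 > 0" "\<And>z'. norm (z' - z) < d2 \<Longrightarrow> z' \<in> ?B" using near[OF z] by blast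
    show "\<exists>d>0. \<forall>z'. dist z' z < d \<longrightarrow> dist (Y z' h t) (Y z h t) < \<eta>"
    proof (intro exI[of _ "min d2 (d1 / C)"] conjI allI impI)
      fix z' assume z': "dist z' z < min d2 (d1 / C)"
      then have zB: "z' \<in> ?B" and zd: "C * norm (z' - z) < d1"
        using d2(2) C by (auto simp: field_simps dist_norm)
      let ?u = "\<lambda>t. Y z' h t - Y z h t"
      have "norm (?u t) \<le> 2 * exp (2 * L) * (norm (?u 0) + ?\<eta> * M)"
      proof (rule gronwall_bound[OF _ _ L(1) _ t])
        fix t :: real assume t: "t \<in> {0..1}"
        show "(?u has_vector_derivative ?D (X z' t) (Y z' h t) - ?D (X z t) (Y z h t)) (at t within {0..1})"
          by (intro has_vector_derivative_diff Yd z zB t)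
        let ?w = "X z' t - X z t"
        have w: "norm ?w < d1" using Xl[OF zB z t] zd by simp
        have "?D (X z' t) (Y z' h t) - ?D (X z t) (Y z h t) =
            ?D (X z' t) (?u t) + (?D (X z t + ?w) (Y z h t) - ?D (X z t) (Y z h t))"
          by (simp add: linear_diff[OF lin[OF zB t]])
        also have "norm \<dots> \<le> L * norm (?u t) + ?\<eta> * norm (Y z h t)"
          using L(3)[OF XK(1)[OF zB t]] d1(2)[OF XK(1)[OF z t] w]
          by (intro norm_triangle_le add_mono) auto
        also have "\<dots> \<le> L * norm (?u t) + ?\<eta> * M"
          using M(2)[OF t] \<eta>' by (intro add_left_mono mult_left_mono) auto
        finally show "norm (?D (X z' t) (Y z' h t) - ?D (X z t) (Y z h t)) \<le> L * norm (?u t) + ?\<eta> * M" .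
      next
        show "0 \<le> ?\<eta> * M" using \<eta>' M by (intro mult_nonneg_nonneg) auto
      qed
      also have "\<dots> = \<eta> / 2" using M by (simp add: Y0[OF z] Y0[OF zB])
      also have "\<dots> < \<eta>" using \<eta> by simp
      finally show "dist (Y z' h t) (Y z h t) < \<eta>" by (simp add: dist_norm)
    qed (use d1 d2 C in auto)
  qed
  have "solves f U (X z)" if "z \<in> ?B" for z
    using Xs[OF that] K(2) by (auto simp: solves_def)
  from that[OF \<delta> X0 this Y0 Yd der cY] show ?thesis .
qed

section \<open>Higher smoothness of flows and the second variation\<close>

definition augmented :: "('a::real_normed_vector \<Rightarrow> 'a) \<Rightarrow> 'a \<times> 'a \<Rightarrow> 'a \<times> 'a" where
  "augmented f p = (f (fst p), frechet_derivative f (at (fst p)) (snd p))"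

text \<open>The linear part spends one derivative of \<open>f\<close>. Smoothness of the flow of
  order \<open>Suc k\<close> is therefore reduced to order \<open>k\<close> for a system of twice
  the dimension.\<close>

lemma Ck_on_augmented:
  fixes f :: "'a::euclidean_space \<Rightarrow> 'a"
  assumes "open U" "Ck_on (Suc k) U f"
  shows "Ck_on k (U \<times> UNIV) (augmented f)"
proof -
  have op: "open (U \<times> (UNIV :: 'a set))" using assms(1) by (simp add: open_Times)
  note lin = Ck_on_bounded_linear[OF bounded_linear_fst op] Ck_on_bounded_linear[OF bounded_linear_snd op]
  have sub: "fst ` (U \<times> (UNIV :: 'a set)) \<subseteq> U" by auto
  have "Ck_on k (U \<times> UNIV) (\<lambda>p. (f (fst p), frechet_derivative f (at (fst p)) (snd p)))"
    by (rule Ck_on_Pair[OF op Ck_on_compose[OF op assms(1) sub Ck_on_Suc_imp[OF assms(2)] lin(1)]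
        Ck_on_derivative_apply[OF op assms(1,2) lin sub]])
  then show ?thesis unfolding augmented_def[abs_def] .
qed

lemma solves_augmented:
  assumes "solves f U X" "\<And>t. t \<in> {0..1} \<Longrightarrow>
    (Y has_vector_derivative frechet_derivative f (at (X t)) (Y t)) (at t within {0..1})"
  shows "solves (augmented f) (U \<times> UNIV) (\<lambda>t. (X t, Y t))"
  using assms by (auto simp: solves_def augmented_def intro!: has_vector_derivative_Pair)

text \<open>
  The predicate makes the induction over the order of differentiability possible, because its
  step passes from the type \<open>'a\<close> to \<open>'a \<times> 'a\<close>.
\<close>

definition flows_Ck :: "nat \<Rightarrow> 'a::euclidean_space itself \<Rightarrow> bool" where
  "flows_Ck k _ \<longleftrightarrow> (\<forall>(f::'a \<Rightarrow> 'a) U X0. open U \<and> Ck_on k U f \<and> solves f U X0 \<longrightarrow>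
    (\<exists>\<delta>>0. \<exists>X. (\<forall>z\<in>ball (X0 0) \<delta>. X z 0 = z \<and> solves f U (X z)) \<and>
      (\<forall>t\<in>{0..1}. Ck_on k (ball (X0 0) \<delta>) (\<lambda>z. X z t))))"

lemma flows_Ck_1: "flows_Ck 1 TYPE('a::euclidean_space)"
  unfolding flows_Ck_def
proof (intro allI impI, elim conjE)
  fix f :: "'a \<Rightarrow> 'a" and U X0
  assume "open U" "Ck_on 1 U f" "solves f U X0"
  then obtain \<delta> X Y where \<delta>: "\<delta> > 0"
    and X: "\<And>z. z \<in> ball (X0 0) \<delta> \<Longrightarrow> X z 0 = z" "\<And>z. z \<in> ball (X0 0) \<delta> \<Longrightarrow> solves f U (X z)"
    and Y: "\<And>z h. z \<in> ball (X0 0) \<delta> \<Longrightarrow> Y z h 0 = h"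
    and Yd: "\<And>z h t. z \<in> ball (X0 0) \<delta> \<Longrightarrow> t \<in> {0..1} \<Longrightarrow>
      (Y z h has_vector_derivative frechet_derivative f (at (X z t)) (Y z h t)) (at t within {0..1})"
    and der: "\<And>z t. z \<in> ball (X0 0) \<delta> \<Longrightarrow> t \<in> {0..1} \<Longrightarrow> ((\<lambda>z. X z t) has_derivative (\<lambda>h. Y z h t)) (at z)"
    and cY: "\<And>z h t. z \<in> ball (X0 0) \<delta> \<Longrightarrow> t \<in> {0..1} \<Longrightarrow> isCont (\<lambda>z. Y z h t) z"
    by (rule flow_variational) (rule that)
  have "Ck_on (Suc 0) (ball (X0 0) \<delta>) (\<lambda>z. X z t)" if t: "t \<in> {0..1}" for t
    using der[OF _ t] cY[OF _ t]
    by (intro Ck_on_SucI) (auto intro: continuous_at_imp_continuous_on)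
  then show "\<exists>\<delta>>0. \<exists>X. (\<forall>z\<in>ball (X0 0) \<delta>. X z 0 = z \<and> solves f U (X z)) \<and>
      (\<forall>t\<in>{0..1}. Ck_on 1 (ball (X0 0) \<delta>) (\<lambda>z. X z t))"
    using \<delta> X by (intro exI[of _ \<delta>] conjI exI[of _ X]) (auto simp del: Ck_on.simps)
qed

text \<open>The derivative of the flow in direction \<open>h\<close> is the second component of the
  flow of \<open>augmented f\<close> started at \<open>(z, h)\<close>, hence of order
  \<open>k\<close> by assumption. That assumption provides only some flow \<open>P\<close> on a ball
  about \<open>(z, h)\<close>; uniqueness of solutions identifies it with \<open>X\<close> and
  \<open>Y\<close>.\<close>

lemma flows_Ck_Suc:
  assumes "flows_Ck k TYPE('a::euclidean_space \<times> 'a)" "k \<ge> 1"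
  shows "flows_Ck (Suc k) TYPE('a)"
  unfolding flows_Ck_def
proof (intro allI impI, elim conjE)
  fix f :: "'a \<Rightarrow> 'a" and U X0
  assume U: "open U" and f: "Ck_on (Suc k) U f" and X0: "solves f U X0"
  have f1: "Ck_on 1 U f" using Ck_on_mono[OF f, of 1] by (simp del: Ck_on.simps)
  have opU: "open (U \<times> (UNIV :: 'a set))" using U by (simp add: open_Times)
  have af: "Ck_on k (U \<times> UNIV) (augmented f)" using Ck_on_augmented[OF U f] .
  \<comment> \<open>The order must be at least 1 for uniqueness of the augmented solutions.\<close>
  then have af1: "Ck_on 1 (U \<times> UNIV) (augmented f)" using Ck_on_mono assms(2) by blast
  obtain \<delta> X Y where \<delta>: "\<delta> > 0"
    and X: "\<And>z. z \<in> ball (X0 0) \<delta> \<Longrightarrow> X z 0 = z" "\<And>z. z \<in> ball (X0 0) \<delta> \<Longrightarrow> solves f U (X z)"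
    and Y: "\<And>z h. z \<in> ball (X0 0) \<delta> \<Longrightarrow> Y z h 0 = h"
    and Yd: "\<And>z h t. z \<in> ball (X0 0) \<delta> \<Longrightarrow> t \<in> {0..1} \<Longrightarrow>
      (Y z h has_vector_derivative frechet_derivative f (at (X z t)) (Y z h t)) (at t within {0..1})"
    and der: "\<And>z t. z \<in> ball (X0 0) \<delta> \<Longrightarrow> t \<in> {0..1} \<Longrightarrow> ((\<lambda>z. X z t) has_derivative (\<lambda>h. Y z h t)) (at z)"
    and cY: "\<And>z h t. z \<in> ball (X0 0) \<delta> \<Longrightarrow> t \<in> {0..1} \<Longrightarrow> isCont (\<lambda>z. Y z h t) z"
    by (rule flow_variational[OF U f1 X0]) (rule that)
  let ?B = "ball (X0 0) \<delta>"
  have XY: "solves (augmented f) (U \<times> UNIV) (\<lambda>t. (X z t, Y z h t))" if "z \<in> ?B" for z h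
    using X(2)[OF that] Yd[OF that] by (intro solves_augmented) auto
  have CY: "Ck_on k ?B (\<lambda>z. Y z h t)" if t: "t \<in> {0..1}" for h t
  proof (rule Ck_on_local)
    fix z assume z: "z \<in> ?B"
    have "\<exists>d>0. \<exists>P. (\<forall>p\<in>ball (X z 0, Y z h 0) d. P p 0 = p \<and> solves (augmented f) (U \<times> UNIV) (P p)) \<and>
        (\<forall>t\<in>{0..1}. Ck_on k (ball (X z 0, Y z h 0) d) (\<lambda>p. P p t))"
      using assms(1)[unfolded flows_Ck_def, rule_format, OF conjI[OF opU conjI[OF af XY[OF z, of h]]]] .
    then obtain d P where d: "d > 0" and P: "\<And>p. p \<in> ball (z, h) d \<Longrightarrow> P p 0 = p \<and> solves (augmented f) (U \<times> UNIV) (P p)"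
      and PC: "\<And>t. t \<in> {0..1} \<Longrightarrow> Ck_on k (ball (z, h) d) (\<lambda>p. P p t)"
      unfolding X(1)[OF z] Y[OF z] by blast
    let ?W = "ball z d \<inter> ?B"
    have opW: "open ?W" by (simp add: open_Int)
    have zh: "(z', h) \<in> ball (z, h) d" if "z' \<in> ?W" for z'
      using that by (simp add: dist_Pair_Pair)
    have CP: "Ck_on k ?W (\<lambda>z'. snd (P (z', h) t))"
    proof (rule Ck_on_linear_compose[OF bounded_linear_snd opW], rule Ck_on_compose[OF opW _ _ PC[OF t]])
      show "Ck_on k ?W (\<lambda>z'. (z', h))"
        by (intro Ck_on_Pair[OF opW] Ck_on_bounded_linear[OF bounded_linear_ident opW] Ck_on_const)
    qed (use zh in auto)
    have "snd (P (z', h) t) = Y z' h t" if z': "z' \<in> ?W" for z'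
    proof -
      have "P (z', h) t = (X z' t, Y z' h t)"
        by (rule solves_unique[OF opU af1 _ XY _ t]) (use z' P[OF zh[OF z']] X Y in auto)
      then show ?thesis by simp
    qed
    then have "Ck_on k ?W (\<lambda>z. Y z h t)"
      by (rule Ck_on_cong[OF opW _ CP])
    then show "\<exists>W. open W \<and> z \<in> W \<and> Ck_on k W (\<lambda>z. Y z h t)"
      using z d by (intro exI[of _ ?W]) auto
  qed
  have "Ck_on (Suc k) ?B (\<lambda>z. X z t)" if t: "t \<in> {0..1}" for t
    using der[OF _ t] CY[OF t] by (intro Ck_on_SucI) auto
  then show "\<exists>\<delta>>0. \<exists>X. (\<forall>z\<in>ball (X0 0) \<delta>. X z 0 = z \<and> solves f U (X z)) \<and>
      (\<forall>t\<in>{0..1}. Ck_on (Suc k) (ball (X0 0) \<delta>) (\<lambda>z. X z t))"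
    using \<delta> X by (intro exI[of _ \<delta>] conjI exI[of _ X]) (auto simp del: Ck_on.simps)
qed

text \<open>Each step doubles the type: order 3 on \<open>'a\<close> comes from order 1 on a
  fourfold product, by two explicit steps.\<close>

lemma flows_Ck_3: "flows_Ck 3 TYPE('a::euclidean_space)"
proof -
  have "flows_Ck (Suc (Suc 1)) TYPE('a)"
    by (intro flows_Ck_Suc flows_Ck_1) auto
  then show ?thesis by (simp add: numeral_3_eq_3)
qed

text \<open>The family \<open>X\<close> is arbitrary. Near \<open>z\<close> it agrees by uniqueness
  with the one built in \<open>flow_variational\<close>, so its derivative, too, is the solution of
  the variational equation.\<close>

lemma flow_first_variation:
  fixes f :: "'a::euclidean_space \<Rightarrow> 'a"
  assumes "open U" "Ck_on 1 U f" "open W" "\<forall>z\<in>W. X z 0 = z \<and> solves f U (X z)" "z \<in> W"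
  defines "Y \<equiv> \<lambda>z h t. frechet_derivative (\<lambda>z. X z t) (at z) h"
  shows "Y z h 0 = h" "\<And>t. t \<in> {0..1} \<Longrightarrow>
    (Y z h has_vector_derivative frechet_derivative f (at (X z t)) (Y z h t)) (at t within {0..1})"
proof -
  have z: "X z 0 = z" "solves f U (X z)" using assms(4,5) by auto
  obtain \<delta> X' Y' where \<delta>: "\<delta> > 0"
    and X': "\<And>w. w \<in> ball z \<delta> \<Longrightarrow> X' w 0 = w" "\<And>w. w \<in> ball z \<delta> \<Longrightarrow> solves f U (X' w)"
    and Y0: "\<And>w h. w \<in> ball z \<delta> \<Longrightarrow> Y' w h 0 = h"
    and Yd: "\<And>w h t. w \<in> ball z \<delta> \<Longrightarrow> t \<in> {0..1} \<Longrightarrow>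
      (Y' w h has_vector_derivative frechet_derivative f (at (X' w t)) (Y' w h t)) (at t within {0..1})"
    and der: "\<And>w t. w \<in> ball z \<delta> \<Longrightarrow> t \<in> {0..1} \<Longrightarrow> ((\<lambda>z. X' z t) has_derivative (\<lambda>h. Y' w h t)) (at w)"
    and cY: "\<And>w h t. w \<in> ball z \<delta> \<Longrightarrow> t \<in> {0..1} \<Longrightarrow> isCont (\<lambda>z. Y' z h t) w"
    by (rule flow_variational[OF assms(1,2) z(2), unfolded z(1)]) (rule that)
  have zB: "z \<in> ball z \<delta>" using \<delta> by simp
  have XX: "X' z' t = X z' t" if "z' \<in> ball z \<delta> \<inter> W" "t \<in> {0..1}" for z' t
    by (rule solves_unique[OF assms(1,2) _ _ _ that(2)]) (use that(1) X' assms(4) in auto)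
  have YY: "Y' z h t = Y z h t" if "t \<in> {0..1}" for h t
  proof -
    have "((\<lambda>z. X z t) has_derivative (\<lambda>h. Y' z h t)) (at z)"
      by (rule has_derivative_transform_within_open[OF der[OF zB that], of "ball z \<delta> \<inter> W"])
        (use \<delta> assms(3,5) XX[OF _ that] in auto)
    then show ?thesis unfolding Y_def by (simp add: frechet_derivative_eqI)
  qed
  show "Y z h 0 = h" using YY[of 0] Y0[OF zB] by simp
  fix t :: real assume t: "t \<in> {0..1}"
  have "(Y' z h has_vector_derivative frechet_derivative f (at (X z t)) (Y z h t)) (at t within {0..1})"
    using Yd[OF zB t, of h] XX[OF _ t, of z] YY[OF t] \<delta> assms(5) by simp
  then show "(Y z h has_vector_derivative frechet_derivative f (at (X z t)) (Y z h t)) (at t within {0..1})"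
    by (rule has_vector_derivative_transform[OF t, rotated]) (rule YY[symmetric])
qed

text \<open>This is the first variation of the augmented system, at \<open>(z, h)\<close> in the
  direction \<open>(k, 0)\<close>: moving \<open>z\<close> alone by \<open>k\<close> changes the
  orbit by \<open>Y z k\<close> and the variation in direction \<open>h\<close> by
  \<open>Z h k\<close>.\<close>

lemma flow_second_variation:
  fixes f :: "'a::euclidean_space \<Rightarrow> 'a"
  assumes U: "open U" and f: "Ck_on 2 U f" and W: "open W"
    and X: "\<forall>z\<in>W. X z 0 = z \<and> solves f U (X z)" and z: "z \<in> W"
  defines "Y \<equiv> \<lambda>z h t. frechet_derivative (\<lambda>z. X z t) (at z) h"
    and "Z \<equiv> \<lambda>h k t. second_derivative (\<lambda>z. X z t) z h k"
  assumes C2: "\<And>t. t \<in> {0..1} \<Longrightarrow> Ck_on 2 W (\<lambda>z. X z t)"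
  shows "Z h k 0 = 0" "\<And>t. t \<in> {0..1} \<Longrightarrow>
    (Z h k has_vector_derivative second_derivative f (X z t) (Y z h t) (Y z k t) +
      frechet_derivative f (at (X z t)) (Z h k t)) (at t within {0..1})"
proof -
  have f2: "Ck_on (Suc (Suc 0)) U f" using f by (simp add: numeral_2_eq_2)
  then have f1: "Ck_on 1 U f" using Ck_on_Suc_imp[OF f2] by simp
  have opU: "open (U \<times> (UNIV :: 'a set))" using U by (simp add: open_Times)
  have af: "Ck_on 1 (U \<times> UNIV) (augmented f)" using Ck_on_augmented[OF U f2] by simp
  note v = flow_first_variation[OF U f1 W X]
  have opW: "open (W \<times> (UNIV :: 'a set))" using W by (simp add: open_Times)
  define P where "P p t = (X (fst p) t, Y (fst p) (snd p) t)" for p t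
  have P: "\<forall>p\<in>W \<times> UNIV. P p 0 = p \<and> solves (augmented f) (U \<times> UNIV) (P p)"
  proof
    fix p :: "'a \<times> 'a" assume "p \<in> W \<times> UNIV"
    then have p: "fst p \<in> W" by auto
    show "P p 0 = p \<and> solves (augmented f) (U \<times> UNIV) (P p)" unfolding P_def
      using X p v[OF p] by (auto intro!: solves_augmented simp: Y_def)
  qed
  have zh: "(z, h) \<in> W \<times> UNIV" using z by simp
  note w = flow_first_variation[OF opU af opW P zh, where h="(k, 0)"]
  have dP: "frechet_derivative (\<lambda>p. P p t) (at (z, h)) (k, 0) = (Y z k t, Z h k t)" if t: "t \<in> {0..1}" for t
  proof -
    have C: "Ck_on (Suc (Suc 0)) W (\<lambda>z. X z t)" using C2[OF t] by (simp add: numeral_2_eq_2)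
    note lin = Ck_on_bounded_linear[OF bounded_linear_fst opW] Ck_on_bounded_linear[OF bounded_linear_snd opW]
    have sub: "fst ` (W \<times> (UNIV :: 'a set)) \<subseteq> W" by auto
    have "Ck_on (Suc 0) (W \<times> UNIV) (\<lambda>p. P p t)"
      unfolding P_def Y_def
      by (rule Ck_on_Pair[OF opW Ck_on_compose[OF opW W sub Ck_on_Suc_imp[OF C] lin(1)]
        Ck_on_derivative_apply[OF opW W C lin sub]])
    then have "((\<lambda>p. P p t) has_derivative frechet_derivative (\<lambda>p. P p t) (at (z, h))) (at (z, h))"
      by (rule Ck_on_has_derivative[OF _ zh])
    then have "((\<lambda>z'. P (z', h) t) has_derivative
        (\<lambda>k. frechet_derivative (\<lambda>p. P p t) (at (z, h)) (k, 0))) (at z)"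
      by (rule has_derivative_compose[where f="\<lambda>z'. (z', h)", rotated])
        (auto intro!: derivative_eq_intros)
    moreover have "((\<lambda>z'. P (z', h) t) has_derivative (\<lambda>k. (Y z k t, Z h k t))) (at z)"
      unfolding P_def Y_def Z_def second_derivative_def fst_conv snd_conv
      by (rule has_derivative_Pair[OF Ck_on_has_derivative[OF C z] Ck_on_has_derivative[OF Ck_on_derivative[OF C] z]])
    ultimately have "(\<lambda>k. frechet_derivative (\<lambda>p. P p t) (at (z, h)) (k, 0)) = (\<lambda>k. (Y z k t, Z h k t))"
      by (rule has_derivative_unique)
    then show ?thesis by (rule fun_cong)
  qed
  have "(Y z k 0, Z h k 0) = (k, 0)" using w(1) dP[of 0] by simp
  then show "Z h k 0 = 0" by simp
  fix t :: real assume t: "t \<in> {0..1}"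
  have "((\<lambda>t. frechet_derivative (\<lambda>p. P p t) (at (z, h)) (k, 0)) has_vector_derivative
      frechet_derivative (augmented f) (at (P (z, h) t)) (Y z k t, Z h k t)) (at t within {0..1})"
    using w(2)[OF t] dP[OF t] by simp
  then have "((\<lambda>t. (Y z k t, Z h k t)) has_vector_derivative
      frechet_derivative (augmented f) (at (P (z, h) t)) (Y z k t, Z h k t)) (at t within {0..1})"
    by (rule has_vector_derivative_transform[OF t, rotated]) (rule dP[symmetric])
  from bounded_linear.has_vector_derivative[OF bounded_linear_snd this]
  have 1: "(Z h k has_vector_derivative
      snd (frechet_derivative (augmented f) (at (P (z, h) t)) (Y z k t, Z h k t))) (at t within {0..1})" by simp
  define x y where "x = X z t" and "y = Y z h t"
  have x: "x \<in> U" using X z t by (auto simp: solves_def x_def)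
  have xy: "(x, y) \<in> U \<times> UNIV" using x by simp
  have D: "(augmented f has_derivative frechet_derivative (augmented f) (at (x, y))) (at (x, y))"
    by (rule Ck_on_has_derivative[where k=0 and S="U \<times> UNIV"]) (use af xy in auto)
  \<comment> \<open>The second component of \<open>augmented f\<close> depends on the position
    through the derivative of \<open>f\<close>, which yields the second derivative, and linearly on
    the variation, which reproduces the first. The two directions are treated separately and
    added.\<close>
  have s: "snd (frechet_derivative (augmented f) (at (x, y)) (a, b)) =
      second_derivative f x y a + frechet_derivative f (at x) b" for a b
  proof -
    have "((\<lambda>x'. augmented f (x', y)) has_derivative (\<lambda>a. frechet_derivative (augmented f) (at (x, y)) (a, 0))) (at x)"
      by (rule has_derivative_compose[where f="\<lambda>x'. (x', y)", OF _ D]) (auto intro!: derivative_eq_intros)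
    then have "((\<lambda>x'. snd (augmented f (x', y))) has_derivative
        (\<lambda>a. snd (frechet_derivative (augmented f) (at (x, y)) (a, 0)))) (at x)"
      by (rule has_derivative_snd)
    then have "((\<lambda>x'. frechet_derivative f (at x') y) has_derivative
        (\<lambda>a. snd (frechet_derivative (augmented f) (at (x, y)) (a, 0)))) (at x)"
      by (simp add: augmented_def)
    from fun_cong[OF frechet_derivative_eqI[OF this], of a]
    have a: "snd (frechet_derivative (augmented f) (at (x, y)) (a, 0)) = second_derivative f x y a"
      by (simp add: second_derivative_def)
    have lin: "linear (frechet_derivative f (at x))"
      using f1 x by (intro linear_frechet_derivative) simp
    have "((\<lambda>y'. augmented f (x, y')) has_derivative (\<lambda>b. frechet_derivative (augmented f) (at (x, y)) (0, b))) (at y)"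
      by (rule has_derivative_compose[where f="\<lambda>y'. (x, y')", OF _ D]) (auto intro!: derivative_eq_intros)
    then have "((\<lambda>y'. snd (augmented f (x, y'))) has_derivative
        (\<lambda>b. snd (frechet_derivative (augmented f) (at (x, y)) (0, b)))) (at y)"
      by (rule has_derivative_snd)
    then have "(frechet_derivative f (at x) has_derivative
        (\<lambda>b. snd (frechet_derivative (augmented f) (at (x, y)) (0, b)))) (at y)"
      by (simp add: augmented_def)
    moreover have "(frechet_derivative f (at x) has_derivative frechet_derivative f (at x)) (at y)"
      using lin by (simp add: linear_conv_bounded_linear bounded_linear_imp_has_derivative)
    ultimately have b: "snd (frechet_derivative (augmented f) (at (x, y)) (0, b)) = frechet_derivative f (at x) b"
      using has_derivative_unique by metis
    have "frechet_derivative (augmented f) (at (x, y)) ((a, 0) + (0, b)) =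
      frechet_derivative (augmented f) (at (x, y)) (a, 0) + frechet_derivative (augmented f) (at (x, y)) (0, b)"
      using has_derivative_linear[OF D] linear_add by blast
    then show ?thesis using a b by simp
  qed
  show "(Z h k has_vector_derivative second_derivative f (X z t) (Y z h t) (Y z k t) +
      frechet_derivative f (at (X z t)) (Z h k t)) (at t within {0..1})"
    using 1 s[of "Y z k t" "Z h k t"] by (simp add: P_def x_def y_def)
qed

section \<open>Linear equations on a segment\<close>

lemma bounded_bilinear_matrix_matrix_mult:
  "bounded_bilinear ((**) :: real ^ 'n ^ 'm \<Rightarrow> real ^ 'k ^ 'n \<Rightarrow> real ^ 'k ^ 'm)"
proof -
  have "bilinear ((**) :: real ^ 'n ^ 'm \<Rightarrow> real ^ 'k ^ 'n \<Rightarrow> real ^ 'k ^ 'm)"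
    unfolding bilinear_def
    by (auto intro!: linearI simp: matrix_matrix_mult_def vec_eq_iff sum_distrib_left algebra_simps sum.distrib)
  then show ?thesis by (simp add: bilinear_conv_bounded_bilinear)
qed

lemma bounded_bilinear_matrix_vector_mult:
  "bounded_bilinear ((*v) :: real ^ 'n ^ 'm \<Rightarrow> real ^ 'n \<Rightarrow> real ^ 'm)"
proof -
  have "bilinear ((*v) :: real ^ 'n ^ 'm \<Rightarrow> real ^ 'n \<Rightarrow> real ^ 'm)"
    unfolding bilinear_def
    by (auto intro!: linearI simp: matrix_vector_mult_def vec_eq_iff sum_distrib_left algebra_simps sum.distrib)
  then show ?thesis by (simp add: bilinear_conv_bounded_bilinear)
qed

text \<open>Since division by zero gives 0, these hold for \<open>\<theta> = 0\<close> as well, a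
  value that occurs as \<open>\<phi> - T\<close> when \<open>\<phi> = T\<close>.\<close>

lemma segment_scale:
  fixes \<theta> :: real
  shows "s \<in> closed_segment 0 \<theta> \<Longrightarrow> s / \<theta> \<in> {0..1}" "s \<in> closed_segment 0 \<theta> \<Longrightarrow> \<theta> * (s / \<theta>) = s"
    "t \<in> {0..1} \<Longrightarrow> \<theta> * t \<in> closed_segment 0 \<theta>"
    "s \<in> closed_segment 0 \<theta> \<Longrightarrow> closed_segment 0 s \<subseteq> closed_segment 0 \<theta>"
  by (auto simp: in_segment mult.commute subset_closed_segment)

lemma has_vector_derivative_unit_to_segment:
  assumes g: "\<And>t. t \<in> {0..1} \<Longrightarrow> (g has_vector_derivative \<theta> *\<^sub>R g' t) (at t within {0..1})"
    and s: "s \<in> closed_segment 0 \<theta>"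
  shows "((\<lambda>s. g (s / \<theta>)) has_vector_derivative g' (s / \<theta>)) (at s within closed_segment 0 \<theta>)"
proof (cases "\<theta> = 0")
  case True
  then have "closed_segment 0 \<theta> = {s}" using s by auto
  \<comment> \<open>Within a single point every vector is a derivative.\<close>
  then show ?thesis
    by (simp add: has_vector_derivative_def has_derivative_within_singleton_iff bounded_linear_scaleR_left)
next
  case False
  have 1: "((\<lambda>s. s / \<theta>) has_vector_derivative 1 / \<theta>) (at s within closed_segment 0 \<theta>)"
    using False by (auto intro!: derivative_eq_intros simp: has_real_derivative_iff_has_vector_derivative[symmetric])
  have "(\<lambda>s. s / \<theta>) ` closed_segment 0 \<theta> \<subseteq> {0..1}" using segment_scale(1) by blast
  then have "(g has_vector_derivative \<theta> *\<^sub>R g' (s / \<theta>)) (at (s / \<theta>) within (\<lambda>s. s / \<theta>) ` closed_segment 0 \<theta>)"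
    using has_vector_derivative_within_subset[OF g] segment_scale(1)[OF s] by blast
  from vector_diff_chain_within[OF 1 this] False show ?thesis by (simp add: comp_def)
qed

lemma has_vector_derivative_segment_to_unit:
  assumes y: "\<And>s. s \<in> closed_segment 0 \<theta> \<Longrightarrow> (y has_vector_derivative y' s) (at s within closed_segment 0 \<theta>)"
    and t: "t \<in> {0..1}"
  shows "((\<lambda>t. y (\<theta> * t)) has_vector_derivative \<theta> *\<^sub>R y' (\<theta> * t)) (at t within {0..1})"
proof -
  have 1: "((\<lambda>t. \<theta> * t) has_vector_derivative \<theta>) (at t within {0..1})"
    by (auto intro!: derivative_eq_intros simp: has_real_derivative_iff_has_vector_derivative[symmetric])
  have "(\<lambda>t. \<theta> * t) ` {0..1} \<subseteq> closed_segment 0 \<theta>" using segment_scale(3) by blast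
  then have "(y has_vector_derivative y' (\<theta> * t)) (at (\<theta> * t) within (\<lambda>t. \<theta> * t) ` {0..1})"
    using has_vector_derivative_within_subset[OF y[OF segment_scale(3)[OF t]]] by blast
  from vector_diff_chain_within[OF 1 this] show ?thesis by (simp add: comp_def)
qed

lemma continuous_on_segment_to_unit:
  fixes \<theta> :: real
  assumes "continuous_on (closed_segment 0 \<theta>) A"
  shows "continuous_on {0..1} (\<lambda>t. A (\<theta> * t))"
  by (rule continuous_on_compose2[OF assms]) (auto intro: continuous_intros segment_scale(3) simp del: atLeastAtMost_iff)

lemma linear_ode_segment_exists:
  fixes A :: "real \<Rightarrow> 'a \<Rightarrow> 'a::euclidean_space"
  assumes "\<And>s. s \<in> closed_segment 0 \<theta> \<Longrightarrow> linear (A s)"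
    "\<And>b. b \<in> Basis \<Longrightarrow> continuous_on (closed_segment 0 \<theta>) (\<lambda>s. A s b)"
  shows "\<exists>y. y 0 = a \<and> (\<forall>s\<in>closed_segment 0 \<theta>. (y has_vector_derivative A s (y s)) (at s within closed_segment 0 \<theta>))"
proof -
  have "\<exists>y. y 0 = a \<and> (\<forall>t\<in>{0..1}. (y has_vector_derivative \<theta> *\<^sub>R A (\<theta> * t) (y t)) (at t within {0..1}))"
  proof (rule linear_ode_exists)
    show "linear (\<lambda>v. \<theta> *\<^sub>R A (\<theta> * t) v)" if "t \<in> {0..1}" for t
      using assms(1)[OF segment_scale(3)[OF that]] by (rule linear_compose_scale_right)
    show "continuous_on {0..1} (\<lambda>t. \<theta> *\<^sub>R A (\<theta> * t) b)" if "b \<in> Basis" for b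
      using continuous_on_segment_to_unit[OF assms(2)[OF that]] by (intro continuous_intros)
  qed
  then obtain y where y: "y 0 = a"
    "\<And>t. t \<in> {0..1} \<Longrightarrow> (y has_vector_derivative \<theta> *\<^sub>R A (\<theta> * t) (y t)) (at t within {0..1})" by blast
  show ?thesis
    by (intro exI[of _ "\<lambda>s. y (s / \<theta>)"] conjI ballI)
      (use y(1) has_vector_derivative_unit_to_segment[OF y(2)] segment_scale(2) in auto)
qed

lemma linear_ode_segment_unique:
  fixes A :: "real \<Rightarrow> 'a \<Rightarrow> 'a::euclidean_space"
  assumes A: "\<And>s. s \<in> closed_segment 0 \<theta> \<Longrightarrow> linear (A s)"
    "\<And>b. b \<in> Basis \<Longrightarrow> continuous_on (closed_segment 0 \<theta>) (\<lambda>s. A s b)"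
    and y: "\<And>s. s \<in> closed_segment 0 \<theta> \<Longrightarrow> (y has_vector_derivative A s (y s)) (at s within closed_segment 0 \<theta>)"
    and z: "\<And>s. s \<in> closed_segment 0 \<theta> \<Longrightarrow> (z has_vector_derivative A s (z s)) (at s within closed_segment 0 \<theta>)"
    and 0: "y 0 = z 0"
  shows "y \<theta> = z \<theta>"
proof -
  have "y (\<theta> * 1) = z (\<theta> * 1)"
  proof (rule linear_ode_unique[where A="\<lambda>t v. \<theta> *\<^sub>R A (\<theta> * t) v" and b="\<lambda>_. 0" and t=1])
    show "linear (\<lambda>v. \<theta> *\<^sub>R A (\<theta> * t) v)" if "t \<in> {0..1}" for t
      using A(1)[OF segment_scale(3)[OF that]] by (rule linear_compose_scale_right)
    show "continuous_on {0..1} (\<lambda>t. \<theta> *\<^sub>R A (\<theta> * t) b)" if "b \<in> Basis" for b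
      using continuous_on_segment_to_unit[OF A(2)[OF that]] by (intro continuous_intros)
  qed (use has_vector_derivative_segment_to_unit[OF y] has_vector_derivative_segment_to_unit[OF z] 0 in auto)
  then show ?thesis by simp
qed

lemma matrix_inv_eqI:
  fixes A B :: "real ^ 'n ^ 'n"
  assumes "A ** B = mat 1" "B ** A = mat 1"
  shows "matrix_inv A = B"
proof -
  have "matrix_inv A ** A = mat 1"
    unfolding matrix_inv_def using someI[of "\<lambda>A'. A ** A' = mat 1 \<and> A' ** A = mat 1" B] assms by blast
  then have "matrix_inv A ** (A ** B) = B" by (simp add: matrix_mul_assoc)
  then show ?thesis by (simp add: assms(1))
qed

text \<open>The inverse is produced as the solution \<open>Z\<close> of the adjoint equation,
  because then \<open>Z s ** M s\<close> has derivative 0. In this way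
  \<open>matrix_inv (M s)\<close> is known to be differentiable in \<open>s\<close>.\<close>

lemma fundamental_inverse:
  fixes J :: "real \<Rightarrow> real ^ 'n ^ 'n"
  assumes J: "continuous_on (closed_segment 0 \<theta>) J" and M0: "M 0 = mat 1"
    and M: "\<And>s. s \<in> closed_segment 0 \<theta> \<Longrightarrow> (M has_vector_derivative J s ** M s) (at s within closed_segment 0 \<theta>)"
  obtains Z where "\<And>s. s \<in> closed_segment 0 \<theta> \<Longrightarrow> (Z has_vector_derivative - (Z s ** J s)) (at s within closed_segment 0 \<theta>)"
    "\<And>s. s \<in> closed_segment 0 \<theta> \<Longrightarrow> Z s ** M s = mat 1"
    "\<And>s. s \<in> closed_segment 0 \<theta> \<Longrightarrow> M s ** Z s = mat 1"
    "\<And>s. s \<in> closed_segment 0 \<theta> \<Longrightarrow> matrix_inv (M s) = Z s"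
proof -
  interpret mm: bounded_bilinear "(**) :: real ^ 'n ^ 'n \<Rightarrow> real ^ 'n ^ 'n \<Rightarrow> real ^ 'n ^ 'n"
    by (rule bounded_bilinear_matrix_matrix_mult)
  have "\<exists>Z. Z 0 = mat 1 \<and> (\<forall>s\<in>closed_segment 0 \<theta>. (Z has_vector_derivative - (Z s ** J s)) (at s within closed_segment 0 \<theta>))"
  proof (rule linear_ode_segment_exists)
    show "linear (\<lambda>Z :: real ^ 'n ^ 'n. - (Z ** J s))" for s
      by (rule linear_compose_neg) (rule bounded_linear.linear[OF mm.bounded_linear_left])
    show "continuous_on (closed_segment 0 \<theta>) (\<lambda>s. - (b ** J s))" for b :: "real ^ 'n ^ 'n"
      by (intro continuous_on_minus mm.continuous_on continuous_on_const J)
  qed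
  then obtain Z where Z0: "Z 0 = mat 1"
    and Z: "\<And>s. s \<in> closed_segment 0 \<theta> \<Longrightarrow> (Z has_vector_derivative - (Z s ** J s)) (at s within closed_segment 0 \<theta>)"
    by blast
  have "((\<lambda>s. Z s ** M s) has_vector_derivative 0) (at s within closed_segment 0 \<theta>)" if "s \<in> closed_segment 0 \<theta>" for s
    using mm.has_vector_derivative[OF Z[OF that] M[OF that]]
    by (simp add: mm.minus_left matrix_mul_assoc)
  then obtain C where C: "\<And>s. s \<in> closed_segment 0 \<theta> \<Longrightarrow> Z s ** M s = C"
    using has_vector_derivative_zero_constant[OF convex_closed_segment, of 0 \<theta> "\<lambda>s. Z s ** M s" thesis]
    by blast
  have "C = mat 1" using C[of 0] Z0 M0 by simp
  with C have ZM: "Z s ** M s = mat 1" if "s \<in> closed_segment 0 \<theta>" for s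
    using that by simp
  then have MZ: "M s ** Z s = mat 1" if "s \<in> closed_segment 0 \<theta>" for s
    using that matrix_left_right_inverse by blast
  have inv: "matrix_inv (M s) = Z s" if "s \<in> closed_segment 0 \<theta>" for s
    using matrix_inv_eqI[OF MZ[OF that] ZM[OF that]] .
  show ?thesis using that[OF Z ZM MZ inv] .
qed

text \<open>Multiplication by the inverse fundamental matrix removes the linear part:
  \<open>Z s *v y s\<close> has derivative \<open>Z s *v b s\<close>. The fundamental theorem of
  calculus is applied to the oriented integral, so negative \<open>s\<close> is covered.\<close>

lemma variation_of_constants:
  fixes J :: "real \<Rightarrow> real ^ 'n ^ 'n" and b y :: "real \<Rightarrow> real ^ 'n"
  assumes J: "continuous_on (closed_segment 0 \<theta>) J" and M0: "M 0 = mat 1"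
    and M: "\<And>s. s \<in> closed_segment 0 \<theta> \<Longrightarrow> (M has_vector_derivative J s ** M s) (at s within closed_segment 0 \<theta>)"
    and y0: "y 0 = 0"
    and y: "\<And>s. s \<in> closed_segment 0 \<theta> \<Longrightarrow> (y has_vector_derivative J s *v y s + b s) (at s within closed_segment 0 \<theta>)"
    and b: "continuous_on (closed_segment 0 \<theta>) b" and s: "s \<in> closed_segment 0 \<theta>"
  shows "y s = M s *v (LBINT r=ereal 0..ereal s. matrix_inv (M r) *v b r)"
proof -
  interpret mv: bounded_bilinear "(*v) :: real ^ 'n ^ 'n \<Rightarrow> real ^ 'n \<Rightarrow> real ^ 'n"
    by (rule bounded_bilinear_matrix_vector_mult)
  obtain Z where Z: "\<And>s. s \<in> closed_segment 0 \<theta> \<Longrightarrow> (Z has_vector_derivative - (Z s ** J s)) (at s within closed_segment 0 \<theta>)"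
    and ZM: "\<And>s. s \<in> closed_segment 0 \<theta> \<Longrightarrow> Z s ** M s = mat 1"
    and MZ: "\<And>s. s \<in> closed_segment 0 \<theta> \<Longrightarrow> M s ** Z s = mat 1"
    and inv: "\<And>s. s \<in> closed_segment 0 \<theta> \<Longrightarrow> matrix_inv (M s) = Z s"
    by (rule fundamental_inverse[OF J M0 M]) (assumption | (rule that; assumption))+
  have sub: "closed_segment 0 s \<subseteq> closed_segment 0 \<theta>" using segment_scale(4)[OF s] .
  have seg: "closed_segment 0 s = {min 0 s..max 0 s}" by (simp add: closed_segment_eq_real_ivl min_def max_def)
  have cZ: "continuous_on (closed_segment 0 \<theta>) Z"
    by (rule has_vector_derivative_continuous_on[OF Z])
  have D: "((\<lambda>s. Z s *v y s) has_vector_derivative Z r *v b r) (at r within closed_segment 0 \<theta>)"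
    if "r \<in> closed_segment 0 \<theta>" for r
    using mv.has_vector_derivative[OF Z[OF that] y[OF that]]
    by (simp add: mv.minus_left mv.add_right matrix_vector_mul_assoc)
  have "(LBINT r=ereal 0..ereal s. matrix_inv (M r) *v b r) = (LBINT r=ereal 0..ereal s. Z r *v b r)"
  proof (rule interval_integral_cong)
    fix r assume "r \<in> einterval (min (ereal 0) (ereal s)) (max (ereal 0) (ereal s))"
    then have "r \<in> closed_segment 0 s" unfolding seg by (auto simp: einterval_def min_def max_def split: if_splits)
    then show "matrix_inv (M r) *v b r = Z r *v b r" using inv sub by auto
  qed
  also have "\<dots> = Z s *v y s - Z 0 *v y 0"
  proof (rule interval_integral_FTC_finite)
    show "continuous_on {min 0 s..max 0 s} (\<lambda>r. Z r *v b r)"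
      unfolding seg[symmetric]
      by (rule continuous_on_subset[OF mv.continuous_on[OF cZ b] sub])
    show "((\<lambda>s. Z s *v y s) has_vector_derivative Z r *v b r) (at r within {min 0 s..max 0 s})"
      if "min 0 s \<le> r" "r \<le> max 0 s" for r
    proof -
      have "r \<in> closed_segment 0 s" unfolding seg using that by simp
      then show ?thesis
        using has_vector_derivative_within_subset[OF D sub] sub unfolding seg by blast
    qed
  qed
  finally have "M s *v (LBINT r=ereal 0..ereal s. matrix_inv (M r) *v b r) = (M s ** Z s) *v y s"
    by (simp add: y0 mv.zero_right matrix_vector_mul_assoc)
  then show ?thesis using MZ[OF s] by simp
qed

section \<open>The flow and its fundamental matrix\<close>

text \<open>Replaces the definite description by any solution at hand. Uniqueness is that of the
  autonomous system \<open>?f\<close>, in which time is a coordinate and both components are scaled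
  by \<open>s\<close>, so that the segment from 0 to \<open>s\<close> becomes the unit
  interval.\<close>

lemma flow_eqI:
  fixes F :: "real \<Rightarrow> real ^ 'p \<Rightarrow> real ^ 'p::finite"
  assumes "open D" and F: "Ck_on 1 (UNIV \<times> D) (\<lambda>(s, x). F s x)"
    and x: "\<And>s. s \<in> closed_segment 0 \<theta> \<Longrightarrow> x s \<in> D"
      "\<And>s. s \<in> closed_segment 0 \<theta> \<Longrightarrow> (x has_vector_derivative F s (x s)) (at s within closed_segment 0 \<theta>)"
    and s: "s \<in> closed_segment 0 \<theta>"
  shows "flow F D s (x 0) = x s"
  unfolding flow_def
proof (rule the_equality)
  have sub: "closed_segment 0 s \<subseteq> closed_segment 0 \<theta>" using segment_scale(4)[OF s] .
  have x': "x r \<in> D \<and> (x has_vector_derivative F r (x r)) (at r within closed_segment 0 s)"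
    if "r \<in> closed_segment 0 s" for r
    using x sub that has_vector_derivative_within_subset[OF x(2) sub] by blast
  show ex: "\<exists>y. y 0 = x 0 \<and> y s = x s \<and> (\<forall>r\<in>closed_segment 0 s. y r \<in> D \<and>
      (y has_vector_derivative F r (y r)) (at r within closed_segment 0 s))"
    using x' by blast
  let ?f = "\<lambda>p :: real \<times> (real ^ 'p). (s, s *\<^sub>R F (fst p) (snd p))"
  have op: "open ((UNIV :: real set) \<times> D)" using assms(1) by (simp add: open_Times)
  have f: "Ck_on 1 (UNIV \<times> D) ?f"
    using F by (intro Ck_on_Pair[OF op] Ck_on_const Ck_on_linear_compose[OF bounded_linear_scaleR_right op])
      (simp add: case_prod_unfold)
  have sol: "solves ?f (UNIV \<times> D) (\<lambda>t. (s * t, y (s * t)))"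
    if "\<And>r. r \<in> closed_segment 0 s \<Longrightarrow> y r \<in> D \<and> (y has_vector_derivative F r (y r)) (at r within closed_segment 0 s)" for y
    unfolding solves_def
  proof (intro ballI conjI)
    fix t :: real assume t: "t \<in> {0..1}"
    show "(s * t, y (s * t)) \<in> UNIV \<times> D" using that segment_scale(3)[OF t] by auto
    have "((\<lambda>t. s * t) has_vector_derivative s) (at t within {0..1})"
      by (auto intro!: derivative_eq_intros simp: has_real_derivative_iff_has_vector_derivative[symmetric])
    moreover have "((\<lambda>t. y (s * t)) has_vector_derivative s *\<^sub>R F (s * t) (y (s * t))) (at t within {0..1})"
      by (rule has_vector_derivative_segment_to_unit[OF _ t]) (use that in blast)
    ultimately show "((\<lambda>t. (s * t, y (s * t))) has_vector_derivative ?f (s * t, y (s * t))) (at t within {0..1})"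
      by (auto intro: has_vector_derivative_Pair)
  qed
  fix w assume "\<exists>y. y 0 = x 0 \<and> y s = w \<and> (\<forall>r\<in>closed_segment 0 s. y r \<in> D \<and>
      (y has_vector_derivative F r (y r)) (at r within closed_segment 0 s))"
  then obtain y where y: "y 0 = x 0" "y s = w" "\<And>r. r \<in> closed_segment 0 s \<Longrightarrow> y r \<in> D \<and>
      (y has_vector_derivative F r (y r)) (at r within closed_segment 0 s)" by blast
  have "(s * 1, y (s * 1)) = (s * 1, x (s * 1))"
    by (rule solves_unique[OF op f sol[OF y(3)] sol[OF x'], of 1]) (use y(1) in auto)
  then show "w = x s" using y(2) by simp
qed

text \<open>The description of \<open>fund_matrix\<close> mentions \<open>flow\<close> along the
  whole segment; once an explicit orbit \<open>x\<close> stands there, uniqueness for linear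
  equations decides.\<close>

lemma fund_matrix_eqI:
  fixes F :: "real \<Rightarrow> real ^ 'p \<Rightarrow> real ^ 'p::finite"
  assumes fl: "\<And>s. s \<in> closed_segment 0 \<theta> \<Longrightarrow> flow F D s z = x s"
    and J: "continuous_on (closed_segment 0 \<theta>) (\<lambda>s. jacobian (F s) (at (x s)))"
    and M0: "M 0 = mat 1"
    and M: "\<And>s. s \<in> closed_segment 0 \<theta> \<Longrightarrow>
      (M has_vector_derivative jacobian (F s) (at (x s)) ** M s) (at s within closed_segment 0 \<theta>)"
    and s: "s \<in> closed_segment 0 \<theta>"
  shows "fund_matrix F D s z = M s"
  unfolding fund_matrix_def
proof (rule the_equality)
  interpret mm: bounded_bilinear "(**) :: real ^ 'p ^ 'p \<Rightarrow> real ^ 'p ^ 'p \<Rightarrow> real ^ 'p ^ 'p"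
    by (rule bounded_bilinear_matrix_matrix_mult)
  have sub: "closed_segment 0 s \<subseteq> closed_segment 0 \<theta>" using segment_scale(4)[OF s] .
  have M': "(M has_vector_derivative jacobian (F r) (at (x r)) ** M r) (at r within closed_segment 0 s)"
    if "r \<in> closed_segment 0 s" for r
    using has_vector_derivative_within_subset[OF M sub] sub that by blast
  show "\<exists>Y. Y 0 = mat 1 \<and> Y s = M s \<and> (\<forall>r\<in>closed_segment 0 s.
      (Y has_vector_derivative jacobian (F r) (at (flow F D r z)) ** Y r) (at r within closed_segment 0 s))"
    using M0 M' fl sub by (intro exI[of _ M]) auto
  fix w assume "\<exists>Y. Y 0 = mat 1 \<and> Y s = w \<and> (\<forall>r\<in>closed_segment 0 s.
      (Y has_vector_derivative jacobian (F r) (at (flow F D r z)) ** Y r) (at r within closed_segment 0 s))"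
  then obtain Y where Y: "Y 0 = mat 1" "Y s = w" "\<And>r. r \<in> closed_segment 0 s \<Longrightarrow>
      (Y has_vector_derivative jacobian (F r) (at (x r)) ** Y r) (at r within closed_segment 0 s)"
    using fl sub by (metis (no_types, lifting) subsetD)
  have "Y s = M s"
  proof (rule linear_ode_segment_unique[where A="\<lambda>r Y. jacobian (F r) (at (x r)) ** Y"])
    show "linear ((**) (jacobian (F r) (at (x r))) :: real ^ 'p ^ 'p \<Rightarrow> _)" for r
      by (rule bounded_linear.linear[OF mm.bounded_linear_right])
    show "continuous_on (closed_segment 0 s) (\<lambda>r. jacobian (F r) (at (x r)) ** b)" for b :: "real ^ 'p ^ 'p"
      by (intro mm.continuous_on continuous_on_const continuous_on_subset[OF J sub])
  qed (use Y M' M0 in auto)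
  then show "w = M s" using Y(2) by simp
qed

section \<open>Dependence of the flow on the initial value and the parameter\<close>

text \<open>This lemma and the next two carry derivatives between a map and its restrictions or
  components: \<open>E\<close> embeds the directions of interest, \<open>L\<close> projects or
  scales the values.\<close>

lemma has_derivative_affine_compose:
  assumes "bounded_linear L" "bounded_linear E" "(f has_derivative f') (at (d + E x))"
  shows "((\<lambda>x. c + L (f (d + E x))) has_derivative (\<lambda>h. L (f' (E h)))) (at x)"
proof -
  have "((\<lambda>x. d + E x) has_derivative E) (at x)"
    using has_derivative_add[OF has_derivative_const bounded_linear_imp_has_derivative[OF assms(2)]] by simp
  from has_derivative_compose[OF this assms(3)]
  have "((\<lambda>x. f (d + E x)) has_derivative (\<lambda>h. f' (E h))) (at x)" .
  from has_derivative_add[OF has_derivative_const bounded_linear.has_derivative[OF assms(1) this]]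
  show ?thesis by simp
qed

lemma frechet_derivative_affine_compose:
  assumes "bounded_linear L" "bounded_linear E" "f differentiable at (d + E x)"
  shows "frechet_derivative (\<lambda>x. c + L (f (d + E x))) (at x) h = L (frechet_derivative f (at (d + E x)) (E h))"
  unfolding frechet_derivative_eqI[OF has_derivative_affine_compose[OF assms(1,2)
      assms(3)[unfolded frechet_derivative_works], of c]] ..

lemma second_derivative_affine_compose:
  fixes f :: "'a::euclidean_space \<Rightarrow> 'b::euclidean_space" and E :: "'c::euclidean_space \<Rightarrow> 'a"
    and L :: "'b \<Rightarrow> 'd::euclidean_space"
  assumes L: "bounded_linear L" and E: "bounded_linear E" and U: "open U" and f: "Ck_on 2 U f" and x: "d + E x \<in> U"
  shows "second_derivative (\<lambda>x. c + L (f (d + E x))) x h k = L (second_derivative f (d + E x) (E h) (E k))"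
proof -
  have f': "Ck_on (Suc (Suc 0)) U f" using f by (simp add: numeral_2_eq_2)
  have op: "open ((\<lambda>x. d + E x) -` U)"
    by (rule open_vimage[OF U]) (intro continuous_intros linear_continuous_on[OF E])
  have "((\<lambda>y. frechet_derivative f (at y) (E h)) has_derivative second_derivative f (d + E x) (E h)) (at (d + E x))"
    unfolding second_derivative_def by (rule Ck_on_has_derivative[OF Ck_on_derivative[OF f'] x])
  from has_derivative_affine_compose[OF L E this, of 0]
  have "((\<lambda>x. frechet_derivative (\<lambda>x. c + L (f (d + E x))) (at x) h) has_derivative
      (\<lambda>k. L (second_derivative f (d + E x) (E h) (E k)))) (at x)"
  proof (rule has_derivative_transform_within_open[OF _ op])
    show "0 + L (frechet_derivative f (at (d + E y)) (E h)) = frechet_derivative (\<lambda>x. c + L (f (d + E x))) (at y) h"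
      if "y \<in> (\<lambda>x. d + E x) -` U" for y
      using frechet_derivative_affine_compose[OF L E, of f d y c h] f' that by simp
  qed (use x in simp)
  then show ?thesis unfolding second_derivative_def by (simp add: frechet_derivative_eqI)
qed

lemma linear_second_derivative:
  assumes "Ck_on 2 U f" "x \<in> U"
  shows "linear (second_derivative f x h)"
  unfolding second_derivative_def using assms
  by (intro linear_frechet_derivative) (simp add: numeral_2_eq_2)

lemma second_derivative_eq_double_sum:
  fixes f :: "'a::euclidean_space \<Rightarrow> 'b::euclidean_space"
  assumes "open U" "Ck_on 2 U f" "x \<in> U"
  shows "second_derivative f x h k =
    (\<Sum>b\<in>Basis. \<Sum>c\<in>Basis. (h \<bullet> b) *\<^sub>R (k \<bullet> c) *\<^sub>R second_derivative f x b c)"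
  unfolding second_derivative_eq_sum_Basis[OF assms, of h] scaleR_sum_right[symmetric]
  by (intro sum.cong refl arg_cong[where f="scaleR _"] linear_eq_sum_Basis linear_second_derivative[OF assms(2,3)])

lemma Ck_on_second_derivative:
  "Ck_on (Suc (Suc k)) S f \<Longrightarrow> Ck_on k S (\<lambda>x. second_derivative f x b c)"
  unfolding second_derivative_def by (intro Ck_on_derivative)

lemma continuous_on_second_derivative:
  fixes f :: "'a::euclidean_space \<Rightarrow> 'b::euclidean_space"
  assumes U: "open U" and f: "Ck_on 2 U f" and p: "continuous_on S p" "p ` S \<subseteq> U"
    and hk: "continuous_on S h" "continuous_on S k"
  shows "continuous_on S (\<lambda>s. second_derivative f (p s) (h s) (k s))"
proof -
  have "Ck_on 0 U (\<lambda>x. second_derivative f x b c)" for b c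
    using f by (intro Ck_on_second_derivative) (simp add: numeral_2_eq_2)
  then have "continuous_on U (\<lambda>x. second_derivative f x b c)" for b c by simp
  then have "continuous_on S (\<lambda>s. second_derivative f (p s) b c)" for b c
    by (rule continuous_on_compose2[OF _ p])
  then have "continuous_on S (\<lambda>s. \<Sum>b\<in>Basis. \<Sum>c\<in>Basis. (h s \<bullet> b) *\<^sub>R (k s \<bullet> c) *\<^sub>R second_derivative f (p s) b c)"
    by (intro continuous_intros hk)
  then show ?thesis
    by (rule continuous_on_eq) (rule second_derivative_eq_double_sum[OF U f, symmetric], use p(2) in auto)
qed

lemma Ck_on_slice:
  fixes F :: "'s::euclidean_space \<Rightarrow> 'x::euclidean_space \<Rightarrow> 'y::euclidean_space"
  assumes "open D" "Ck_on k (UNIV \<times> D) (\<lambda>(s, x). F s x)"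
  shows "Ck_on k D (F s)"
proof -
  have "open ((UNIV :: 's set) \<times> D)" using assms(1) by (simp add: open_Times)
  from Ck_on_compose[OF assms(1) this _ assms(2)
      Ck_on_Pair[OF assms(1) Ck_on_const[of _ _ s] Ck_on_bounded_linear[OF bounded_linear_ident assms(1)]]]
  show ?thesis by auto
qed

lemma frechet_derivative_slice:
  fixes F :: "'s::euclidean_space \<Rightarrow> 'x::euclidean_space \<Rightarrow> 'y::euclidean_space"
  assumes "open D" "Ck_on (Suc k) (UNIV \<times> D) (\<lambda>(s, x). F s x)" "x \<in> D"
  shows "frechet_derivative (F s) (at x) h = frechet_derivative (\<lambda>(s, x). F s x) (at (s, x)) (0, h)"
proof -
  have "((\<lambda>(s, x). F s x) has_derivative frechet_derivative (\<lambda>(s, x). F s x) (at (s, x))) (at (s, x))"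
    by (rule Ck_on_has_derivative[OF assms(2)]) (use assms(3) in simp)
  then have "((\<lambda>x. (\<lambda>(s, x). F s x) (s, x)) has_derivative
      (\<lambda>h. frechet_derivative (\<lambda>(s, x). F s x) (at (s, x)) (0, h))) (at x)"
    by (rule has_derivative_compose[where f="\<lambda>x. (s, x)", rotated]) (auto intro!: derivative_eq_intros)
  then show ?thesis by (simp add: frechet_derivative_eqI)
qed

text \<open>Continuity of \<open>m\<close> is enough because the factor \<open>t\<close> vanishes at
  0. All terms of higher order in the parameter can thus be collected in one function
  \<open>m\<close>.\<close>

lemma has_vector_derivative_scaleR_id:
  fixes m :: "real \<Rightarrow> 'a::real_normed_vector"
  assumes "isCont m 0"
  shows "((\<lambda>t. t *\<^sub>R m t) has_vector_derivative m 0) (at 0)"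
  unfolding has_vector_derivative_def has_derivative_at_alt
proof (intro conjI allI impI)
  show "bounded_linear (\<lambda>x. x *\<^sub>R m 0)" by (rule bounded_linear_scaleR_left)
  fix e :: real assume "e > 0"
  then obtain d where d: "d > 0" "\<And>t. dist t 0 < d \<Longrightarrow> dist (m t) (m 0) < e"
    using assms unfolding continuous_at_eps_delta by blast
  show "\<exists>d>0. \<forall>y. norm (y - 0) < d \<longrightarrow> norm (y *\<^sub>R m y - 0 *\<^sub>R m 0 - (y - 0) *\<^sub>R m 0) \<le> e * norm (y - 0)"
  proof (intro exI[of _ d] conjI allI impI d(1))
    fix y :: real assume "norm (y - 0) < d"
    then have "norm (m y - m 0) \<le> e" using d(2)[of y] by (simp add: dist_norm)
    then have "\<bar>y\<bar> * norm (m y - m 0) \<le> \<bar>y\<bar> * e" by (intro mult_left_mono) auto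
    then show "norm (y *\<^sub>R m y - 0 *\<^sub>R m 0 - (y - 0) *\<^sub>R m 0) \<le> e * norm (y - 0)"
      by (simp add: scaleR_diff_right[symmetric] mult.commute)
  qed
qed

text \<open>Reads off the components that move with constant speed, such as time, the parameter and
  their variations.\<close>

lemma antiderivative_unique:
  fixes y z :: "real \<Rightarrow> 'a::euclidean_space"
  assumes "\<And>t. t \<in> {0..1} \<Longrightarrow> (y has_vector_derivative b t) (at t within {0..1})"
    "\<And>t. t \<in> {0..1} \<Longrightarrow> (z has_vector_derivative b t) (at t within {0..1})"
    "y 0 = z 0" "t \<in> {0..1}"
  shows "y t = z t"
  by (rule linear_ode_unique[where A="\<lambda>_ _. 0" and b=b and t=t])
    (use assms in \<open>auto intro: linear_zero\<close>)

text \<open>For \<open>\<theta> = 0\<close> the segment degenerates and \<open>\<theta> / \<theta> = 0\<close>.\<close>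

lemma unit_to_segment_end:
  fixes g :: "real \<Rightarrow> 'a::euclidean_space"
  assumes "\<And>t. t \<in> {0..1} \<Longrightarrow> (g has_vector_derivative \<theta> *\<^sub>R g' t) (at t within {0..1})"
  shows "g (\<theta> / \<theta>) = g 1"
proof (cases "\<theta> = 0")
  case True
  have "g 1 = g 0"
    by (rule antiderivative_unique[where b="\<lambda>_. 0" and z="\<lambda>_. g 0"]) (use assms True in auto)
  then show ?thesis using True by simp
qed simp

lemma interval_integral_segment_cong:
  fixes f g :: "real \<Rightarrow> 'a::euclidean_space"
  assumes "\<And>r. r \<in> closed_segment 0 s \<Longrightarrow> f r = g r"
  shows "(LBINT r=ereal 0..ereal s. f r) = (LBINT r=ereal 0..ereal s. g r)"
  by (rule interval_integral_cong, rule assms)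
    (auto simp: einterval_def closed_segment_eq_real_ivl min_def max_def split: if_splits)

section \<open>The system with time and parameter as state variables\<close>

definition rhs_state ::
  "(nat \<Rightarrow> real \<Rightarrow> real ^ 'p \<Rightarrow> real ^ 'p) \<Rightarrow> (real \<Rightarrow> real ^ 'p \<Rightarrow> real \<Rightarrow> real ^ 'p) \<Rightarrow>
   real \<times> (real ^ 'p::finite) \<times> real \<Rightarrow> real ^ 'p" where
  "rhs_state F R p = rhs F R (fst p) (fst (snd p)) (snd (snd p))"

context
  fixes F :: "nat \<Rightarrow> real \<Rightarrow> real ^ 'p \<Rightarrow> real ^ 'p::finite"
    and R :: "real \<Rightarrow> real ^ 'p \<Rightarrow> real \<Rightarrow> real ^ 'p"
    and D :: "(real ^ 'p) set" and \<epsilon>0 :: real and U :: "(real \<times> (real ^ 'p) \<times> real) set"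
  defines "U \<equiv> UNIV \<times> D \<times> {-\<epsilon>0<..<\<epsilon>0}"
  assumes D: "open D" and \<epsilon>0: "0 < \<epsilon>0"
    and F: "\<And>i. i \<in> {0, 1, 2} \<Longrightarrow> Ck_on 3 (UNIV \<times> D) (\<lambda>(\<theta>, x). F i \<theta> x)"
    and R: "Ck_on 3 U (\<lambda>(\<theta>, x, \<epsilon>). R \<theta> x \<epsilon>)"
begin

lemma open_U: "open U"
  unfolding U_def by (intro open_Times D) auto

lemma open_UD: "open ((UNIV :: real set) \<times> D)"
  by (intro open_Times D) auto

lemma F1: "i \<in> {0, 1, 2} \<Longrightarrow> Ck_on (Suc 0) (UNIV \<times> D) (\<lambda>(\<theta>, x). F i \<theta> x)"
  by (rule Ck_on_mono[OF F]) auto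

lemma F_slice: "i \<in> {0, 1, 2} \<Longrightarrow> Ck_on 3 D (F i s)"
  by (rule Ck_on_slice[OF D F])

lemma F_slice_2: "i \<in> {0, 1, 2} \<Longrightarrow> Ck_on (Suc (Suc 0)) D (F i s)"
  by (rule Ck_on_mono[OF F_slice]) auto

lemma Ck_on_rhs_state: "Ck_on 3 U (rhs_state F R)"
proof -
  have lin: "Ck_on 3 U L" if "bounded_linear L" for L :: "real \<times> (real ^ 'p) \<times> real \<Rightarrow> 'c::euclidean_space"
    by (rule Ck_on_bounded_linear[OF that open_U])
  have b: "bounded_linear (\<lambda>p::real \<times> (real ^ 'p) \<times> real. (fst p, fst (snd p)))"
    "bounded_linear (\<lambda>p::real \<times> (real ^ 'p) \<times> real. snd (snd p))"
    by (auto intro!: bounded_linear_intros)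
  have FC: "Ck_on 3 U (\<lambda>p. F i (fst p) (fst (snd p)))" if "i \<in> {0, 1, 2}" for i
  proof -
    have "(\<lambda>p. (fst p, fst (snd p))) ` U \<subseteq> UNIV \<times> D" by (auto simp: U_def)
    from Ck_on_compose[OF open_U open_UD this F[OF that] lin[OF b(1)]] show ?thesis by simp
  qed
  have e: "Ck_on 3 U (\<lambda>p. snd (snd p))" by (rule lin[OF b(2)])
  have e2: "Ck_on 3 U (\<lambda>p. (snd (snd p))\<^sup>2)" "Ck_on 3 U (\<lambda>p. snd (snd p) ^ 3)"
    using Ck_on_scaleR[OF open_U e e] Ck_on_scaleR[OF open_U e Ck_on_scaleR[OF open_U e e]]
    by (simp_all add: power2_eq_square power3_eq_cube mult.assoc)
  have "Ck_on 3 U (\<lambda>p. F 0 (fst p) (fst (snd p)) + snd (snd p) *\<^sub>R F 1 (fst p) (fst (snd p)) +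
      (snd (snd p))\<^sup>2 *\<^sub>R F 2 (fst p) (fst (snd p)) + snd (snd p) ^ 3 *\<^sub>R R (fst p) (fst (snd p)) (snd (snd p)))"
    using R by (intro Ck_on_add Ck_on_scaleR open_U FC e e2) (simp_all add: case_prod_unfold)
  then show ?thesis unfolding rhs_state_def[abs_def] rhs_def .
qed

text \<open>Stated for every \<open>\<epsilon>\<close> because the second derivative is found by
  differentiating this formula along a line. The direction has time component 0, so no derivative in
  time appears.\<close>

lemma rhs_state_derivative:
  assumes x: "x \<in> D" and \<epsilon>: "\<epsilon> \<in> {-\<epsilon>0<..<\<epsilon>0}"
  shows "frechet_derivative (rhs_state F R) (at (s, x, \<epsilon>)) (0, y, e) =
    frechet_derivative (F 0 s) (at x) y
    + (\<epsilon> *\<^sub>R frechet_derivative (F 1 s) (at x) y + e *\<^sub>R F 1 s x)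
    + (\<epsilon>\<^sup>2 *\<^sub>R frechet_derivative (F 2 s) (at x) y + (2 * \<epsilon> * e) *\<^sub>R F 2 s x)
    + (\<epsilon> ^ 3 *\<^sub>R frechet_derivative (\<lambda>(\<theta>, x, \<epsilon>). R \<theta> x \<epsilon>) (at (s, x, \<epsilon>)) (0, y, e) + (3 * \<epsilon>\<^sup>2 * e) *\<^sub>R R s x \<epsilon>)"
    (is "_ = ?rhs")
proof -
  have p: "(s, x, \<epsilon>) \<in> U" using x \<epsilon> by (simp add: U_def)
  have l: "((\<lambda>t. g ((s, x, \<epsilon>) + t *\<^sub>R (0, y, e))) has_vector_derivative frechet_derivative g (at (s, x, \<epsilon>)) (0, y, e)) (at 0)"
    if "Ck_on 3 U g" for g :: "real \<times> (real ^ 'p) \<times> real \<Rightarrow> real ^ 'p"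
  proof -
    have "(g has_derivative frechet_derivative g (at (s, x, \<epsilon>))) (at ((s, x, \<epsilon>) + 0 *\<^sub>R (0, y, e)))"
      using Ck_on_has_derivative[OF _ p, of 2 g] that by (simp add: numeral_3_eq_3 numeral_2_eq_2 del: Ck_on.simps)
    then show ?thesis by (rule has_vector_derivative_line)
  qed
  have f: "((\<lambda>t. F i s (x + t *\<^sub>R y)) has_vector_derivative frechet_derivative (F i s) (at x) y) (at 0)"
    if "i \<in> {0, 1, 2}" for i
  proof -
    have "(F i s has_derivative frechet_derivative (F i s) (at x)) (at (x + 0 *\<^sub>R y))"
      using Ck_on_has_derivative[OF F_slice_2[OF that] x] by simp
    then show ?thesis by (rule has_vector_derivative_line)
  qed
  have e1: "((\<lambda>t. \<epsilon> + t * e) has_real_derivative e) (at 0)"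
    by (auto intro!: derivative_eq_intros)
  have e2: "((\<lambda>t. (\<epsilon> + t * e)\<^sup>2) has_real_derivative (2 * \<epsilon> * e)) (at 0)"
    "((\<lambda>t. (\<epsilon> + t * e) ^ 3) has_real_derivative (3 * \<epsilon>\<^sup>2 * e)) (at 0)"
    by (auto intro!: derivative_eq_intros)
  have r: "((\<lambda>t. R s (x + t *\<^sub>R y) (\<epsilon> + t * e)) has_vector_derivative
      frechet_derivative (\<lambda>(\<theta>, x, \<epsilon>). R \<theta> x \<epsilon>) (at (s, x, \<epsilon>)) (0, y, e)) (at 0)"
    using l[OF R] by simp
  have "((\<lambda>t. F 0 s (x + t *\<^sub>R y) + (\<epsilon> + t * e) *\<^sub>R F 1 s (x + t *\<^sub>R y)
      + (\<epsilon> + t * e)\<^sup>2 *\<^sub>R F 2 s (x + t *\<^sub>R y) + (\<epsilon> + t * e) ^ 3 *\<^sub>R R s (x + t *\<^sub>R y) (\<epsilon> + t * e))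
      has_vector_derivative ?rhs) (at 0)"
    using has_vector_derivative_add[OF has_vector_derivative_add[OF has_vector_derivative_add[OF f[of 0]
        has_vector_derivative_scaleR[OF e1 f[of 1]]] has_vector_derivative_scaleR[OF e2(1) f[of 2]]]
        has_vector_derivative_scaleR[OF e2(2) r]] by simp
  then have "((\<lambda>t. rhs_state F R ((s, x, \<epsilon>) + t *\<^sub>R (0, y, e))) has_vector_derivative ?rhs) (at 0)"
    by (simp add: rhs_state_def rhs_def)
  then show ?thesis
    using vector_derivative_unique_at[OF l[OF Ck_on_rhs_state]] by blast
qed

lemma rhs_state_derivative_0:
  assumes "x \<in> D"
  shows "frechet_derivative (rhs_state F R) (at (s, x, 0)) (0, y, e) =
    frechet_derivative (F 0 s) (at x) y + e *\<^sub>R F 1 s x"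
  using rhs_state_derivative[OF assms, of 0 s y e] \<epsilon>0 by simp

text \<open>The source of the integrand of \<open>y2\<close>. Along the line in the direction
  \<open>(0, y, 1)\<close> the first derivative is that of \<open>F 0 s\<close> applied to
  \<open>y\<close>, plus \<open>F 1 s\<close>, plus \<open>t\<close> times a continuous function
  \<open>m\<close>. Hence the derivative of \<open>F 1 s\<close> enters twice, once from
  \<open>F 1 s\<close> and once from \<open>m 0\<close>, which also contains
  \<open>2 *\<^sub>R F 2 s x\<close>.\<close>

lemma rhs_state_second_derivative_0:
  assumes x: "x \<in> D"
  shows "second_derivative (rhs_state F R) (s, x, 0) (0, y, 1) (0, y, 1) =
    2 *\<^sub>R F 2 s x + 2 *\<^sub>R frechet_derivative (F 1 s) (at x) y + second_derivative (F 0 s) x y y"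
    (is "_ = ?rhs")
proof -
  let ?p = "(s, x, 0::real)" and ?v = "(0::real, y, 1::real)"
  let ?R = "\<lambda>(\<theta>, x, \<epsilon>). R \<theta> x \<epsilon>"
  have p: "?p \<in> U" using x \<epsilon>0 by (simp add: U_def)
  have H2: "Ck_on (Suc (Suc 0)) U (rhs_state F R)" by (rule Ck_on_mono[OF Ck_on_rhs_state]) auto
  have "((\<lambda>p. frechet_derivative (rhs_state F R) (at p) ?v) has_derivative
      second_derivative (rhs_state F R) ?p ?v) (at (?p + 0 *\<^sub>R ?v))"
    unfolding second_derivative_def using Ck_on_has_derivative[OF Ck_on_derivative[OF H2] p] by simp
  from has_vector_derivative_line[OF this]
  have 1: "((\<lambda>t. frechet_derivative (rhs_state F R) (at (s, x + t *\<^sub>R y, t)) ?v) has_vector_derivative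
      second_derivative (rhs_state F R) ?p ?v ?v) (at 0)" by simp
  define m where "m t = frechet_derivative (F 1 s) (at (x + t *\<^sub>R y)) y + 2 *\<^sub>R F 2 s (x + t *\<^sub>R y)
    + t *\<^sub>R (frechet_derivative (F 2 s) (at (x + t *\<^sub>R y)) y
      + t *\<^sub>R frechet_derivative ?R (at (s, x + t *\<^sub>R y, t)) ?v + 3 *\<^sub>R R s (x + t *\<^sub>R y) t)" for t
  define W where "W = {t. (s, x + t *\<^sub>R y, t) \<in> U}"
  have "continuous_on UNIV (\<lambda>t. (s, x + t *\<^sub>R y, t))" by (intro continuous_intros)
  then have W: "open W" unfolding W_def
    using open_U open_vimage[of U "\<lambda>t. (s, x + t *\<^sub>R y, t)"] by (simp add: vimage_def)
  have W0: "0 \<in> W" using p by (simp add: W_def)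
  have WU: "(\<lambda>t. (s, x + t *\<^sub>R y, t)) ` W \<subseteq> U" "(\<lambda>t. x + t *\<^sub>R y) ` W \<subseteq> D"
    by (auto simp: W_def U_def)
  have cU: "continuous_on W (\<lambda>t. g (s, x + t *\<^sub>R y, t))" if "continuous_on U g"
    for g :: "real \<times> (real ^ 'p) \<times> real \<Rightarrow> real ^ 'p"
    by (rule continuous_on_compose2[OF that _ WU(1)]) (intro continuous_intros)
  have cD: "continuous_on W (\<lambda>t. g (x + t *\<^sub>R y))" if "continuous_on D g" for g :: "real ^ 'p \<Rightarrow> real ^ 'p"
    by (rule continuous_on_compose2[OF that _ WU(2)]) (intro continuous_intros)
  have FD: "continuous_on D (\<lambda>x. frechet_derivative (F i s) (at x) y)" "continuous_on D (F i s)"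
    if "i \<in> {0, 1, 2}" for i
    using Ck_on_continuous[OF F_slice[OF that]] Ck_on_continuous[OF Ck_on_derivative[OF F_slice_2[OF that]]] by auto
  have R1: "Ck_on (Suc 0) U ?R" by (rule Ck_on_mono[OF R]) auto
  have "continuous_on W m" unfolding m_def
    using cU[OF Ck_on_continuous[OF R]] cU[OF Ck_on_continuous[OF Ck_on_derivative[OF R1, of ?v]]]
    by (intro continuous_intros cD FD) auto
  then have "isCont m 0" using W W0 continuous_on_eq_continuous_at by blast
  from has_vector_derivative_scaleR_id[OF this]
  have 2: "((\<lambda>t. t *\<^sub>R m t) has_vector_derivative frechet_derivative (F 1 s) (at x) y + 2 *\<^sub>R F 2 s x) (at 0)"
    by (simp add: m_def)
  have "(F 1 s has_derivative frechet_derivative (F 1 s) (at x)) (at (x + 0 *\<^sub>R y))"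
    using Ck_on_has_derivative[OF F_slice_2[of 1] x] by simp
  note 3 = has_vector_derivative_line[OF this]
  have "((\<lambda>x. frechet_derivative (F 0 s) (at x) y) has_derivative second_derivative (F 0 s) x y) (at (x + 0 *\<^sub>R y))"
    unfolding second_derivative_def using Ck_on_has_derivative[OF Ck_on_derivative[OF F_slice_2[of 0]] x] by simp
  note 4 = has_vector_derivative_line[OF this]
  have "((\<lambda>t. frechet_derivative (F 0 s) (at (x + t *\<^sub>R y)) y + F 1 s (x + t *\<^sub>R y) + t *\<^sub>R m t)
      has_vector_derivative ?rhs) (at 0)"
    using has_vector_derivative_add[OF has_vector_derivative_add[OF 4 3] 2]
    by (simp add: algebra_simps scaleR_2)
  then have "((\<lambda>t. frechet_derivative (rhs_state F R) (at (s, x + t *\<^sub>R y, t)) ?v) has_vector_derivative ?rhs) (at 0)"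
  proof (rule has_vector_derivative_transform_within_open[OF _ W W0])
    fix t assume "t \<in> W"
    then have "x + t *\<^sub>R y \<in> D" "t \<in> {-\<epsilon>0<..<\<epsilon>0}" by (auto simp: W_def U_def)
    from rhs_state_derivative[OF this, of s y 1]
    show "frechet_derivative (F 0 s) (at (x + t *\<^sub>R y)) y + F 1 s (x + t *\<^sub>R y) + t *\<^sub>R m t =
        frechet_derivative (rhs_state F R) (at (s, x + t *\<^sub>R y, t)) ?v"
      by (simp add: m_def algebra_simps power2_eq_square power3_eq_cube)
  qed
  then show ?thesis using vector_derivative_unique_at[OF 1] by blast
qed


lemma jacobian_slice:
  assumes "x \<in> D" "i \<in> {0, 1, 2}"
  shows "jacobian (F i s) (at x) *v h = frechet_derivative (F i s) (at x) h"
proof -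
  have "linear (frechet_derivative (F i s) (at x))"
    using F_slice_2[OF assms(2), of s] assms(1) by (intro linear_frechet_derivative) simp
  then show ?thesis by (simp add: jacobian_def matrix_works)
qed

lemma continuous_jacobian_slice:
  assumes x: "continuous_on S x" "x ` S \<subseteq> D" and i: "i \<in> {0, 1, 2}"
  shows "continuous_on S (\<lambda>s. jacobian (F i s) (at (x s)))"
proof -
  have "continuous_on S (\<lambda>s. frechet_derivative (F i s) (at (x s)) h)" for h
  proof -
    have "continuous_on S (\<lambda>s. frechet_derivative (\<lambda>(s, x). F i s x) (at (s, x s)) (0, h))"
      by (rule continuous_on_compose2[OF Ck_on_continuous[OF Ck_on_derivative[OF F1[OF i]]]])
        (use x in \<open>auto intro!: continuous_intros\<close>)
    then show ?thesis
      by (rule continuous_on_eq) (rule frechet_derivative_slice[OF D F1[OF i], symmetric], use x(2) in auto)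
  qed
  then show ?thesis
    unfolding jacobian_def matrix_def by (intro continuous_intros)
qed

text \<open>One statement for both halves, with \<open>\<theta>\<close> equal to
  \<open>\<phi>\<close> or to \<open>\<phi> - T\<close>. The identities are proved at all
  \<open>(z, 0)\<close> near the start of the orbit, not just there, because the second bifurcation
  function differentiates \<open>g0\<close> and \<open>g1\<close> in \<open>v\<close>.\<close>

lemma half_flow:
  assumes x0: "\<And>s. s \<in> closed_segment 0 \<theta> \<Longrightarrow> x0 s \<in> D"
    "\<And>s. s \<in> closed_segment 0 \<theta> \<Longrightarrow> (x0 has_vector_derivative F 0 s (x0 s)) (at s within closed_segment 0 \<theta>)"
  obtains \<delta> \<Phi> where "\<delta> > 0" "Ck_on 3 (ball (x0 0, 0 :: real) \<delta>) \<Phi>"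
    "\<And>z \<epsilon>. (z, \<epsilon>) \<in> ball (x0 0, 0) \<delta> \<Longrightarrow> \<exists>x. x 0 = z \<and> x \<theta> = \<Phi> (z, \<epsilon>) \<and> (\<forall>s\<in>closed_segment 0 \<theta>.
      x s \<in> D \<and> (x has_vector_derivative rhs F R s (x s) \<epsilon>) (at s within closed_segment 0 \<theta>))"
    "\<And>z. (z, 0 :: real) \<in> ball (x0 0, 0) \<delta> \<Longrightarrow> \<Phi> (z, 0) = y0 F D \<theta> z"
    "\<And>z h. (z, 0 :: real) \<in> ball (x0 0, 0) \<delta> \<Longrightarrow>
      frechet_derivative \<Phi> (at (z, 0)) (h, 0) = fund_matrix (F 0) D \<theta> z *v h"
    "\<And>z. (z, 0 :: real) \<in> ball (x0 0, 0) \<delta> \<Longrightarrow> frechet_derivative \<Phi> (at (z, 0)) (0, 1) = y1 F D \<theta> z"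
    "\<And>z. (z, 0 :: real) \<in> ball (x0 0, 0) \<delta> \<Longrightarrow> second_derivative \<Phi> (z, 0) (0, 1) (0, 1) = y2 F D \<theta> z"
proof -
  let ?S = "closed_segment 0 \<theta>"
  let ?H = "rhs_state F R"
  define L where "L v = (0 :: real, \<theta> *\<^sub>R v, 0 :: real)" for v :: "real ^ 'p"
  have L: "bounded_linear L"
    unfolding L_def by (intro bounded_linear_Pair bounded_linear_zero bounded_linear_scaleR_right)
  \<comment> \<open>Time runs with speed \<open>\<theta>\<close> and the parameter stands still, so
    unit time covers the segment from 0 to \<open>\<theta>\<close>.\<close>
  define f where "f p = (\<theta>, 0, 0) + L (?H p)" for p
  have f: "Ck_on 3 U f"
    unfolding f_def by (intro Ck_on_add open_U Ck_on_const Ck_on_linear_compose[OF L] Ck_on_rhs_state)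
  have f1: "Ck_on 1 U f" and f2: "Ck_on 2 U f" by (rule Ck_on_mono[OF f], simp)+
  have H2: "Ck_on 2 U ?H" by (rule Ck_on_mono[OF Ck_on_rhs_state]) simp
  have Df: "frechet_derivative f (at p) v = (0, \<theta> *\<^sub>R frechet_derivative ?H (at p) v, 0)" if "p \<in> U" for p v
  proof -
    have "?H differentiable (at (0 + p))" using Ck_on_rhs_state that by (simp add: numeral_3_eq_3)
    from frechet_derivative_affine_compose[OF L bounded_linear_ident this, of "(\<theta>, 0, 0)" v]
    show ?thesis by (simp add: f_def[abs_def] L_def)
  qed
  have D2f: "second_derivative f p v w = (0, \<theta> *\<^sub>R second_derivative ?H p v w, 0)" if "p \<in> U" for p v w
    using second_derivative_affine_compose[OF L bounded_linear_ident open_U H2, of 0 p "(\<theta>, 0, 0)" v w] that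
    by (simp add: f_def[abs_def] L_def)
  define X0 where "X0 t = (\<theta> * t, x0 (\<theta> * t), 0 :: real)" for t
  have \<theta>t: "((\<lambda>t. s + \<theta> * t) has_vector_derivative \<theta>) (at t within {0..1})" for s t
    by (auto intro!: derivative_eq_intros simp: has_real_derivative_iff_has_vector_derivative[symmetric])
  have X0s: "solves f U X0"
    unfolding solves_def
  proof (intro ballI conjI)
    fix t :: real assume t: "t \<in> {0..1}"
    show "X0 t \<in> U" using x0(1)[OF segment_scale(3)[OF t]] \<epsilon>0 by (simp add: X0_def U_def)
    have "(X0 has_vector_derivative (\<theta>, \<theta> *\<^sub>R F 0 (\<theta> * t) (x0 (\<theta> * t)), 0)) (at t within {0..1})"
      unfolding X0_def using \<theta>t[of 0 t]
      by (intro has_vector_derivative_Pair has_vector_derivative_const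
          has_vector_derivative_segment_to_unit[OF x0(2) t]) simp_all
    then show "(X0 has_vector_derivative f (X0 t)) (at t within {0..1})"
      by (simp add: f_def L_def rhs_state_def rhs_def X0_def)
  qed
  have X00: "X0 0 = (0, x0 0, 0)" by (simp add: X0_def)
  have "\<exists>\<delta>>0. \<exists>X. (\<forall>z\<in>ball (X0 0) \<delta>. X z 0 = z \<and> solves f U (X z)) \<and>
      (\<forall>t\<in>{0..1}. Ck_on 3 (ball (X0 0) \<delta>) (\<lambda>z. X z t))"
    using flows_Ck_3[unfolded flows_Ck_def, rule_format, OF conjI[OF open_U conjI[OF f X0s]]] .
  then obtain \<delta> X where \<delta>: "\<delta> > 0" and X: "\<forall>p\<in>ball (0, x0 0, 0) \<delta>. X p 0 = p \<and> solves f U (X p)"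
    and XC: "\<And>t. t \<in> {0..1} \<Longrightarrow> Ck_on 3 (ball (0, x0 0, 0) \<delta>) (\<lambda>p. X p t)"
    unfolding X00 by blast
  let ?B = "ball (x0 0, 0 :: real) \<delta>" and ?W = "ball (0 :: real, x0 0, 0 :: real) \<delta>"
  have BW: "(0, q) \<in> ?W" if "q \<in> ?B" for q
    using that by (cases q) (simp add: dist_Pair_Pair)
  define \<pi> where "\<pi> p = fst (snd p)" for p :: "real \<times> (real ^ 'p) \<times> real"
  have \<pi>: "bounded_linear \<pi>"
    unfolding \<pi>_def by (intro bounded_linear_compose[OF bounded_linear_fst] bounded_linear_snd)
  have E: "bounded_linear (\<lambda>q :: (real ^ 'p) \<times> real. (0 :: real, q))"
    by (intro bounded_linear_Pair bounded_linear_zero bounded_linear_ident)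
  \<comment> \<open>The summand 0 brings \<open>\<Phi>\<close> into the form of the affine
    composition lemmas.\<close>
  define \<Phi> where "\<Phi> q = 0 + \<pi> (X (0, q) 1)" for q
  have \<Phi>C: "Ck_on 3 ?B \<Phi>"
  proof -
    have "Ck_on 3 ?B (\<lambda>q. X (0, q) 1)"
      by (rule Ck_on_compose[OF open_ball open_ball _ XC Ck_on_bounded_linear[OF E open_ball]]) (use BW in auto)
    then show ?thesis
      unfolding \<Phi>_def by (intro Ck_on_add Ck_on_const Ck_on_linear_compose[OF \<pi>] open_ball)
  qed
  have comp: "X (0, z, \<epsilon>) t = (\<theta> * t, \<pi> (X (0, z, \<epsilon>) t), \<epsilon>)" "\<pi> (X (0, z, \<epsilon>) t) \<in> D" "\<epsilon> \<in> {-\<epsilon>0<..<\<epsilon>0}"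
    "((\<lambda>t. \<pi> (X (0, z, \<epsilon>) t)) has_vector_derivative \<theta> *\<^sub>R rhs F R (\<theta> * t) (\<pi> (X (0, z, \<epsilon>) t)) \<epsilon>) (at t within {0..1})"
    "X (0, z, \<epsilon>) 0 = (0, z, \<epsilon>)"
    if q: "(z, \<epsilon>) \<in> ?B" and t: "t \<in> {0..1}" for z \<epsilon> t
  proof -
    let ?X = "X (0, z, \<epsilon>)"
    have X0: "?X 0 = (0, z, \<epsilon>)" and Xs: "solves f U ?X" using X BW[OF q] by auto
    have XU: "?X t \<in> U" and Xd: "(?X has_vector_derivative (\<theta>, \<theta> *\<^sub>R ?H (?X t), 0)) (at t within {0..1})"
      if "t \<in> {0..1}" for t
      using Xs that by (auto simp: solves_def f_def L_def)
    have "fst (?X t) = \<theta> * t"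
      by (rule antiderivative_unique[OF _ _ _ t, where b="\<lambda>_. \<theta>"])
        (use bounded_linear.has_vector_derivative[OF bounded_linear_fst Xd] \<theta>t[of 0] X0 in auto)
    moreover have e: "snd (snd (?X t)) = \<epsilon>"
      by (rule antiderivative_unique[OF _ _ _ t, where b="\<lambda>_. 0" and z="\<lambda>_. \<epsilon>"])
        (use bounded_linear.has_vector_derivative[OF
          bounded_linear_compose[OF bounded_linear_snd bounded_linear_snd] Xd] X0 in auto)
    ultimately show c: "?X t = (\<theta> * t, \<pi> (?X t), \<epsilon>)" by (simp add: \<pi>_def prod_eq_iff)
    show "\<pi> (?X t) \<in> D" "\<epsilon> \<in> {-\<epsilon>0<..<\<epsilon>0}"
      using XU[OF t] e by (auto simp: U_def \<pi>_def mem_Times_iff)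
    have "((\<lambda>t. \<pi> (?X t)) has_vector_derivative \<theta> *\<^sub>R ?H (?X t)) (at t within {0..1})"
      using bounded_linear.has_vector_derivative[OF \<pi> Xd[OF t]] by (simp add: \<pi>_def)
    moreover have "?H (?X t) = rhs F R (\<theta> * t) (\<pi> (?X t)) \<epsilon>"
      by (subst c) (simp add: rhs_state_def)
    ultimately show "((\<lambda>t. \<pi> (?X t)) has_vector_derivative \<theta> *\<^sub>R rhs F R (\<theta> * t) (\<pi> (?X t)) \<epsilon>) (at t within {0..1})"
      by simp
    show "?X 0 = (0, z, \<epsilon>)" by (rule X0)
  qed
  have orbit: "(\<lambda>s. \<pi> (X (0, z, \<epsilon>) (s / \<theta>))) 0 = z"
    "\<pi> (X (0, z, \<epsilon>) (\<theta> / \<theta>)) = \<Phi> (z, \<epsilon>)"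
    "s \<in> ?S \<Longrightarrow> \<pi> (X (0, z, \<epsilon>) (s / \<theta>)) \<in> D"
    "s \<in> ?S \<Longrightarrow> ((\<lambda>s. \<pi> (X (0, z, \<epsilon>) (s / \<theta>))) has_vector_derivative rhs F R s (\<pi> (X (0, z, \<epsilon>) (s / \<theta>))) \<epsilon>) (at s within ?S)"
    if q: "(z, \<epsilon>) \<in> ?B" for z \<epsilon> s
  proof -
    show "\<pi> (X (0, z, \<epsilon>) (0 / \<theta>)) = z" using comp(5)[OF q, of 0] by (simp add: \<pi>_def)
    show "\<pi> (X (0, z, \<epsilon>) (\<theta> / \<theta>)) = \<Phi> (z, \<epsilon>)"
      using unit_to_segment_end[OF comp(4)[OF q]] by (simp add: \<Phi>_def)
    assume s: "s \<in> ?S"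
    show "\<pi> (X (0, z, \<epsilon>) (s / \<theta>)) \<in> D" using comp(2)[OF q segment_scale(1)[OF s]] .
    show "((\<lambda>s. \<pi> (X (0, z, \<epsilon>) (s / \<theta>))) has_vector_derivative rhs F R s (\<pi> (X (0, z, \<epsilon>) (s / \<theta>))) \<epsilon>) (at s within ?S)"
      using has_vector_derivative_unit_to_segment[OF comp(4)[OF q] s] segment_scale(2)[OF s] by simp
  qed
  have main: "\<Phi> (z, 0) = y0 F D \<theta> z \<and>
    frechet_derivative \<Phi> (at (z, 0)) (h, 0) = fund_matrix (F 0) D \<theta> z *v h \<and>
    frechet_derivative \<Phi> (at (z, 0)) (0, 1) = y1 F D \<theta> z \<and>
    second_derivative \<Phi> (z, 0) (0, 1) (0, 1) = y2 F D \<theta> z" if q: "(z, 0) \<in> ?B" for z h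
  proof -
    let ?P = "(0 :: real, z, 0 :: real)"
    have PW: "?P \<in> ?W" using BW[OF q] .
    define \<xi> where "\<xi> t = \<pi> (X ?P t)" for t
    define x where "x s = \<xi> (s / \<theta>)" for s
    have rhs0: "rhs F R s v 0 = F 0 s v" for s v by (simp add: rhs_def)
    have XP: "X ?P t = (\<theta> * t, \<xi> t, 0)" "\<xi> t \<in> D" if "t \<in> {0..1}" for t
      using comp(1,2)[OF q that] by (auto simp: \<xi>_def)
    have XU: "X ?P t \<in> U" if "t \<in> {0..1}" for t
      unfolding XP(1)[OF that] using XP(2)[OF that] \<epsilon>0 by (simp add: U_def)
    have x: "x 0 = z" "x \<theta> = \<Phi> (z, 0)" "\<And>s. s \<in> ?S \<Longrightarrow> x s \<in> D"
      "\<And>s. s \<in> ?S \<Longrightarrow> (x has_vector_derivative F 0 s (x s)) (at s within ?S)"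
      using orbit[OF q] unfolding x_def \<xi>_def rhs0 by blast+
    have xt: "x (\<theta> * t) = \<xi> t" if "t \<in> {0..1}" "\<theta> \<noteq> 0" for t using that by (simp add: x_def)
    have F01: "Ck_on 1 (UNIV \<times> D) (\<lambda>(s, x). F 0 s x)" using F1[of 0] by simp
    have fl: "flow (F 0) D s z = x s" if "s \<in> ?S" for s
      using flow_eqI[OF D F01 x(3,4) that] x(1) by simp
    have xc: "continuous_on ?S x" by (rule has_vector_derivative_continuous_on[OF x(4)])
    have xS: "x ` ?S \<subseteq> D" using x(3) by auto
    define J where "J s = jacobian (F 0 s) (at (x s))" for s
    have Jc: "continuous_on ?S J" unfolding J_def by (rule continuous_jacobian_slice[OF xc xS]) simp
    have "\<exists>M. M 0 = mat 1 \<and> (\<forall>s\<in>?S. (M has_vector_derivative J s ** M s) (at s within ?S))"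
      by (rule linear_ode_segment_exists)
        (use bounded_bilinear.continuous_on[OF bounded_bilinear_matrix_matrix_mult Jc continuous_on_const]
          bounded_linear.linear[OF bounded_bilinear.bounded_linear_right[OF bounded_bilinear_matrix_matrix_mult]] in auto)
    then obtain M where M0: "M 0 = mat 1"
      and M: "\<And>s. s \<in> ?S \<Longrightarrow> (M has_vector_derivative J s ** M s) (at s within ?S)" by blast
    have fM: "fund_matrix (F 0) D s z = M s" if "s \<in> ?S" for s
      by (rule fund_matrix_eqI[OF fl Jc[unfolded J_def] M0 M[unfolded J_def] that])
    define Y where "Y v t = frechet_derivative (\<lambda>p. X p t) (at ?P) v" for v t
    have Y0: "Y v 0 = v" and Yd: "t \<in> {0..1} \<Longrightarrow>
        (Y v has_vector_derivative frechet_derivative f (at (X ?P t)) (Y v t)) (at t within {0..1})" for v t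
      unfolding Y_def by (rule flow_first_variation[OF open_U f1 open_ball X PW], assumption?)+
    \<comment> \<open>The spatial part of a variation. The speeds of time and parameter are
      constants of the extended system, so the variation keeps its time component 0 and its
      parameter component \<open>e\<close>.\<close>
    define \<eta> where "\<eta> h e t = \<pi> (Y (0, h, e) t)" for h e t
    have Ysplit: "Y (0, h, e) t = (0, \<eta> h e t, e)"
      and \<eta>d: "(\<eta> h e has_vector_derivative \<theta> *\<^sub>R (frechet_derivative (F 0 (\<theta> * t)) (at (\<xi> t)) (\<eta> h e t) + e *\<^sub>R F 1 (\<theta> * t) (\<xi> t)))
        (at t within {0..1})" if t: "t \<in> {0..1}" for h e t
    proof -
      let ?Y = "Y (0, h, e)"
      have d: "(?Y has_vector_derivative (0, \<theta> *\<^sub>R frechet_derivative ?H (at (X ?P t)) (?Y t), 0)) (at t within {0..1})"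
        if "t \<in> {0..1}" for t
        using Yd[OF that, of "(0, h, e)"] Df[OF XU[OF that]] by simp
      have "fst (?Y t) = 0"
        by (rule antiderivative_unique[OF _ _ _ t, where b="\<lambda>_. 0" and z="\<lambda>_. 0"])
          (use bounded_linear.has_vector_derivative[OF bounded_linear_fst d] Y0 in auto)
      moreover have "snd (snd (?Y t)) = e"
        by (rule antiderivative_unique[OF _ _ _ t, where b="\<lambda>_. 0" and z="\<lambda>_. e"])
          (use bounded_linear.has_vector_derivative[OF
            bounded_linear_compose[OF bounded_linear_snd bounded_linear_snd] d] Y0 in auto)
      ultimately show s: "?Y t = (0, \<eta> h e t, e)" by (simp add: \<eta>_def \<pi>_def prod_eq_iff)
      have "(\<eta> h e has_vector_derivative \<theta> *\<^sub>R frechet_derivative ?H (at (X ?P t)) (?Y t)) (at t within {0..1})"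
        using bounded_linear.has_vector_derivative[OF \<pi> d[OF t]] by (simp add: \<pi>_def \<eta>_def[abs_def])
      then show "(\<eta> h e has_vector_derivative \<theta> *\<^sub>R (frechet_derivative (F 0 (\<theta> * t)) (at (\<xi> t)) (\<eta> h e t) + e *\<^sub>R F 1 (\<theta> * t) (\<xi> t)))
        (at t within {0..1})"
        unfolding XP(1)[OF t] s rhs_state_derivative_0[OF XP(2)[OF t]] .
    qed
    define y where "y h e s = \<eta> h e (s / \<theta>)" for h e s
    have y_end: "y h e \<theta> = \<eta> h e 1" for h e
      unfolding y_def by (rule unit_to_segment_end[OF \<eta>d])
    have y_0: "y h e 0 = h" for h e by (simp add: y_def \<eta>_def Y0 \<pi>_def)
    have yd: "(y h e has_vector_derivative J s *v y h e s + e *\<^sub>R F 1 s (x s)) (at s within ?S)" if s: "s \<in> ?S" for h e s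
      using has_vector_derivative_unit_to_segment[OF \<eta>d s, of h e] segment_scale(2)[OF s]
        jacobian_slice[OF x(3)[OF s], of 0 s]
      unfolding y_def[abs_def] J_def x_def by simp
    have \<Phi>D: "frechet_derivative \<Phi> (at (z, 0)) (h, e) = y h e \<theta>" for h e
    proof -
      have "(\<lambda>p. X p 1) differentiable (at (0 + ?P))" using XC[of 1] PW by (simp add: numeral_3_eq_3)
      from frechet_derivative_affine_compose[OF \<pi> E this, of 0 "(h, e)"]
      show ?thesis by (simp add: \<Phi>_def[abs_def] y_end \<eta>_def Y_def)
    qed
    have "y h 0 \<theta> = M \<theta> *v h"
    proof (rule linear_ode_segment_unique[where A="\<lambda>s v. J s *v v" and z="\<lambda>s. M s *v h"])
      show "continuous_on ?S (\<lambda>s. J s *v b)" for b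
        by (rule bounded_bilinear.continuous_on[OF bounded_bilinear_matrix_vector_mult Jc continuous_on_const])
      show "((\<lambda>s. M s *v h) has_vector_derivative J s *v (M s *v h)) (at s within ?S)" if "s \<in> ?S" for s
        using bounded_bilinear.has_vector_derivative[OF bounded_bilinear_matrix_vector_mult M[OF that] has_vector_derivative_const]
        by (simp add: matrix_vector_mul_assoc)
    qed (use yd[of _ h 0] y_0 M0 in auto)
    moreover have \<theta>S: "\<theta> \<in> ?S" by simp
    ultimately have 1: "frechet_derivative \<Phi> (at (z, 0)) (h, 0) = fund_matrix (F 0) D \<theta> z *v h"
      using fM[OF \<theta>S] by (simp add: \<Phi>D)
    have F1c: "continuous_on ?S (\<lambda>s. F 1 s (x s))"
    proof -
      have "continuous_on ?S (\<lambda>s. (\<lambda>(s, x). F 1 s x) (s, x s))"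
        by (rule continuous_on_compose2[OF Ck_on_continuous[OF F1]])
          (use xc xS in \<open>auto intro!: continuous_intros\<close>)
      then show ?thesis by simp
    qed
    \<comment> \<open>The variation with \<open>h = 0\<close> and \<open>e = 1\<close> starts at 0
      and is driven by \<open>F 1\<close>; variation of constants gives it the integral form of
      \<open>y1\<close>.\<close>
    have y1: "y1 F D s z = y 0 1 s" if s: "s \<in> ?S" for s
    proof -
      have "y 0 1 s = M s *v (LBINT r=ereal 0..ereal s. matrix_inv (M r) *v F 1 r (x r))"
        by (rule variation_of_constants[where y="y 0 1", OF Jc M0 M y_0[of 0 1] _ F1c s])
          (use yd[of _ 0 1] in simp_all)
      also have "(LBINT r=ereal 0..ereal s. matrix_inv (M r) *v F 1 r (x r)) =
          (LBINT r=ereal 0..ereal s. matrix_inv (fund_matrix (F 0) D r z) *v F 1 r (flow (F 0) D r z))"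
        by (rule interval_integral_segment_cong) (use fM fl segment_scale(4)[OF s] in auto)
      finally show ?thesis unfolding y1_def fM[OF s] ..
    qed
    \<comment> \<open>The second variation, taken twice in the direction of the parameter. Its time
      and parameter components vanish, and its spatial part solves the linearised equation with the
      inhomogeneity \<open>b\<close> introduced below.\<close>
    define Z where "Z t = second_derivative (\<lambda>p. X p t) ?P (0, 0, 1) (0, 0, 1)" for t
    have XC2: "Ck_on 2 ?W (\<lambda>p. X p t)" if "t \<in> {0..1}" for t by (rule Ck_on_mono[OF XC[OF that]]) simp
    note sv = flow_second_variation[OF open_U f2 open_ball X PW XC2, where h="(0, 0, 1)" and k="(0, 0, 1)"]
    have Z0: "Z 0 = 0" unfolding Z_def by (rule sv(1))
    have Zd: "(Z has_vector_derivative (0, \<theta> *\<^sub>R (second_derivative ?H (X ?P t) (0, \<eta> 0 1 t, 1) (0, \<eta> 0 1 t, 1) +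
        frechet_derivative ?H (at (X ?P t)) (Z t)), 0)) (at t within {0..1})" if t: "t \<in> {0..1}" for t
      using sv(2)[OF _ t, folded Z_def] Ysplit[OF t, of 0 1] D2f[OF XU[OF t]] Df[OF XU[OF t]]
      by (simp add: Y_def scaleR_add_right)
    define \<zeta> where "\<zeta> t = \<pi> (Z t)" for t
    have \<zeta>d: "(\<zeta> has_vector_derivative \<theta> *\<^sub>R (second_derivative ?H (X ?P t) (0, \<eta> 0 1 t, 1) (0, \<eta> 0 1 t, 1) +
        frechet_derivative (F 0 (\<theta> * t)) (at (\<xi> t)) (\<zeta> t))) (at t within {0..1})" if t: "t \<in> {0..1}" for t
    proof -
      have "fst (Z t) = 0"
        by (rule antiderivative_unique[OF _ _ _ t, where b="\<lambda>_. 0" and z="\<lambda>_. 0"])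
          (use bounded_linear.has_vector_derivative[OF bounded_linear_fst Zd] Z0 in auto)
      moreover have "snd (snd (Z t)) = 0"
        by (rule antiderivative_unique[OF _ _ _ t, where b="\<lambda>_. 0" and z="\<lambda>_. 0"])
          (use bounded_linear.has_vector_derivative[OF
            bounded_linear_compose[OF bounded_linear_snd bounded_linear_snd] Zd] Z0 in auto)
      ultimately have s: "Z t = (0, \<zeta> t, 0)" by (simp add: \<zeta>_def \<pi>_def prod_eq_iff)
      have "(\<zeta> has_vector_derivative \<theta> *\<^sub>R (second_derivative ?H (X ?P t) (0, \<eta> 0 1 t, 1) (0, \<eta> 0 1 t, 1) +
        frechet_derivative ?H (at (X ?P t)) (0, \<zeta> t, 0))) (at t within {0..1})"
        using bounded_linear.has_vector_derivative[OF \<pi> Zd[OF t]] unfolding s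
        by (simp add: \<pi>_def \<zeta>_def[abs_def])
      then show ?thesis
        unfolding XP(1)[OF t] rhs_state_derivative_0[OF XP(2)[OF t]] by simp
    qed
    define b where "b s = second_derivative ?H (s, x s, 0) (0, y 0 1 s, 1) (0, y 0 1 s, 1)" for s
    have bc: "continuous_on ?S b" unfolding b_def
    proof -
      have "continuous_on ?S (y 0 1)" by (rule has_vector_derivative_continuous_on[OF yd])
      then have v: "continuous_on ?S (\<lambda>s. (0 :: real, y 0 1 s, 1 :: real))" by (intro continuous_intros)
      have p: "continuous_on ?S (\<lambda>s. (s, x s, 0 :: real))" by (intro continuous_intros xc)
      have "(\<lambda>s. (s, x s, 0)) ` ?S \<subseteq> U" using x(3) \<epsilon>0 by (auto simp: U_def)
      from continuous_on_second_derivative[OF open_U H2 p this v v]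
      show "continuous_on ?S (\<lambda>s. second_derivative ?H (s, x s, 0) (0, y 0 1 s, 1) (0, y 0 1 s, 1))" .
    qed
    have zd: "((\<lambda>s. \<zeta> (s / \<theta>)) has_vector_derivative J s *v \<zeta> (s / \<theta>) + b s) (at s within ?S)" if s: "s \<in> ?S" for s
      using has_vector_derivative_unit_to_segment[OF \<zeta>d s] XP(1)[OF segment_scale(1)[OF s]] segment_scale(2)[OF s]
        jacobian_slice[OF x(3)[OF s], of 0 s]
      unfolding y_def[abs_def] J_def x_def b_def by (simp add: add.commute)
    have "\<zeta> 1 = \<zeta> (\<theta> / \<theta>)" by (rule unit_to_segment_end[OF \<zeta>d, symmetric])
    also have "\<dots> = M \<theta> *v (LBINT r=ereal 0..ereal \<theta>. matrix_inv (M r) *v b r)"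
      by (rule variation_of_constants[where y="\<lambda>s. \<zeta> (s / \<theta>)", OF Jc M0 M _ zd bc \<theta>S]) (simp_all add: \<zeta>_def Z0 \<pi>_def)
    also have "(LBINT r=ereal 0..ereal \<theta>. matrix_inv (M r) *v b r) =
      (LBINT s=ereal 0..ereal \<theta>. matrix_inv (fund_matrix (F 0) D s z) *v
          (2 *\<^sub>R F 2 s (flow (F 0) D s z)
           + 2 *\<^sub>R frechet_derivative (F 1 s) (at (flow (F 0) D s z)) (y1 F D s z)
           + second_derivative (F 0 s) (flow (F 0) D s z) (y1 F D s z) (y1 F D s z)))"
    proof (rule interval_integral_segment_cong)
      fix s assume s: "s \<in> ?S"
      show "matrix_inv (M s) *v b s = matrix_inv (fund_matrix (F 0) D s z) *v
          (2 *\<^sub>R F 2 s (flow (F 0) D s z)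
           + 2 *\<^sub>R frechet_derivative (F 1 s) (at (flow (F 0) D s z)) (y1 F D s z)
           + second_derivative (F 0 s) (flow (F 0) D s z) (y1 F D s z) (y1 F D s z))"
        unfolding fM[OF s] fl[OF s] y1[OF s] b_def rhs_state_second_derivative_0[OF x(3)[OF s]] ..
    qed
    finally have \<zeta>1: "\<zeta> 1 = y2 F D \<theta> z" unfolding y2_def fM[OF \<theta>S] .
    have "second_derivative \<Phi> (z, 0) (0, 1) (0, 1) = \<pi> (Z 1)"
      using second_derivative_affine_compose[OF \<pi> E open_ball XC2[of 1], of 0 "(z, 0)" 0 "(0, 1)" "(0, 1)"] PW
      by (simp add: \<Phi>_def[abs_def] Z_def)
    then have 2: "second_derivative \<Phi> (z, 0) (0, 1) (0, 1) = y2 F D \<theta> z" using \<zeta>1 by (simp add: \<zeta>_def)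
    have "\<Phi> (z, 0) = y0 F D \<theta> z" using x(2) fl[OF \<theta>S] by (simp add: y0_def)
    moreover have "frechet_derivative \<Phi> (at (z, 0)) (0, 1) = y1 F D \<theta> z" using y1[OF \<theta>S] by (simp add: \<Phi>D)
    ultimately show ?thesis using 1 2 by blast
  qed
  show ?thesis
  proof (rule that[OF \<delta> \<Phi>C])
    fix z \<epsilon> assume q: "(z, \<epsilon>) \<in> ?B"
    show "\<exists>x. x 0 = z \<and> x \<theta> = \<Phi> (z, \<epsilon>) \<and> (\<forall>s\<in>?S.
      x s \<in> D \<and> (x has_vector_derivative rhs F R s (x s) \<epsilon>) (at s within ?S))"
      using orbit[OF q] by (intro exI[of _ "\<lambda>s. \<pi> (X (0, z, \<epsilon>) (s / \<theta>))"]) blast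
  next
    fix z :: "real ^ 'p" assume q: "(z, 0) \<in> ?B"
    show "\<Phi> (z, 0) = y0 F D \<theta> z" using main[OF q] by blast
    show "frechet_derivative \<Phi> (at (z, 0)) (h, 0) = fund_matrix (F 0) D \<theta> z *v h" for h
      using main[OF q] by blast
    show "frechet_derivative \<Phi> (at (z, 0)) (0, 1) = y1 F D \<theta> z" using main[OF q] by blast
    show "second_derivative \<Phi> (z, 0) (0, 1) (0, 1) = y2 F D \<theta> z" using main[OF q] by blast
  qed
qed

end

section \<open>Symmetry of second derivatives\<close>

text \<open>The second difference is the increment, for \<open>t\<close> from 0 to 1, of the
  difference of \<open>f\<close> on two parallel segments. The derivative in \<open>t\<close> is
  \<open>s\<close> times a difference of \<open>?w\<close> at points \<open>s *\<^sub>R k\<close>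
  apart, hence close to \<open>s\<^sup>2 *\<^sub>R ?B k\<close>.\<close>

lemma second_difference:
  fixes f :: "'a::euclidean_space \<Rightarrow> 'b::euclidean_space"
  assumes U: "open U" and f: "Ck_on 2 U f" and x: "x \<in> U" and \<eta>: "\<eta> > 0"
  shows "\<exists>d>0. \<forall>s. 0 < s \<and> s < d \<longrightarrow>
    norm (f (x + s *\<^sub>R h + s *\<^sub>R k) - f (x + s *\<^sub>R h) - f (x + s *\<^sub>R k) + f x - s\<^sup>2 *\<^sub>R second_derivative f x h k) \<le> \<eta> * s\<^sup>2"
proof -
  let ?w = "\<lambda>y. frechet_derivative f (at y) h" and ?B = "second_derivative f x h"
  \<comment> \<open>Bounds all combinations of \<open>h\<close> and \<open>k\<close> with
    coefficients in the unit interval; the 1 keeps it positive. Two Taylor errors of half of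
    \<open>\<eta> * s\<close> each are then allowed.\<close>
  define c where "c = norm h + norm k + 1"
  have c: "c > 0" by (simp add: c_def add_nonneg_pos)
  have f2: "Ck_on (Suc (Suc 0)) U f" using f by (simp add: numeral_2_eq_2)
  have w: "Ck_on 1 U ?w" using Ck_on_derivative[OF f2] by simp
  obtain d where d: "d > 0" "\<And>y. norm y < d \<Longrightarrow> x + y \<in> U"
    "\<And>y. norm y < d \<Longrightarrow> norm (?w (x + y) - ?w x - ?B y) \<le> \<eta> / (2 * c) * norm y"
    using Taylor_first_order_uniform[OF U, of "{x}" ?w "\<eta> / (2 * c)"] w x \<eta> c
    by (auto simp: second_derivative_def)
  show ?thesis
  proof (intro exI[of _ "d / c"] conjI allI impI)
    show "d / c > 0" using d c by simp
    fix s :: real assume s: "0 < s \<and> s < d / c"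
    then have sd: "s * c < d" using c by (simp add: field_simps)
    have small: "norm (t *\<^sub>R s *\<^sub>R h + r *\<^sub>R s *\<^sub>R k) \<le> s * c" if "t \<in> {0..1}" "r \<in> {0..1}" for t r
    proof -
      have "norm (t *\<^sub>R s *\<^sub>R h + r *\<^sub>R s *\<^sub>R k) \<le> norm (t *\<^sub>R s *\<^sub>R h) + norm (r *\<^sub>R s *\<^sub>R k)" by (rule norm_triangle_ineq)
      also have "\<dots> = t * (s * norm h) + r * (s * norm k)" using that s by simp
      also have "\<dots> \<le> 1 * (s * norm h) + 1 * (s * norm k)" using that s by (intro add_mono mult_right_mono) auto
      also have "\<dots> \<le> s * c" using s by (simp add: c_def algebra_simps)
      finally show ?thesis .
    qed
    let ?p = "\<lambda>t r. t *\<^sub>R s *\<^sub>R h + r *\<^sub>R s *\<^sub>R k"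
    have lin: "linear ?B" by (rule linear_second_derivative[OF f x])
    let ?r = "\<lambda>t. f (x + s *\<^sub>R k + t *\<^sub>R s *\<^sub>R h) - f (x + t *\<^sub>R s *\<^sub>R h) - t *\<^sub>R s\<^sup>2 *\<^sub>R ?B k"
    have "norm (?r 1 - ?r 0) \<le> \<eta> * s\<^sup>2"
    proof (rule norm_increment_le[where f'="\<lambda>t. s *\<^sub>R (?w (x + ?p t 1) - ?w (x + ?p t 0) - s *\<^sub>R ?B k)"])
      fix t :: real assume t: "t \<in> {0..1}"
      have n: "norm (?p t 1) \<le> s * c" "norm (?p t 0) \<le> s * c" using small[OF t, of 1] small[OF t, of 0] by auto
      then have n': "norm (?p t 1) < d" "norm (?p t 0) < d" using sd by auto
      have D: "(f has_derivative frechet_derivative f (at (x + ?p t r))) (at (x + ?p t r))" if "r \<in> {0,1}" for r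
        using Ck_on_has_derivative[OF f2 d(2), of "?p t r"] n' that by auto
      have "((\<lambda>t. f (x + s *\<^sub>R k + t *\<^sub>R s *\<^sub>R h)) has_vector_derivative frechet_derivative f (at (x + ?p t 1)) (s *\<^sub>R h)) (at t)"
        by (rule has_vector_derivative_line) (use D[of 1] in \<open>simp add: algebra_simps\<close>)
      moreover have "((\<lambda>t. f (x + t *\<^sub>R s *\<^sub>R h)) has_vector_derivative frechet_derivative f (at (x + ?p t 0)) (s *\<^sub>R h)) (at t)"
        by (rule has_vector_derivative_line) (use D[of 0] in simp)
      ultimately have "(?r has_vector_derivative frechet_derivative f (at (x + ?p t 1)) (s *\<^sub>R h)
          - frechet_derivative f (at (x + ?p t 0)) (s *\<^sub>R h) - s\<^sup>2 *\<^sub>R ?B k) (at t)"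
        by (intro has_vector_derivative_diff has_vector_derivative_scaleR_const)
      moreover have "frechet_derivative f (at (x + ?p t 1)) (s *\<^sub>R h) = s *\<^sub>R ?w (x + ?p t 1)"
        "frechet_derivative f (at (x + ?p t 0)) (s *\<^sub>R h) = s *\<^sub>R ?w (x + ?p t 0)"
        using linear_scale[OF has_derivative_linear[OF D]] by blast+
      moreover have "s *\<^sub>R (?w (x + ?p t 1) - ?w (x + ?p t 0) - s *\<^sub>R ?B k) =
          s *\<^sub>R ?w (x + ?p t 1) - s *\<^sub>R ?w (x + ?p t 0) - s\<^sup>2 *\<^sub>R ?B k"
        by (simp add: scaleR_diff_right power2_eq_square)
      ultimately show "(?r has_vector_derivative s *\<^sub>R (?w (x + ?p t 1) - ?w (x + ?p t 0) - s *\<^sub>R ?B k)) (at t)"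
        by (simp only:)
      have "?w (x + ?p t 1) - ?w (x + ?p t 0) - s *\<^sub>R ?B k =
        (?w (x + ?p t 1) - ?w x - ?B (?p t 1)) - (?w (x + ?p t 0) - ?w x - ?B (?p t 0))"
        by (simp add: linear_add[OF lin] linear_scale[OF lin])
      also have "norm \<dots> \<le> \<eta> / (2 * c) * norm (?p t 1) + \<eta> / (2 * c) * norm (?p t 0)"
        by (intro order_trans[OF norm_triangle_ineq4] add_mono d(3) n')
      also have "\<dots> \<le> \<eta> / (2 * c) * (s * c) + \<eta> / (2 * c) * (s * c)"
        using n \<eta> c by (intro add_mono mult_left_mono) auto
      also have "\<dots> = \<eta> * s" using c by (simp add: field_simps)
      finally have "s * norm (?w (x + ?p t 1) - ?w (x + ?p t 0) - s *\<^sub>R ?B k) \<le> s * (\<eta> * s)"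
        using s by (intro mult_left_mono) auto
      then show "norm (s *\<^sub>R (?w (x + ?p t 1) - ?w (x + ?p t 0) - s *\<^sub>R ?B k)) \<le> \<eta> * s\<^sup>2"
        using s by (simp add: power2_eq_square mult_ac)
    qed simp
    moreover have "?r 1 - ?r 0 = f (x + s *\<^sub>R h + s *\<^sub>R k) - f (x + s *\<^sub>R h) - f (x + s *\<^sub>R k) + f x - s\<^sup>2 *\<^sub>R ?B k"
      by (simp add: algebra_simps)
    ultimately show "norm (f (x + s *\<^sub>R h + s *\<^sub>R k) - f (x + s *\<^sub>R h) - f (x + s *\<^sub>R k) + f x - s\<^sup>2 *\<^sub>R ?B k) \<le> \<eta> * s\<^sup>2"
      by (simp only:)
  qed
qed

text \<open>The second difference is symmetric in \<open>h\<close> and \<open>k\<close>, and both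
  second derivatives approximate it. With \<open>\<eta>\<close> a third of their distance, two
  errors of size \<open>\<eta>\<close> cannot bridge the gap.\<close>

lemma second_derivative_symmetric:
  fixes f :: "'a::euclidean_space \<Rightarrow> 'b::euclidean_space"
  assumes U: "open U" and f: "Ck_on 2 U f" and x: "x \<in> U"
  shows "second_derivative f x h k = second_derivative f x k h"
proof (rule ccontr)
  assume ne: "second_derivative f x h k \<noteq> second_derivative f x k h"
  define \<eta> where "\<eta> = norm (second_derivative f x h k - second_derivative f x k h) / 3"
  have \<eta>: "\<eta> > 0" using ne by (simp add: \<eta>_def)
  obtain d1 d2 where d: "d1 > 0" "d2 > 0"
    "\<And>s. 0 < s \<and> s < d1 \<Longrightarrow> norm (f (x + s *\<^sub>R h + s *\<^sub>R k) - f (x + s *\<^sub>R h) - f (x + s *\<^sub>R k) + f x - s\<^sup>2 *\<^sub>R second_derivative f x h k) \<le> \<eta> * s\<^sup>2"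
    "\<And>s. 0 < s \<and> s < d2 \<Longrightarrow> norm (f (x + s *\<^sub>R k + s *\<^sub>R h) - f (x + s *\<^sub>R k) - f (x + s *\<^sub>R h) + f x - s\<^sup>2 *\<^sub>R second_derivative f x k h) \<le> \<eta> * s\<^sup>2"
    using second_difference[OF U f x \<eta>, of h k] second_difference[OF U f x \<eta>, of k h] by blast
  define s where "s = min d1 d2 / 2"
  have s: "0 < s \<and> s < d1" "0 < s \<and> s < d2" using d(1,2) by (auto simp: s_def)
  let ?a = "f (x + s *\<^sub>R h + s *\<^sub>R k) - f (x + s *\<^sub>R h) - f (x + s *\<^sub>R k) + f x"
  have "norm (?a - s\<^sup>2 *\<^sub>R second_derivative f x k h) \<le> \<eta> * s\<^sup>2"
    using d(4)[OF s(2)] by (simp add: algebra_simps)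
  from norm_triangle_ineq4[THEN order_trans, OF add_mono[OF this d(3)[OF s(1)]]]
  have "norm (s\<^sup>2 *\<^sub>R (second_derivative f x h k - second_derivative f x k h)) \<le> \<eta> * s\<^sup>2 + \<eta> * s\<^sup>2"
    by (simp add: scaleR_diff_right)
  moreover have "norm (s\<^sup>2 *\<^sub>R (second_derivative f x h k - second_derivative f x k h)) = s\<^sup>2 * (3 * \<eta>)"
    unfolding norm_scaleR \<eta>_def by simp
  ultimately have "s\<^sup>2 * (3 * \<eta>) \<le> \<eta> * s\<^sup>2 + \<eta> * s\<^sup>2" by (simp only:)
  then have "s\<^sup>2 * (3 * \<eta>) \<le> s\<^sup>2 * (2 * \<eta>)" by (simp add: algebra_simps)
  then show False using s(1) \<eta> by simp
qed

lemma differentiable_transform_open: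
  assumes "f differentiable (at x)" "open W" "x \<in> W" "\<And>y. y \<in> W \<Longrightarrow> f y = g y"
  shows "g differentiable (at x)"
  using assms unfolding differentiable_def by (meson has_derivative_transform_within_open)

text \<open>Base point and directions all move with \<open>y\<close>, so the form is expanded in the
  basis; its coefficients are differentiable because \<open>f\<close> has one more derivative. This
  gives differentiability of the second bifurcation function.\<close>

lemma differentiable_second_derivative:
  fixes f :: "'a::euclidean_space \<Rightarrow> 'b::euclidean_space" and p h k :: "'c::euclidean_space \<Rightarrow> 'a"
  assumes U: "open U" and f: "Ck_on 3 U f" and W: "open W" "p ` W \<subseteq> U" "x \<in> W"
    and p: "p differentiable (at x)" and hk: "h differentiable (at x)" "k differentiable (at x)"
  shows "(\<lambda>y. second_derivative f (p y) (h y) (k y)) differentiable (at x)"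
proof -
  have f2: "Ck_on 2 U f" by (rule Ck_on_mono[OF f]) simp
  have d: "(\<lambda>y. second_derivative f (p y) b c) differentiable (at x)" for b c
  proof -
    have "Ck_on (Suc 0) U (\<lambda>q. second_derivative f q b c)"
      using f by (intro Ck_on_second_derivative) (simp add: numeral_3_eq_3)
    then have "(\<lambda>q. second_derivative f q b c) differentiable (at (p x))"
      using W(2,3) by (auto dest: Ck_on_has_derivative intro: differentiableI)
    then show ?thesis using differentiable_chain_at[OF p] by (simp add: comp_def)
  qed
  have "(\<lambda>y. \<Sum>b\<in>Basis. \<Sum>c\<in>Basis. (h y \<bullet> b) *\<^sub>R (k y \<bullet> c) *\<^sub>R second_derivative f (p y) b c) differentiable (at x)"
    using hk by (intro differentiable_sum ballI differentiable_scaleR d differentiable_inner) auto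
  then show ?thesis
    by (rule differentiable_transform_open[OF _ W(1,3)])
      (rule second_derivative_eq_double_sum[OF U f2, symmetric], use W(2) in auto)
qed

section \<open>Matrices depending differentiably on a parameter\<close>

lemma differentiable_vec_componentwise:
  fixes f :: "'a::real_normed_vector \<Rightarrow> 'b::euclidean_space ^ 'n"
  assumes "\<And>i. (\<lambda>x. f x $ i) differentiable (at x)"
  shows "f differentiable (at x)"
  unfolding differentiable_componentwise_within[of f]
  using assms by (auto simp: Basis_vec_def inner_axis intro!: differentiable_inner)

lemma differentiable_prod_finite:
  fixes f :: "'i \<Rightarrow> 'a::real_normed_vector \<Rightarrow> real"
  assumes "\<And>i. i \<in> I \<Longrightarrow> f i differentiable (at x)"
  shows "(\<lambda>y. \<Prod>i\<in>I. f i y) differentiable (at x)"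
  using assms by (induction I rule: infinite_finite_induct) (auto intro!: differentiable_mult)

lemma differentiable_det:
  fixes A :: "'a::real_normed_vector \<Rightarrow> real ^ 'n ^ 'n"
  assumes "\<And>i j. (\<lambda>y. A y $ i $ j) differentiable (at x)"
  shows "(\<lambda>y. det (A y)) differentiable (at x)"
  unfolding det_def
  by (intro differentiable_sum ballI differentiable_mult differentiable_prod_finite assms differentiable_const)
    (simp add: finite_permutations)

text \<open>By Cramer's rule the entries of the inverse are quotients of determinants, thus
  polynomials in the entries of \<open>A y\<close> divided by \<open>det (A y)\<close>.\<close>

lemma differentiable_matrix_inv:
  fixes A :: "'a::real_normed_vector \<Rightarrow> real ^ 'n ^ 'n"
  assumes A: "\<And>i j. (\<lambda>y. A y $ i $ j) differentiable (at x)" and W: "open W" "x \<in> W"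
    and det: "\<And>y. y \<in> W \<Longrightarrow> det (A y) \<noteq> 0"
  shows "(\<lambda>y. matrix_inv (A y)) differentiable (at x)"
proof -
  let ?C = "\<lambda>y i j. det (\<chi> a c. if c = i then (if a = j then 1 else 0) else A y $ a $ c) / det (A y)"
  have eq: "?C y i j = matrix_inv (A y) $ i $ j" if y: "y \<in> W" for y i j
  proof -
    obtain B where B: "A y ** B = mat 1" "B ** A y = mat 1"
      using det[OF y] unfolding invertible_det_nz[symmetric] invertible_def by blast
    let ?b = "(\<chi> a. if a = j then 1 else 0) :: real ^ 'n"
    have "A y *v (B *v ?b) = ?b" using B(1) by (simp add: matrix_vector_mul_assoc)
    then have "B *v ?b = (\<chi> k. det (\<chi> a c. if c = k then ?b $ a else A y $ a $ c) / det (A y))"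
      using cramer[OF det[OF y]] by blast
    then have "(B *v ?b) $ i = ?C y i j"
      unfolding vec_lambda_beta by (simp only: vec_lambda_beta)
    moreover have "?b = axis j 1" by (simp add: axis_def)
    ultimately have "(B *v axis j 1) $ i = ?C y i j" by (simp only:)
    moreover have "(B *v axis j 1) $ i = B $ i $ j"
      by (simp add: matrix_vector_mult_basis column_def)
    ultimately show ?thesis using matrix_inv_eqI[OF B] by simp
  qed
  have "(\<lambda>y. ?C y i j) differentiable (at x)" for i j
  proof (intro differentiable_divide differentiable_det)
    show "(\<lambda>y. (\<chi> a c. if c = i then if a = j then 1 else 0 else A y $ a $ c) $ r $ s) differentiable at x" for r s
      using A by (cases "s = i") auto
  qed (use A det[OF W(2)] in auto)
  then have "(\<lambda>y. matrix_inv (A y) $ i $ j) differentiable (at x)" for i j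
    by (rule differentiable_transform_open[OF _ W eq])
  then show ?thesis by (intro differentiable_vec_componentwise)
qed

lemma bounded_bilinear_differentiable:
  assumes "bounded_bilinear B" "f differentiable (at x)" "g differentiable (at x)"
  shows "(\<lambda>y. B (f y) (g y)) differentiable (at x)"
  using bounded_bilinear.FDERIV[OF assms(1)] assms(2,3) unfolding differentiable_def by blast

section \<open>Zeros of perturbed maps\<close>

text \<open>Near \<open>a\<close> the map \<open>N0\<close> is close to \<open>y - a\<close>, so
  \<open>y - N \<epsilon> y\<close> sends a small ball \<open>cball a s\<close> into itself: the
  error of linearisation and that of the perturbation are at most \<open>s / 2\<close> each.
  Brouwer's fixed point is a zero of \<open>N \<epsilon>\<close>.\<close>

lemma zeros_of_perturbation:
  fixes N :: "real \<Rightarrow> 'a::euclidean_space \<Rightarrow> 'a"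
  assumes r: "r > 0" and N0: "(N0 has_derivative (\<lambda>h. h)) (at a)" "N0 a = 0"
    and cont: "\<exists>\<epsilon>1>0. \<forall>\<epsilon>. 0 < \<bar>\<epsilon>\<bar> \<and> \<bar>\<epsilon>\<bar> < \<epsilon>1 \<longrightarrow> continuous_on (cball a r) (N \<epsilon>)"
    and unif: "\<And>\<eta>. \<eta> > 0 \<Longrightarrow> \<exists>\<epsilon>1>0. \<forall>\<epsilon>. 0 < \<bar>\<epsilon>\<bar> \<and> \<bar>\<epsilon>\<bar> < \<epsilon>1 \<longrightarrow> (\<forall>y\<in>cball a r. norm (N \<epsilon> y - N0 y) \<le> \<eta>)"
    and \<rho>: "\<rho> > 0"
  shows "\<exists>\<epsilon>1>0. \<forall>\<epsilon>. 0 < \<bar>\<epsilon>\<bar> \<and> \<bar>\<epsilon>\<bar> < \<epsilon>1 \<longrightarrow> (\<exists>y\<in>cball a r \<inter> cball a \<rho>. N \<epsilon> y = 0)"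
proof -
  obtain d where d: "d > 0" "\<And>y. norm (y - a) < d \<Longrightarrow> norm (N0 y - N0 a - (y - a)) \<le> 1/2 * norm (y - a)"
    using N0(1) unfolding has_derivative_at_alt by (metis half_gt_zero_iff zero_less_one)
  \<comment> \<open>At most \<open>d / 2\<close>, so that the closed ball stays strictly inside the
    range of the linear estimate.\<close>
  define s where "s = min (min r \<rho>) (d / 2)"
  have s: "s > 0" "s \<le> r" "s \<le> \<rho>" "s < d" using r \<rho> d(1) by (auto simp: s_def)
  obtain \<epsilon>1 where \<epsilon>1: "\<epsilon>1 > 0" "\<And>\<epsilon>. 0 < \<bar>\<epsilon>\<bar> \<and> \<bar>\<epsilon>\<bar> < \<epsilon>1 \<Longrightarrow> continuous_on (cball a r) (N \<epsilon>)" using cont by blast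
  obtain \<epsilon>2 where \<epsilon>2: "\<epsilon>2 > 0" "\<And>\<epsilon> y. 0 < \<bar>\<epsilon>\<bar> \<and> \<bar>\<epsilon>\<bar> < \<epsilon>2 \<Longrightarrow> y \<in> cball a r \<Longrightarrow> norm (N \<epsilon> y - N0 y) \<le> s / 2"
    using unif[of "s / 2"] s by auto
  show ?thesis
  proof (intro exI[of _ "min \<epsilon>1 \<epsilon>2"] conjI allI impI)
    show "min \<epsilon>1 \<epsilon>2 > 0" using \<epsilon>1 \<epsilon>2 by simp
    fix \<epsilon> assume \<epsilon>: "0 < \<bar>\<epsilon>\<bar> \<and> \<bar>\<epsilon>\<bar> < min \<epsilon>1 \<epsilon>2"
    have sub: "cball a s \<subseteq> cball a r" using s by auto
    have "\<exists>y\<in>cball a s. N \<epsilon> y = 0"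
    proof (rule brouwer_surjective_cball[where S="{0}"])
      show "continuous_on (cball a s) (N \<epsilon>)"
        using \<epsilon>1(2)[of \<epsilon>] \<epsilon> continuous_on_subset sub by auto
      fix x y assume "x \<in> {0::'a}" and y: "y \<in> cball a s"
      have y1: "norm (y - a) \<le> s" using y by (simp add: dist_norm norm_minus_commute)
      have "norm (N0 y - (y - a)) \<le> 1/2 * norm (y - a)" using d(2)[of y] y1 s N0(2) by simp
      moreover have "norm (N \<epsilon> y - N0 y) \<le> s / 2" using \<epsilon>2(2)[of \<epsilon> y] \<epsilon> y sub by auto
      ultimately have "norm ((N \<epsilon> y - N0 y) + (N0 y - (y - a))) \<le> s"
        using y1 norm_triangle_ineq[of "N \<epsilon> y - N0 y" "N0 y - (y - a)"] by simp
      then show "x + (y - N \<epsilon> y) \<in> cball a s"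
        using \<open>x \<in> {0}\<close> by (simp add: dist_norm algebra_simps)
    qed (use s in auto)
    then show "\<exists>y\<in>cball a r \<inter> cball a \<rho>. N \<epsilon> y = 0" using sub s by auto
  qed
qed

text \<open>
  For every \<open>\<epsilon>\<close> a point is chosen whose distance to the limit is minimal up to \<open>\<bar>\<epsilon>\<bar>\<close>.
\<close>

lemma tendsto_choice:
  fixes P :: "real \<Rightarrow> 'a::metric_space \<Rightarrow> bool"
  assumes "\<And>\<rho>. \<rho> > 0 \<Longrightarrow> \<exists>\<epsilon>1>0. \<forall>\<epsilon>. 0 < \<bar>\<epsilon>\<bar> \<and> \<bar>\<epsilon>\<bar> < \<epsilon>1 \<longrightarrow> (\<exists>z. P \<epsilon> z \<and> dist z a \<le> \<rho>)" and "\<epsilon>0 > 0"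
  shows "\<exists>\<epsilon>1 z. 0 < \<epsilon>1 \<and> \<epsilon>1 \<le> \<epsilon>0 \<and> (\<forall>\<epsilon>. 0 < \<bar>\<epsilon>\<bar> \<and> \<bar>\<epsilon>\<bar> < \<epsilon>1 \<longrightarrow> P \<epsilon> (z \<epsilon>)) \<and> (z \<longlongrightarrow> a) (at 0)"
proof -
  let ?S = "\<lambda>\<epsilon>. {dist z a | z. P \<epsilon> z}"
  have bdd: "bdd_below (?S \<epsilon>)" for \<epsilon> by (rule bdd_belowI[of _ 0]) auto
  obtain \<epsilon>1 where \<epsilon>1: "\<epsilon>1 > 0" "\<forall>\<epsilon>. 0 < \<bar>\<epsilon>\<bar> \<and> \<bar>\<epsilon>\<bar> < \<epsilon>1 \<longrightarrow> (\<exists>z. P \<epsilon> z \<and> dist z a \<le> 1)"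
    using assms(1)[OF zero_less_one] by (elim exE conjE)
  have ex: "\<exists>z. P \<epsilon> z \<and> dist z a < Inf (?S \<epsilon>) + \<bar>\<epsilon>\<bar>" if "0 < \<bar>\<epsilon>\<bar> \<and> \<bar>\<epsilon>\<bar> < \<epsilon>1" for \<epsilon>
  proof -
    have "?S \<epsilon> \<noteq> {}" using \<epsilon>1(2)[rule_format, OF that] by auto
    from cInf_lessD[OF this, of "Inf (?S \<epsilon>) + \<bar>\<epsilon>\<bar>"] that show ?thesis by auto
  qed
  define z where "z \<epsilon> = (SOME z. P \<epsilon> z \<and> dist z a < Inf (?S \<epsilon>) + \<bar>\<epsilon>\<bar>)" for \<epsilon>
  have z: "P \<epsilon> (z \<epsilon>) \<and> dist (z \<epsilon>) a < Inf (?S \<epsilon>) + \<bar>\<epsilon>\<bar>" if "0 < \<bar>\<epsilon>\<bar> \<and> \<bar>\<epsilon>\<bar> < \<epsilon>1" for \<epsilon>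
    unfolding z_def by (rule someI_ex) (rule ex[OF that])
  have "(z \<longlongrightarrow> a) (at 0)"
  proof (rule tendstoI)
    fix e :: real assume e: "e > 0"
    obtain \<epsilon>2 where \<epsilon>2: "\<epsilon>2 > 0" "\<forall>\<epsilon>. 0 < \<bar>\<epsilon>\<bar> \<and> \<bar>\<epsilon>\<bar> < \<epsilon>2 \<longrightarrow> (\<exists>z. P \<epsilon> z \<and> dist z a \<le> e / 2)"
      using assms(1)[OF half_gt_zero[OF e]] by (elim exE conjE)
    have "dist (z \<epsilon>) a < e" if \<epsilon>: "0 < \<bar>\<epsilon>\<bar>" "\<bar>\<epsilon>\<bar> < min (min \<epsilon>1 \<epsilon>2) (e / 2)" for \<epsilon>
    proof -
      obtain w where w: "P \<epsilon> w" "dist w a \<le> e / 2" using \<epsilon>2(2) \<epsilon> by auto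
      have "Inf (?S \<epsilon>) \<le> dist w a" using w(1) by (intro cInf_lower bdd) auto
      then show ?thesis using z[of \<epsilon>] \<epsilon> w by auto
    qed
    then show "\<forall>\<^sub>F \<epsilon> in at 0. dist (z \<epsilon>) a < e"
      unfolding eventually_at using \<epsilon>1(1) \<epsilon>2(1) e
      by (intro exI[of _ "min (min \<epsilon>1 \<epsilon>2) (e / 2)"]) auto
  qed
  then show ?thesis
    using z \<epsilon>1(1) assms(2) by (intro exI[of _ "min \<epsilon>1 \<epsilon>0"] exI[of _ z]) auto
qed

section \<open>Periodic solutions\<close>

lemma periodic_int:
  assumes "periodic T f"
  shows "f (\<theta> + of_int k * T) = f \<theta>"
proof (induction k arbitrary: \<theta> rule: int_induct[of _ 0])
  case base
  show ?case by simp
next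
  case (step1 i)
  have "f (\<theta> + of_int (i + 1) * T) = f ((\<theta> + of_int i * T) + T)" by (simp add: algebra_simps)
  then show ?case using assms step1 by (simp add: periodic_def)
next
  case (step2 i)
  have "f (\<theta> + of_int i * T) = f ((\<theta> + of_int (i - 1) * T) + T)" by (simp add: algebra_simps)
  then show ?case using assms step2 by (simp add: periodic_def)
qed

lemma has_vector_derivative_shift:
  assumes "(f has_vector_derivative f') (at (\<theta> - c) within S)"
  shows "((\<lambda>\<theta>. f (\<theta> - c)) has_vector_derivative f') (at \<theta> within (\<lambda>s. s + c) ` S)"
proof -
  have "((\<lambda>\<theta>. \<theta> - c) has_vector_derivative 1) (at \<theta> within (\<lambda>s. s + c) ` S)"
    by (auto intro!: derivative_eq_intros simp: has_real_derivative_iff_has_vector_derivative[symmetric])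
  from vector_diff_chain_within[OF this] assms show ?thesis by (simp add: image_image comp_def)
qed

text \<open>Both pieces are attached at time 0: \<open>xm\<close> on \<open>{\<phi> - T..0}\<close>
  is the piece on \<open>{\<phi>..T}\<close> moved back by one period. Besides the common value at
  0, the pieces then only have to agree at \<open>\<phi>\<close> and
  \<open>\<phi> - T\<close>.\<close>

lemma periodic_solution_exists:
  fixes xp xm :: "real \<Rightarrow> real ^ 'p::finite"
  assumes T: "0 < T" "0 < \<phi>" "\<phi> \<le> T"
    and perp: "\<And>x. x \<in> D \<Longrightarrow> periodic T (\<lambda>\<theta>. rhs Fp Rp \<theta> x \<epsilon>)"
    and perm: "\<And>x. x \<in> D \<Longrightarrow> periodic T (\<lambda>\<theta>. rhs Fm Rm \<theta> x \<epsilon>)"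
    and xp: "\<And>s. s \<in> {0..\<phi>} \<Longrightarrow> xp s \<in> D \<and> (xp has_vector_derivative rhs Fp Rp s (xp s) \<epsilon>) (at s within {0..\<phi>})"
    and xm: "\<And>s. s \<in> {\<phi> - T..0} \<Longrightarrow> xm s \<in> D \<and> (xm has_vector_derivative rhs Fm Rm s (xm s) \<epsilon>) (at s within {\<phi> - T..0})"
    and match: "xp 0 = xm 0" "xp \<phi> = xm (\<phi> - T)"
  shows "\<exists>x. pw_solution Fp Fm Rp Rm D T \<phi> \<epsilon> x \<and> periodic T x \<and> x 0 = xp 0"
proof -
  define w where "w s = (if s \<le> \<phi> then xp s else xm (s - T))" for s
  define x where "x \<theta> = w (\<theta> - of_int \<lfloor>\<theta> / T\<rfloor> * T)" for \<theta>
  have per: "periodic T x"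
    unfolding periodic_def
  proof
    fix \<theta>
    have "(\<theta> + T) / T = \<theta> / T + 1" using T by (simp add: field_simps)
    then have "\<lfloor>(\<theta> + T) / T\<rfloor> = \<lfloor>\<theta> / T\<rfloor> + 1" by simp
    then show "x (\<theta> + T) = x \<theta>" by (simp add: x_def algebra_simps)
  qed
  have fl: "x \<theta> = w (\<theta> - of_int k * T)" if "of_int k * T \<le> \<theta>" "\<theta> < (of_int k + 1) * T" for \<theta> and k :: int
  proof -
    have "\<lfloor>\<theta> / T\<rfloor> = k" using that T by (intro floor_unique) (simp_all add: field_simps)
    then show ?thesis by (simp add: x_def)
  qed
  have end': "x ((of_int k + 1) * T) = xp 0" for k :: int
    using fl[of "k + 1" "(of_int k + 1) * T"] T by (simp add: w_def algebra_simps)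
  have P: "x \<theta> = xp (\<theta> - of_int k * T)" if "\<theta> \<in> {of_int k * T..of_int k * T + \<phi>}" for \<theta> and k :: int
  proof (cases "\<theta> < (of_int k + 1) * T")
    case True
    then show ?thesis using fl[of k \<theta>] that by (simp add: w_def)
  next
    case False
    \<comment> \<open>The floor jumps at the right end of a period. This end belongs to the plus
      piece only if \<open>\<phi> = T\<close>, and then the matching conditions give
      \<open>xp T = xm 0 = xp 0\<close>.\<close>
    then have "\<theta> = (of_int k + 1) * T" "\<phi> = T" using that T by (auto simp: algebra_simps)
    then show ?thesis using end'[of k] match by (simp add: algebra_simps)
  qed
  have M: "x \<theta> = xm (\<theta> - (of_int k + 1) * T)" if "\<theta> \<in> {of_int k * T + \<phi>..(of_int k + 1) * T}" for \<theta> and k :: int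
  proof (cases "\<theta> < (of_int k + 1) * T")
    case True
    then have "x \<theta> = w (\<theta> - of_int k * T)" using fl[of k \<theta>] that T by auto
    also have "\<dots> = xm (\<theta> - of_int k * T - T)"
    proof (cases "\<theta> = of_int k * T + \<phi>")
      case True
      then show ?thesis using match by (simp add: w_def)
    next
      case False
      then show ?thesis using that by (simp add: w_def)
    qed
    finally show ?thesis by (simp add: algebra_simps)
  next
    case False
    then have "\<theta> = (of_int k + 1) * T" using that by auto
    then show ?thesis using end'[of k] match by simp
  qed
  have imP: "(\<lambda>s. s + of_int k * T) ` {0..\<phi>} = {of_int k * T..of_int k * T + \<phi>}" for k :: int
    by (simp add: add.commute)
  have imM: "(\<lambda>s. s + (of_int k + 1) * T) ` {\<phi> - T..0} = {of_int k * T + \<phi>..(of_int k + 1) * T}" for k :: int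
    by (simp add: algebra_simps)
  have dP: "(x has_vector_derivative rhs Fp Rp \<theta> (x \<theta>) \<epsilon>) (at \<theta> within {of_int k * T..of_int k * T + \<phi>})" "x \<theta> \<in> D"
    if \<theta>: "\<theta> \<in> {of_int k * T..of_int k * T + \<phi>}" for \<theta> and k :: int
  proof -
    let ?s = "\<theta> - of_int k * T"
    have s: "?s \<in> {0..\<phi>}" using \<theta> by auto
    show D: "x \<theta> \<in> D" using xp[OF s] P[OF \<theta>] by simp
    have "((\<lambda>\<theta>. xp (\<theta> - of_int k * T)) has_vector_derivative rhs Fp Rp ?s (xp ?s) \<epsilon>) (at \<theta> within {of_int k * T..of_int k * T + \<phi>})"
      using has_vector_derivative_shift[of xp _ \<theta> "of_int k * T" "{0..\<phi>}"] xp[OF s] unfolding imP by blast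
    moreover have "rhs Fp Rp ?s (xp ?s) \<epsilon> = rhs Fp Rp \<theta> (x \<theta>) \<epsilon>"
      using periodic_int[OF perp[OF D], of ?s k] P[OF \<theta>] by simp
    ultimately show "(x has_vector_derivative rhs Fp Rp \<theta> (x \<theta>) \<epsilon>) (at \<theta> within {of_int k * T..of_int k * T + \<phi>})"
      using has_vector_derivative_transform[OF \<theta> P] by simp
  qed
  have dM: "(x has_vector_derivative rhs Fm Rm \<theta> (x \<theta>) \<epsilon>) (at \<theta> within {of_int k * T + \<phi>..(of_int k + 1) * T})" "x \<theta> \<in> D"
    if \<theta>: "\<theta> \<in> {of_int k * T + \<phi>..(of_int k + 1) * T}" for \<theta> and k :: int
  proof -
    let ?s = "\<theta> - (of_int k + 1) * T"
    have s: "?s \<in> {\<phi> - T..0}" using \<theta> by (auto simp: algebra_simps)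
    show D: "x \<theta> \<in> D" using xm[OF s] M[OF \<theta>] by simp
    have "((\<lambda>\<theta>. xm (\<theta> - (of_int k + 1) * T)) has_vector_derivative rhs Fm Rm ?s (xm ?s) \<epsilon>)
        (at \<theta> within {of_int k * T + \<phi>..(of_int k + 1) * T})"
      using has_vector_derivative_shift[of xm _ \<theta> "(of_int k + 1) * T" "{\<phi> - T..0}"] xm[OF s] unfolding imM by blast
    moreover have "rhs Fm Rm ?s (xm ?s) \<epsilon> = rhs Fm Rm \<theta> (x \<theta>) \<epsilon>"
      using periodic_int[OF perm[OF D], of ?s "k + 1"] M[OF \<theta>] by simp
    ultimately show "(x has_vector_derivative rhs Fm Rm \<theta> (x \<theta>) \<epsilon>) (at \<theta> within {of_int k * T + \<phi>..(of_int k + 1) * T})"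
      using has_vector_derivative_transform[OF \<theta> M] by simp
  qed
  have c1: "continuous_on {of_int k * T..(of_int k + 1) * T} x" for k :: int
  proof -
    have "continuous_on ({of_int k * T..of_int k * T + \<phi>} \<union> {of_int k * T + \<phi>..(of_int k + 1) * T}) x"
      by (intro continuous_on_closed_Un closed_atLeastAtMost has_vector_derivative_continuous_on[OF dP(1)]
          has_vector_derivative_continuous_on[OF dM(1)])
    moreover have "{of_int k * T..of_int k * T + \<phi>} \<union> {of_int k * T + \<phi>..(of_int k + 1) * T} = {of_int k * T..(of_int k + 1) * T}"
      using T by (intro ivl_disj_un_two_touch) (auto simp: algebra_simps)
    ultimately show ?thesis by simp
  qed
  have fk: "of_int \<lfloor>\<theta> / T\<rfloor> * T \<le> \<theta>" "\<theta> < (of_int \<lfloor>\<theta> / T\<rfloor> + 1) * T" for \<theta>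
    using floor_divide_lower[OF T(1)] floor_divide_upper[OF T(1)] by auto
  have "isCont x \<theta>" for \<theta>
  proof -
    define k where "k = \<lfloor>\<theta> / T\<rfloor>"
    \<comment> \<open>Two neighbouring periods are joined, so that \<open>\<theta>\<close> is an
      interior point even if it is a multiple of \<open>T\<close>.\<close>
    have "continuous_on ({of_int (k - 1) * T..(of_int (k - 1) + 1) * T} \<union> {of_int k * T..(of_int k + 1) * T}) x"
      by (intro continuous_on_closed_Un closed_atLeastAtMost c1)
    moreover have "{(of_int k - 1) * T<..<(of_int k + 1) * T} \<subseteq>
        {of_int (k - 1) * T..(of_int (k - 1) + 1) * T} \<union> {of_int k * T..(of_int k + 1) * T}"
      by auto
    ultimately have "continuous_on {(of_int k - 1) * T<..<(of_int k + 1) * T} x"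
      by (rule continuous_on_subset)
    moreover have "\<theta> \<in> {(of_int k - 1) * T<..<(of_int k + 1) * T}"
      using fk[of \<theta>] T unfolding k_def[symmetric] by (auto simp: algebra_simps)
    ultimately show ?thesis using continuous_on_eq_continuous_at[OF open_greaterThanLessThan] by blast
  qed
  then have "continuous_on UNIV x" by (simp add: continuous_at_imp_continuous_on)
  moreover have "x \<theta> \<in> D" for \<theta>
    using dP(2)[of \<theta> "\<lfloor>\<theta> / T\<rfloor>"] dM(2)[of \<theta> "\<lfloor>\<theta> / T\<rfloor>"] fk[of \<theta>] by fastforce
  ultimately have "pw_solution Fp Fm Rp Rm D T \<phi> \<epsilon> x"
    unfolding pw_solution_def using dP(1) dM(1) by blast
  moreover have "x 0 = xp 0" using P[of 0 0] T by simp
  ultimately show ?thesis using per by blast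
qed

section \<open>The displacement function\<close>

lemma pw_solution_pieces:
  assumes "pw_solution Fp Fm Rp Rm D T \<phi> \<epsilon> x" "0 < \<phi>" "\<phi> \<le> T"
  shows "s \<in> closed_segment 0 \<phi> \<Longrightarrow> x s \<in> D"
    "s \<in> closed_segment 0 \<phi> \<Longrightarrow> (x has_vector_derivative rhs Fp Rp s (x s) \<epsilon>) (at s within closed_segment 0 \<phi>)"
    "s \<in> closed_segment 0 (\<phi> - T) \<Longrightarrow> x s \<in> D"
    "s \<in> closed_segment 0 (\<phi> - T) \<Longrightarrow> (x has_vector_derivative rhs Fm Rm s (x s) \<epsilon>) (at s within closed_segment 0 (\<phi> - T))"
proof -
  have seg: "closed_segment 0 \<phi> = {0..\<phi>}" "closed_segment 0 (\<phi> - T) = {\<phi> - T..0}"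
    using assms by (auto simp: closed_segment_eq_real_ivl)
  \<comment> \<open>The minus piece that ends at time 0 has the index -1.\<close>
  have k: "of_int 0 * T = 0" "of_int (-1) * T + \<phi> = \<phi> - T" "(of_int (-1) + 1) * T = 0" by auto
  note p = assms(1)[unfolded pw_solution_def]
  show "x s \<in> D" "x s \<in> D" using p by auto
  show "s \<in> closed_segment 0 \<phi> \<Longrightarrow> (x has_vector_derivative rhs Fp Rp s (x s) \<epsilon>) (at s within closed_segment 0 \<phi>)"
    using p[THEN conjunct2, THEN conjunct2, THEN spec, of 0, THEN conjunct1] unfolding seg k by simp
  show "s \<in> closed_segment 0 (\<phi> - T) \<Longrightarrow> (x has_vector_derivative rhs Fm Rm s (x s) \<epsilon>) (at s within closed_segment 0 (\<phi> - T))"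
    using p[THEN conjunct2, THEN conjunct2, THEN spec, of "-1", THEN conjunct2] unfolding seg k by simp
qed

lemma rhs_0: "rhs F R s v 0 = F 0 s v"
  by (simp add: rhs_def)

lemma rhs_periodic:
  assumes "\<And>i x. \<lbrakk>i \<in> {0, 1, 2}; x \<in> D\<rbrakk> \<Longrightarrow> periodic T (\<lambda>\<theta>. F i \<theta> x)"
    and "\<And>x \<epsilon>. \<lbrakk>x \<in> D; \<epsilon> \<in> {-\<epsilon>0<..<\<epsilon>0}\<rbrakk> \<Longrightarrow> periodic T (\<lambda>\<theta>. R \<theta> x \<epsilon>)"
    and "x \<in> D" "\<epsilon> \<in> {-\<epsilon>0<..<\<epsilon>0}"
  shows "periodic T (\<lambda>\<theta>. rhs F R \<theta> x \<epsilon>)"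
proof -
  have "F i (\<theta> + T) x = F i \<theta> x" if "i \<in> {0, 1, 2}" for i \<theta>
    using assms(1)[OF that assms(3)] by (simp add: periodic_def)
  moreover have "R (\<theta> + T) x \<epsilon> = R \<theta> x \<epsilon>" for \<theta>
    using assms(2)[OF assms(3,4)] by (simp add: periodic_def)
  ultimately show ?thesis by (simp add: periodic_def rhs_def)
qed

text \<open>On a periodic orbit the values compared by \<open>g0\<close> are \<open>x \<phi>\<close>
  and \<open>x (\<phi> - T)\<close>, which lie one period apart.\<close>

lemma g0_eq_0:
  assumes "0 < \<phi>" "\<phi> \<le> T" "open D"
    and Fp: "Ck_on 3 (UNIV \<times> D) (\<lambda>(\<theta>, x). Fp 0 \<theta> x)" and Fm: "Ck_on 3 (UNIV \<times> D) (\<lambda>(\<theta>, x). Fm 0 \<theta> x)"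
    and x: "pw_solution Fp Fm Rp Rm D T \<phi> 0 x" "periodic T x"
  shows "g0 Fp Fm D T \<phi> (x 0) = 0"
proof -
  note p = pw_solution_pieces[OF x(1) assms(1,2), unfolded rhs_0]
  have F1: "Ck_on 1 (UNIV \<times> D) (\<lambda>(\<theta>, x). Fp 0 \<theta> x)" "Ck_on 1 (UNIV \<times> D) (\<lambda>(\<theta>, x). Fm 0 \<theta> x)"
    by (rule Ck_on_mono[OF Fp], simp) (rule Ck_on_mono[OF Fm], simp)
  have "flow (Fp 0) D \<phi> (x 0) = x \<phi>"
    by (rule flow_eqI[OF assms(3) F1(1), of \<phi> x \<phi>]) (use p in auto)
  moreover have "flow (Fm 0) D (\<phi> - T) (x 0) = x (\<phi> - T)"
    by (rule flow_eqI[OF assms(3) F1(2), of "\<phi> - T" x "\<phi> - T"]) (use p in auto)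
  moreover have "x (\<phi> - T) = x \<phi>"
    using x(2)[unfolded periodic_def, THEN spec, of "\<phi> - T"] by simp
  ultimately show ?thesis by (simp add: g0_def y0_def)
qed

text \<open>\<open>\<Psi>\<close> is the difference of the two half flows, so a zero yields two
  pieces that fit together to a periodic solution. It is defined only near one orbit, where both
  half flows exist. Its second parameter derivative is the difference of the two \<open>y2\<close>,
  hence \<open>2 *\<^sub>R g2\<close> by the normalisation of \<open>g2\<close>.\<close>

lemma displacement:
  fixes Fp Fm :: "nat \<Rightarrow> real \<Rightarrow> real ^ 'p \<Rightarrow> real ^ 'p::finite"
    and Rp Rm :: "real \<Rightarrow> real ^ 'p \<Rightarrow> real \<Rightarrow> real ^ 'p"
  assumes T: "0 < T" "0 < \<phi>" "\<phi> \<le> T" and \<epsilon>0: "0 < \<epsilon>0" and D: "open D"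
    and F_smooth: "\<And>i F. \<lbrakk>i \<in> {0, 1, 2}; F \<in> {Fp, Fm}\<rbrakk> \<Longrightarrow>
           Ck_on 3 (UNIV \<times> D) (\<lambda>(\<theta>, x). F i \<theta> x)"
    and F_periodic: "\<And>i F x. \<lbrakk>i \<in> {0, 1, 2}; F \<in> {Fp, Fm}; x \<in> D\<rbrakk> \<Longrightarrow>
           periodic T (\<lambda>\<theta>. F i \<theta> x)"
    and R_smooth: "\<And>R. R \<in> {Rp, Rm} \<Longrightarrow>
           Ck_on 3 (UNIV \<times> D \<times> {-\<epsilon>0<..<\<epsilon>0}) (\<lambda>(\<theta>, x, \<epsilon>). R \<theta> x \<epsilon>)"
    and R_periodic: "\<And>R x \<epsilon>. \<lbrakk>R \<in> {Rp, Rm}; x \<in> D; \<epsilon> \<in> {-\<epsilon>0<..<\<epsilon>0}\<rbrakk> \<Longrightarrow>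
           periodic T (\<lambda>\<theta>. R \<theta> x \<epsilon>)"
    and x0: "pw_solution Fp Fm Rp Rm D T \<phi> 0 x0"
  obtains \<delta> \<Psi> where "\<delta> > 0" "Ck_on 3 (ball (x0 0, 0 :: real) \<delta>) \<Psi>"
    "\<And>z \<epsilon>. (z, \<epsilon>) \<in> ball (x0 0, 0) \<delta> \<Longrightarrow> \<Psi> (z, \<epsilon>) = 0 \<Longrightarrow>
      \<exists>x. pw_solution Fp Fm Rp Rm D T \<phi> \<epsilon> x \<and> periodic T x \<and> x 0 = z"
    "\<And>z. (z, 0 :: real) \<in> ball (x0 0, 0) \<delta> \<Longrightarrow> \<Psi> (z, 0) = g0 Fp Fm D T \<phi> z"
    "\<And>z h. (z, 0 :: real) \<in> ball (x0 0, 0) \<delta> \<Longrightarrow> frechet_derivative \<Psi> (at (z, 0)) (h, 0) = Ydiff Fp Fm D T \<phi> z *v h"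
    "\<And>z. (z, 0 :: real) \<in> ball (x0 0, 0) \<delta> \<Longrightarrow> frechet_derivative \<Psi> (at (z, 0)) (0, 1) = g1 Fp Fm D T \<phi> z"
    "\<And>z. (z, 0 :: real) \<in> ball (x0 0, 0) \<delta> \<Longrightarrow> second_derivative \<Psi> (z, 0) (0, 1) (0, 1) = 2 *\<^sub>R g2 Fp Fm D T \<phi> z"
proof -
  note p = pw_solution_pieces[OF x0 T(2,3), unfolded rhs_0]
  have Fp: "\<And>i. i \<in> {0, 1, 2} \<Longrightarrow> Ck_on 3 (UNIV \<times> D) (\<lambda>(\<theta>, x). Fp i \<theta> x)"
    and Fm: "\<And>i. i \<in> {0, 1, 2} \<Longrightarrow> Ck_on 3 (UNIV \<times> D) (\<lambda>(\<theta>, x). Fm i \<theta> x)"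
    by (rule F_smooth, assumption, simp)+
  have Rp: "Ck_on 3 (UNIV \<times> D \<times> {-\<epsilon>0<..<\<epsilon>0}) (\<lambda>(\<theta>, x, \<epsilon>). Rp \<theta> x \<epsilon>)"
    and Rm: "Ck_on 3 (UNIV \<times> D \<times> {-\<epsilon>0<..<\<epsilon>0}) (\<lambda>(\<theta>, x, \<epsilon>). Rm \<theta> x \<epsilon>)"
    by (rule R_smooth, simp)+
  obtain \<delta>p \<Phi>p where \<delta>p: "\<delta>p > 0" "Ck_on 3 (ball (x0 0, 0 :: real) \<delta>p) \<Phi>p"
    "\<And>z \<epsilon>. (z, \<epsilon>) \<in> ball (x0 0, 0) \<delta>p \<Longrightarrow> \<exists>x. x 0 = z \<and> x \<phi> = \<Phi>p (z, \<epsilon>) \<and> (\<forall>s\<in>closed_segment 0 \<phi>.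
      x s \<in> D \<and> (x has_vector_derivative rhs Fp Rp s (x s) \<epsilon>) (at s within closed_segment 0 \<phi>))"
    "\<And>z. (z, 0 :: real) \<in> ball (x0 0, 0) \<delta>p \<Longrightarrow> \<Phi>p (z, 0) = y0 Fp D \<phi> z"
    "\<And>z h. (z, 0 :: real) \<in> ball (x0 0, 0) \<delta>p \<Longrightarrow>
      frechet_derivative \<Phi>p (at (z, 0)) (h, 0) = fund_matrix (Fp 0) D \<phi> z *v h"
    "\<And>z. (z, 0 :: real) \<in> ball (x0 0, 0) \<delta>p \<Longrightarrow> frechet_derivative \<Phi>p (at (z, 0)) (0, 1) = y1 Fp D \<phi> z"
    "\<And>z. (z, 0 :: real) \<in> ball (x0 0, 0) \<delta>p \<Longrightarrow> second_derivative \<Phi>p (z, 0) (0, 1) (0, 1) = y2 Fp D \<phi> z"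
    by (rule half_flow[where F=Fp and R=Rp and ?x0.0=x0 and \<theta>=\<phi>, OF D \<epsilon>0 Fp Rp p(1,2)]) (assumption | (rule that; assumption))+
  obtain \<delta>m \<Phi>m where \<delta>m: "\<delta>m > 0" "Ck_on 3 (ball (x0 0, 0 :: real) \<delta>m) \<Phi>m"
    "\<And>z \<epsilon>. (z, \<epsilon>) \<in> ball (x0 0, 0) \<delta>m \<Longrightarrow> \<exists>x. x 0 = z \<and> x (\<phi> - T) = \<Phi>m (z, \<epsilon>) \<and> (\<forall>s\<in>closed_segment 0 (\<phi> - T).
      x s \<in> D \<and> (x has_vector_derivative rhs Fm Rm s (x s) \<epsilon>) (at s within closed_segment 0 (\<phi> - T)))"
    "\<And>z. (z, 0 :: real) \<in> ball (x0 0, 0) \<delta>m \<Longrightarrow> \<Phi>m (z, 0) = y0 Fm D (\<phi> - T) z"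
    "\<And>z h. (z, 0 :: real) \<in> ball (x0 0, 0) \<delta>m \<Longrightarrow>
      frechet_derivative \<Phi>m (at (z, 0)) (h, 0) = fund_matrix (Fm 0) D (\<phi> - T) z *v h"
    "\<And>z. (z, 0 :: real) \<in> ball (x0 0, 0) \<delta>m \<Longrightarrow> frechet_derivative \<Phi>m (at (z, 0)) (0, 1) = y1 Fm D (\<phi> - T) z"
    "\<And>z. (z, 0 :: real) \<in> ball (x0 0, 0) \<delta>m \<Longrightarrow> second_derivative \<Phi>m (z, 0) (0, 1) (0, 1) = y2 Fm D (\<phi> - T) z"
    by (rule half_flow[where F=Fm and R=Rm and ?x0.0=x0 and \<theta>="\<phi> - T", OF D \<epsilon>0 Fm Rm p(3,4)]) (assumption | (rule that; assumption))+
  \<comment> \<open>The bound \<open>\<epsilon>0\<close> keeps the parameter in the range where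
    \<open>Rp\<close> and \<open>Rm\<close> are known to be periodic.\<close>
  define \<delta> where "\<delta> = min \<epsilon>0 (min \<delta>p \<delta>m)"
  define \<Psi> where "\<Psi> q = \<Phi>p q - \<Phi>m q" for q
  let ?B = "ball (x0 0, 0 :: real) \<delta>"
  have \<delta>: "\<delta> > 0" using \<delta>p(1) \<delta>m(1) \<epsilon>0 by (simp add: \<delta>_def)
  have sub: "?B \<subseteq> ball (x0 0, 0) \<delta>p" "?B \<subseteq> ball (x0 0, 0) \<delta>m" by (auto simp: \<delta>_def)
  have Cp: "Ck_on (Suc (Suc (Suc 0))) ?B \<Phi>p" and Cm: "Ck_on (Suc (Suc (Suc 0))) ?B \<Phi>m"
    using Ck_on_subset[OF \<delta>p(2) sub(1)] Ck_on_subset[OF \<delta>m(2) sub(2)] by (simp_all add: numeral_3_eq_3)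
  have \<Psi>3: "Ck_on 3 ?B \<Psi>"
    unfolding \<Psi>_def numeral_3_eq_3 by (intro Ck_on_diff open_ball Cp Cm)
  have D\<Psi>: "frechet_derivative \<Psi> (at q) h = frechet_derivative \<Phi>p (at q) h - frechet_derivative \<Phi>m (at q) h"
    if "q \<in> ?B" for q h
    using has_derivative_diff[OF Ck_on_has_derivative[OF Cp that] Ck_on_has_derivative[OF Cm that]]
    unfolding \<Psi>_def[abs_def] by (simp add: frechet_derivative_eqI)
  have D2\<Psi>: "second_derivative \<Psi> q h k = second_derivative \<Phi>p q h k - second_derivative \<Phi>m q h k"
    if "q \<in> ?B" for q h k
  proof -
    have "((\<lambda>q. frechet_derivative \<Phi>p (at q) h - frechet_derivative \<Phi>m (at q) h) has_derivative
        (\<lambda>k. second_derivative \<Phi>p q h k - second_derivative \<Phi>m q h k)) (at q)"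
      unfolding second_derivative_def
      by (rule has_derivative_diff[OF Ck_on_has_derivative[OF Ck_on_derivative[OF Cp] that]
            Ck_on_has_derivative[OF Ck_on_derivative[OF Cm] that]])
    then have "((\<lambda>q. frechet_derivative \<Psi> (at q) h) has_derivative
        (\<lambda>k. second_derivative \<Phi>p q h k - second_derivative \<Phi>m q h k)) (at q)"
      by (rule has_derivative_transform_within_open[OF _ open_ball that]) (simp add: D\<Psi>)
    then show ?thesis unfolding second_derivative_def[of \<Psi>] by (simp add: frechet_derivative_eqI)
  qed
  show ?thesis
  proof (rule that[OF \<delta> \<Psi>3])
    fix z \<epsilon> assume q: "(z, \<epsilon>) \<in> ?B" and z: "\<Psi> (z, \<epsilon>) = 0"
    have "dist \<epsilon> 0 \<le> dist (z, \<epsilon>) (x0 0, 0)" using dist_snd_le[of "(z, \<epsilon>)" "(x0 0, 0)"] by simp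
    also have "\<dots> < \<epsilon>0" using q by (simp add: dist_commute \<delta>_def)
    finally have \<epsilon>: "\<epsilon> \<in> {-\<epsilon>0<..<\<epsilon>0}" by auto
    have seg: "closed_segment 0 \<phi> = {0..\<phi>}" "closed_segment 0 (\<phi> - T) = {\<phi> - T..0}"
      using T by (auto simp: closed_segment_eq_real_ivl)
    obtain xp where xp: "xp 0 = z" "xp \<phi> = \<Phi>p (z, \<epsilon>)" "\<forall>s\<in>{0..\<phi>}.
        xp s \<in> D \<and> (xp has_vector_derivative rhs Fp Rp s (xp s) \<epsilon>) (at s within {0..\<phi>})"
      using \<delta>p(3)[OF subsetD[OF sub(1) q], unfolded seg] by (elim exE conjE)
    obtain xm where xm: "xm 0 = z" "xm (\<phi> - T) = \<Phi>m (z, \<epsilon>)" "\<forall>s\<in>{\<phi> - T..0}.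
        xm s \<in> D \<and> (xm has_vector_derivative rhs Fm Rm s (xm s) \<epsilon>) (at s within {\<phi> - T..0})"
      using \<delta>m(3)[OF subsetD[OF sub(2) q], unfolded seg] by (elim exE conjE)
    have per: "periodic T (\<lambda>\<theta>. rhs Fp Rp \<theta> x \<epsilon>)" "periodic T (\<lambda>\<theta>. rhs Fm Rm \<theta> x \<epsilon>)" if "x \<in> D" for x
      by (rule rhs_periodic[OF _ _ that \<epsilon>]; rule F_periodic R_periodic; simp)+
    show "\<exists>x. pw_solution Fp Fm Rp Rm D T \<phi> \<epsilon> x \<and> periodic T x \<and> x 0 = z"
    proof -
      have "xp 0 = xm 0" "xp \<phi> = xm (\<phi> - T)" using xp(1,2) xm(1,2) z by (simp_all add: \<Psi>_def)
      then have "\<exists>x. pw_solution Fp Fm Rp Rm D T \<phi> \<epsilon> x \<and> periodic T x \<and> x 0 = xp 0"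
        by (intro periodic_solution_exists[OF T] per bspec[OF xp(3)]) (assumption | rule bspec[OF xm(3)])+
      then show ?thesis unfolding xp(1) .
    qed
  next
    fix z assume q: "(z, 0 :: real) \<in> ?B"
    have q': "(z, 0 :: real) \<in> ball (x0 0, 0) \<delta>p" "(z, 0 :: real) \<in> ball (x0 0, 0) \<delta>m"
      by - (rule subsetD[OF sub(1) q], rule subsetD[OF sub(2) q])
    show "\<Psi> (z, 0) = g0 Fp Fm D T \<phi> z" by (simp add: \<Psi>_def g0_def \<delta>p(4)[OF q'(1)] \<delta>m(4)[OF q'(2)])
    show "frechet_derivative \<Psi> (at (z, 0)) (h, 0) = Ydiff Fp Fm D T \<phi> z *v h" for h
      by (simp add: D\<Psi>[OF q] Ydiff_def \<delta>p(5)[OF q'(1)] \<delta>m(5)[OF q'(2)] matrix_vector_mult_diff_rdistrib)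
    show "frechet_derivative \<Psi> (at (z, 0)) (0, 1) = g1 Fp Fm D T \<phi> z"
      by (simp add: D\<Psi>[OF q] g1_def \<delta>p(6)[OF q'(1)] \<delta>m(6)[OF q'(2)])
    show "second_derivative \<Psi> (z, 0) (0, 1) (0, 1) = 2 *\<^sub>R g2 Fp Fm D T \<phi> z"
      by (simp add: D2\<Psi>[OF q] g2_def \<delta>p(7)[OF q'(1)] \<delta>m(7)[OF q'(2)])
  qed
qed

section \<open>Splitting the coordinates\<close>

lemma pair_vec_split: "pair_vec e u v = pair_vec e u 0 + pair_vec e 0 v"
  by (simp add: pair_vec_def vec_eq_iff)

lemma pair_vec_0: "pair_vec e 0 v = \<xi>_perp e v"
  by (simp add: pair_vec_def \<xi>_perp_def vec_eq_iff)

lemma bounded_linear_pair_vec: "bounded_linear (\<lambda>u. pair_vec e u 0)"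
  unfolding linear_conv_bounded_linear[symmetric]
  by (intro linearI) (simp_all add: pair_vec_def vec_eq_iff)

lemma bounded_linear_\<xi>: "bounded_linear (\<xi> e)"
  unfolding linear_conv_bounded_linear[symmetric]
  by (intro linearI) (simp_all add: \<xi>_def vec_eq_iff)

lemma bounded_linear_\<xi>_perp: "bounded_linear (\<xi>_perp e)"
  unfolding linear_conv_bounded_linear[symmetric]
  by (intro linearI) (simp_all add: \<xi>_perp_def vec_eq_iff)

lemma \<xi>_pair_vec: "inj e \<Longrightarrow> \<xi> e (pair_vec e u v) = u"
  by (simp add: \<xi>_def pair_vec_def vec_eq_iff)

lemma \<xi>_perp_pair_vec: "\<xi>_perp e (pair_vec e u v) = \<xi>_perp e v"
  by (simp add: \<xi>_perp_def pair_vec_def vec_eq_iff)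

lemma \<xi>_perp_idem: "\<xi>_perp e (\<xi>_perp e v) = \<xi>_perp e v"
  by (simp add: \<xi>_perp_def vec_eq_iff)

lemma pair_vec_\<xi>: "inj e \<Longrightarrow> pair_vec e (\<xi> e z) z = z"
  by (auto simp: \<xi>_def pair_vec_def vec_eq_iff)

lemma eq_if_parts_eq:
  assumes "inj e" "\<xi> e x = \<xi> e y" "\<xi>_perp e x = \<xi>_perp e y"
  shows "x = y"
proof -
  have "pair_vec e (\<xi> e z) 0 + \<xi>_perp e z = z" for z
    using trans[OF pair_vec_split[symmetric] pair_vec_\<xi>[OF assms(1)]] unfolding pair_vec_0 .
  from this[of x] this[of y] show ?thesis unfolding assms(2,3) by (rule trans[OF sym])
qed

text \<open>A vector whose coordinates in \<open>range e\<close> vanish meets only the last columns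
  of \<open>M\<close>, where the upper block is zero and the lower one is the corner; the padding in
  \<open>lower_corner\<close> multiplies zeros.\<close>

lemma block_mult:
  assumes "\<And>i j. i \<in> range e \<Longrightarrow> j \<notin> range e \<Longrightarrow> M $ i $ j = 0" and v: "\<xi>_perp e v = v"
  shows "\<xi> e (M *v v) = 0" "\<xi>_perp e (M *v v) = lower_corner e M *v v"
proof -
  have v0: "v $ j = 0" if "j \<in> range e" for j
  proof -
    have "\<xi>_perp e v $ j = 0" using that by (simp add: \<xi>_perp_def)
    then show ?thesis using v by simp
  qed
  have z: "M $ i $ j * v $ j = 0" if "i \<in> range e" for i j
    using assms(1)[OF that] v0 by (cases "j \<in> range e") auto
  have "(\<Sum>j\<in>UNIV. M $ e i $ j * v $ j) = 0" for i
    by (rule sum.neutral) (intro ballI z rangeI)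
  then show "\<xi> e (M *v v) = 0"
    by (simp add: \<xi>_def matrix_vector_mult_def vec_eq_iff)
  have "(\<xi>_perp e (M *v v)) $ i = (lower_corner e M *v v) $ i" for i
  proof (cases "i \<in> range e")
    case True
    have "lower_corner e M $ i $ j * v $ j = 0" for j
      using v0 True by (cases "j \<in> range e") (auto simp: lower_corner_def)
    then have "(\<Sum>j\<in>UNIV. lower_corner e M $ i $ j * v $ j) = 0" by (intro sum.neutral ballI)
    then show ?thesis using True by (simp add: \<xi>_perp_def matrix_vector_mult_def)
  next
    case False
    have "M $ i $ j * v $ j = lower_corner e M $ i $ j * v $ j" for j
      using v0 False by (cases "j \<in> range e") (auto simp: lower_corner_def)
    then have "(\<Sum>j\<in>UNIV. M $ i $ j * v $ j) = (\<Sum>j\<in>UNIV. lower_corner e M $ i $ j * v $ j)"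
      by (intro sum.cong refl)
    then show ?thesis using False by (simp add: \<xi>_perp_def matrix_vector_mult_def)
  qed
  then show "\<xi>_perp e (M *v v) = lower_corner e M *v v" by (simp add: vec_eq_iff)
qed

lemma lower_corner_inverse:
  fixes e :: "'q::finite \<Rightarrow> 'p::finite"
  assumes "det (lower_corner e M) \<noteq> 0"
  shows "\<xi>_perp e (matrix_inv (lower_corner e M) *v \<xi>_perp e w) = matrix_inv (lower_corner e M) *v \<xi>_perp e w"
    "lower_corner e M *v (matrix_inv (lower_corner e M) *v w) = w"
proof -
  show "\<xi>_perp e (matrix_inv (lower_corner e M) *v \<xi>_perp e w) = matrix_inv (lower_corner e M) *v \<xi>_perp e w"
    using matrix_inv_lower_corner[OF assms] by blast
  obtain B where B: "lower_corner e M ** B = mat 1" "B ** lower_corner e M = mat 1"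
    using assms unfolding invertible_det_nz[symmetric] invertible_def by blast
  show "lower_corner e M *v (matrix_inv (lower_corner e M) *v w) = w"
    unfolding matrix_inv_eqI[OF B] by (simp add: matrix_vector_mul_assoc B(1))
qed

section \<open>Bifurcation from the zeros of a reduced function\<close>

text \<open>The common core of both orders, used with \<open>k = 1\<close> and \<open>k = 2\<close>.
  The part \<open>\<xi> e \<zeta>\<close> moves the point along the manifold, the rest of
  \<open>\<zeta>\<close> acts transversally through \<open>b\<close>. After division by
  \<open>\<epsilon> ^ k\<close> the limit is \<open>f\<close> in the first coordinates and the
  identity in the others, so injectivity of \<open>f'\<close> makes its derivative at
  \<open>pair_vec e a 0\<close> invertible.\<close>

lemma bifurcation_zeros:
  fixes e :: "'q::finite \<Rightarrow> 'p::finite" and \<Psi> :: "(real ^ 'p) \<times> real \<Rightarrow> real ^ 'p"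
    and f :: "real ^ 'q \<Rightarrow> real ^ 'q" and c :: "real ^ 'q \<Rightarrow> real ^ 'p" and b :: "real ^ 'p \<Rightarrow> real \<Rightarrow> real ^ 'p"
  assumes e: "inj e" and \<Psi>: "continuous_on B \<Psi>" and r: "r > 0"
    and f0: "f a = 0" and f': "(f has_derivative f') (at a)" and inj: "\<And>u. f' u = 0 \<Longrightarrow> u = 0"
    and c: "continuous_on (cball (pair_vec e a 0) r) (\<lambda>\<zeta>. c (\<xi> e \<zeta>))"
    and b: "\<And>\<epsilon>. continuous_on (cball (pair_vec e a 0) r) (\<lambda>\<zeta>. b \<zeta> \<epsilon>)"
    and bC: "\<And>\<zeta> \<epsilon>. \<zeta> \<in> cball (pair_vec e a 0) r \<Longrightarrow> \<bar>\<epsilon>\<bar> \<le> 1 \<Longrightarrow> norm (b \<zeta> \<epsilon>) \<le> C"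
    and unif: "\<And>\<eta>. \<eta> > 0 \<Longrightarrow> \<exists>\<epsilon>1>0. \<forall>\<epsilon>. 0 < \<bar>\<epsilon>\<bar> \<and> \<bar>\<epsilon>\<bar> < \<epsilon>1 \<longrightarrow> (\<forall>\<zeta>\<in>cball (pair_vec e a 0) r.
        (c (\<xi> e \<zeta>) + \<epsilon> *\<^sub>R b \<zeta> \<epsilon>, \<epsilon>) \<in> B \<and>
        norm (\<Psi> (c (\<xi> e \<zeta>) + \<epsilon> *\<^sub>R b \<zeta> \<epsilon>, \<epsilon>) - \<epsilon> ^ k *\<^sub>R pair_vec e (f (\<xi> e \<zeta>)) \<zeta>) \<le> \<eta> * \<bar>\<epsilon>\<bar> ^ k)"
    and \<rho>: "\<rho> > 0"
  shows "\<exists>\<epsilon>1>0. \<forall>\<epsilon>. 0 < \<bar>\<epsilon>\<bar> \<and> \<bar>\<epsilon>\<bar> < \<epsilon>1 \<longrightarrow> (\<exists>z. ((z, \<epsilon>) \<in> B \<and> \<Psi> (z, \<epsilon>) = 0) \<and> dist z (c a) \<le> \<rho>)"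
proof -
  let ?a = "pair_vec e a 0" and ?Y = "\<lambda>\<zeta> \<epsilon>. (c (\<xi> e \<zeta>) + \<epsilon> *\<^sub>R b \<zeta> \<epsilon>, \<epsilon>)"
  have \<xi>a: "\<xi> e ?a = a" using \<xi>_pair_vec[OF e] .
  have lf: "linear f'" using f' has_derivative_linear by blast
  then obtain S where S: "linear S" "\<And>u. S (f' u) = u" "\<And>u. f' (S u) = u"
    using linear_injective_isomorphism[of f'] inj linear_injective_0[OF lf] by blast
  have bS: "bounded_linear S" using S(1) by (simp add: linear_conv_bounded_linear)
  \<comment> \<open>Undoes \<open>f'\<close> in the first coordinates and leaves the others alone.
    The limit \<open>N0\<close> then has the identity as its derivative, as
    \<open>zeros_of_perturbation\<close> demands.\<close>
  define Tr where "Tr w = pair_vec e (S (\<xi> e w)) 0 + \<xi>_perp e w" for w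
  have Tr: "bounded_linear Tr"
    unfolding Tr_def
    by (intro bounded_linear_add bounded_linear_\<xi>_perp bounded_linear_compose[OF bounded_linear_pair_vec]
        bounded_linear_compose[OF bS] bounded_linear_\<xi>)
  have Tr0: "w = 0" if "Tr w = 0" for w
  proof -
    have T: "Tr w = pair_vec e (S (\<xi> e w)) w"
      using pair_vec_split[of e "S (\<xi> e w)" w] by (simp add: Tr_def pair_vec_0)
    have "S (\<xi> e w) = 0"
      using T that \<xi>_pair_vec[OF e, of "S (\<xi> e w)" w] linear_0[OF bounded_linear.linear[OF bounded_linear_\<xi>, of e]] by simp
    then have "\<xi> e w = 0" using S(3)[of "\<xi> e w"] linear_0[OF lf] by simp
    then show ?thesis using T that \<open>S (\<xi> e w) = 0\<close> pair_vec_\<xi>[OF e, of w] by simp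
  qed
  define G where "G \<zeta> = pair_vec e (f (\<xi> e \<zeta>)) \<zeta>" for \<zeta>
  define N0 where "N0 \<zeta> = Tr (G \<zeta>)" for \<zeta>
  define N where "N \<epsilon> \<zeta> = Tr ((1 / \<epsilon> ^ k) *\<^sub>R \<Psi> (?Y \<zeta> \<epsilon>))" for \<epsilon> \<zeta>
  have N0': "N0 \<zeta> = pair_vec e (S (f (\<xi> e \<zeta>))) 0 + \<xi>_perp e \<zeta>" for \<zeta>
    by (simp add: N0_def G_def Tr_def \<xi>_pair_vec[OF e] \<xi>_perp_pair_vec)
  have split: "pair_vec e (\<xi> e h) 0 + \<xi>_perp e h = h" for h
    using trans[OF pair_vec_split[symmetric] pair_vec_\<xi>[OF e]] unfolding pair_vec_0 .
  have "(f has_derivative f') (at (\<xi> e ?a))" using f' by (simp add: \<xi>a)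
  from has_derivative_compose[OF bounded_linear_imp_has_derivative[OF bounded_linear_\<xi>] this]
  have "((\<lambda>\<zeta>. f (\<xi> e \<zeta>)) has_derivative (\<lambda>h. f' (\<xi> e h))) (at ?a)" .
  from has_derivative_add[OF bounded_linear.has_derivative[OF bounded_linear_compose[OF bounded_linear_pair_vec bS] this]
      bounded_linear_imp_has_derivative[OF bounded_linear_\<xi>_perp]]
  have "(N0 has_derivative (\<lambda>h. pair_vec e (\<xi> e h) 0 + \<xi>_perp e h)) (at ?a)"
    unfolding N0'[abs_def] by (simp add: S(2))
  then have N0d: "(N0 has_derivative (\<lambda>h. h)) (at ?a)" unfolding split .
  have N0a: "N0 ?a = 0"
  proof -
    have "S (f (\<xi> e ?a)) = 0" by (simp add: \<xi>a f0 linear_0[OF S(1)])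
    then show ?thesis
      unfolding N0' \<xi>_perp_pair_vec by (simp add: pair_vec_def \<xi>_perp_def vec_eq_iff)
  qed
  obtain M where M: "M > 0" "\<And>w. norm (Tr w) \<le> norm w * M"
    using bounded_linear.pos_bounded[OF Tr] by blast
  have cont: "\<exists>\<epsilon>1>0. \<forall>\<epsilon>. 0 < \<bar>\<epsilon>\<bar> \<and> \<bar>\<epsilon>\<bar> < \<epsilon>1 \<longrightarrow> continuous_on (cball ?a r) (N \<epsilon>)"
  proof -
    obtain \<epsilon>1 where \<epsilon>1: "\<epsilon>1 > 0" "\<And>\<epsilon> \<zeta>. 0 < \<bar>\<epsilon>\<bar> \<and> \<bar>\<epsilon>\<bar> < \<epsilon>1 \<Longrightarrow> \<zeta> \<in> cball ?a r \<Longrightarrow> ?Y \<zeta> \<epsilon> \<in> B"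
      using unif[OF zero_less_one] by blast
    have "continuous_on (cball ?a r) (N \<epsilon>)" if "0 < \<bar>\<epsilon>\<bar> \<and> \<bar>\<epsilon>\<bar> < \<epsilon>1" for \<epsilon>
      unfolding N_def
    proof (intro bounded_linear.continuous_on[OF Tr] continuous_on_scaleR continuous_on_const)
      show "continuous_on (cball ?a r) (\<lambda>\<zeta>. \<Psi> (?Y \<zeta> \<epsilon>))"
        by (rule continuous_on_compose2[OF \<Psi>]) (use \<epsilon>1(2)[OF that] in \<open>auto intro!: continuous_intros c b simp del: mem_cball\<close>)
    qed
    then show ?thesis using \<epsilon>1(1) by blast
  qed
  have un: "\<exists>\<epsilon>1>0. \<forall>\<epsilon>. 0 < \<bar>\<epsilon>\<bar> \<and> \<bar>\<epsilon>\<bar> < \<epsilon>1 \<longrightarrow> (\<forall>y\<in>cball ?a r. norm (N \<epsilon> y - N0 y) \<le> \<eta>)" if \<eta>: "\<eta> > 0" for \<eta>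
  proof -
    obtain \<epsilon>1 where \<epsilon>1: "\<epsilon>1 > 0" "\<And>\<epsilon> \<zeta>. 0 < \<bar>\<epsilon>\<bar> \<and> \<bar>\<epsilon>\<bar> < \<epsilon>1 \<Longrightarrow> \<zeta> \<in> cball ?a r \<Longrightarrow>
        norm (\<Psi> (?Y \<zeta> \<epsilon>) - \<epsilon> ^ k *\<^sub>R G \<zeta>) \<le> \<eta> / M * \<bar>\<epsilon>\<bar> ^ k"
      using unif[of "\<eta> / M"] \<eta> M(1) unfolding G_def by auto
    have "norm (N \<epsilon> \<zeta> - N0 \<zeta>) \<le> \<eta>" if \<epsilon>: "0 < \<bar>\<epsilon>\<bar> \<and> \<bar>\<epsilon>\<bar> < \<epsilon>1" and \<zeta>: "\<zeta> \<in> cball ?a r" for \<epsilon> \<zeta>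
    proof -
      have \<epsilon>k: "\<bar>\<epsilon>\<bar> ^ k > 0" "\<epsilon> ^ k \<noteq> 0" using \<epsilon> by auto
      have "N \<epsilon> \<zeta> - N0 \<zeta> = Tr ((1 / \<epsilon> ^ k) *\<^sub>R (\<Psi> (?Y \<zeta> \<epsilon>) - \<epsilon> ^ k *\<^sub>R G \<zeta>))"
        unfolding N_def N0_def linear_diff[OF bounded_linear.linear[OF Tr], symmetric]
        using \<epsilon> by (auto simp: scaleR_diff_right)
      then have "norm (N \<epsilon> \<zeta> - N0 \<zeta>) \<le> norm ((1 / \<epsilon> ^ k) *\<^sub>R (\<Psi> (?Y \<zeta> \<epsilon>) - \<epsilon> ^ k *\<^sub>R G \<zeta>)) * M" using M(2) by metis
      also have "\<dots> = norm (\<Psi> (?Y \<zeta> \<epsilon>) - \<epsilon> ^ k *\<^sub>R G \<zeta>) / \<bar>\<epsilon>\<bar> ^ k * M" by (simp add: power_abs)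
      also have "\<dots> \<le> (\<eta> / M * \<bar>\<epsilon>\<bar> ^ k) / \<bar>\<epsilon>\<bar> ^ k * M"
        using \<epsilon>1(2)[OF \<epsilon> \<zeta>] \<epsilon>k M(1) by (intro mult_right_mono divide_right_mono) auto
      also have "\<dots> = \<eta>" using \<epsilon>k M(1) by simp
      finally show ?thesis .
    qed
    then show ?thesis using \<epsilon>1(1) by blast
  qed
  have "isCont (\<lambda>\<zeta>. c (\<xi> e \<zeta>)) ?a"
    using continuous_on_interior[OF c, of ?a] r by simp
  then obtain \<rho>' where \<rho>': "\<rho>' > 0" "\<And>\<zeta>. dist \<zeta> ?a < \<rho>' \<Longrightarrow> dist (c (\<xi> e \<zeta>)) (c a) < \<rho> / 2"
    unfolding continuous_at_eps_delta \<xi>a using \<rho> half_gt_zero by blast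
  obtain \<epsilon>1 where \<epsilon>1: "\<epsilon>1 > 0" "\<And>\<epsilon>. 0 < \<bar>\<epsilon>\<bar> \<and> \<bar>\<epsilon>\<bar> < \<epsilon>1 \<Longrightarrow> \<exists>\<zeta>\<in>cball ?a r \<inter> cball ?a (\<rho>' / 2). N \<epsilon> \<zeta> = 0"
    using zeros_of_perturbation[OF r N0d N0a cont un half_gt_zero[OF \<rho>'(1)]] by blast
  obtain \<epsilon>2 where \<epsilon>2: "\<epsilon>2 > 0" "\<And>\<epsilon> \<zeta>. 0 < \<bar>\<epsilon>\<bar> \<and> \<bar>\<epsilon>\<bar> < \<epsilon>2 \<Longrightarrow> \<zeta> \<in> cball ?a r \<Longrightarrow> ?Y \<zeta> \<epsilon> \<in> B"
    using unif[OF zero_less_one] by blast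
  \<comment> \<open>Keeps the shift \<open>\<epsilon> *\<^sub>R b \<zeta> \<epsilon>\<close> within
    \<open>\<rho> / 2\<close>; the other half of \<open>\<rho>\<close> is for the movement along the
    manifold.\<close>
  define \<epsilon>3 where "\<epsilon>3 = \<rho> / (2 * (\<bar>C\<bar> + 1))"
  have \<epsilon>3: "\<epsilon>3 > 0" using \<rho> by (simp add: \<epsilon>3_def)
  show ?thesis
  proof (intro exI[of _ "min (min \<epsilon>1 \<epsilon>2) (min \<epsilon>3 1)"] conjI allI impI)
    fix \<epsilon> :: real assume "0 < \<bar>\<epsilon>\<bar> \<and> \<bar>\<epsilon>\<bar> < min (min \<epsilon>1 \<epsilon>2) (min \<epsilon>3 1)"
    then have \<epsilon>: "0 < \<bar>\<epsilon>\<bar> \<and> \<bar>\<epsilon>\<bar> < \<epsilon>1" "0 < \<bar>\<epsilon>\<bar> \<and> \<bar>\<epsilon>\<bar> < \<epsilon>2" "\<bar>\<epsilon>\<bar> < \<epsilon>3" "\<bar>\<epsilon>\<bar> \<le> 1" by auto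
    obtain \<zeta> where \<zeta>: "\<zeta> \<in> cball ?a r" "\<zeta> \<in> cball ?a (\<rho>' / 2)" "N \<epsilon> \<zeta> = 0" using \<epsilon>1(2)[OF \<epsilon>(1)] by blast
    let ?z = "c (\<xi> e \<zeta>) + \<epsilon> *\<^sub>R b \<zeta> \<epsilon>"
    have "(1 / \<epsilon> ^ k) *\<^sub>R \<Psi> (?z, \<epsilon>) = 0" using Tr0 \<zeta>(3) unfolding N_def by blast
    then have 0: "\<Psi> (?z, \<epsilon>) = 0" using \<epsilon>(1) by simp
    have "dist \<zeta> ?a < \<rho>'" using \<zeta>(2) \<rho>'(1) by (simp add: dist_commute)
    then have 1: "norm (c (\<xi> e \<zeta>) - c a) < \<rho> / 2" using \<rho>'(2) by (simp add: dist_norm)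
    have "norm (\<epsilon> *\<^sub>R b \<zeta> \<epsilon>) \<le> \<epsilon>3 * (\<bar>C\<bar> + 1)"
      unfolding norm_scaleR using bC[OF \<zeta>(1) \<epsilon>(4)] \<epsilon>(3) \<epsilon>3 by (intro mult_mono) auto
    also have "\<dots> = \<rho> / 2" by (simp add: \<epsilon>3_def field_simps)
    finally have "norm ((c (\<xi> e \<zeta>) - c a) + \<epsilon> *\<^sub>R b \<zeta> \<epsilon>) \<le> \<rho> / 2 + \<rho> / 2"
      using 1 by (intro norm_triangle_mono) auto
    then have "dist ?z (c a) \<le> \<rho>" by (simp add: dist_norm algebra_simps)
    then show "\<exists>z. ((z, \<epsilon>) \<in> B \<and> \<Psi> (z, \<epsilon>) = 0) \<and> dist z (c a) \<le> \<rho>"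
      using 0 \<epsilon>2(2)[OF \<epsilon>(2) \<zeta>(1)] by blast
  qed (use \<epsilon>1 \<epsilon>2 \<epsilon>3 in auto)
qed

text \<open>The choice in \<open>frechet_derivative\<close> sees the same set of derivatives on both
  sides. It transfers the Jacobians of \<open>f1\<close> and \<open>f2\<close> to expressions in the
  displacement that agree with them only near the point.\<close>

lemma frechet_derivative_cong_open:
  assumes "open W" "x \<in> W" "\<And>y. y \<in> W \<Longrightarrow> f y = g y"
  shows "frechet_derivative f (at x) = frechet_derivative g (at x)"
proof -
  have "(f has_derivative f') (at x) \<longleftrightarrow> (g has_derivative f') (at x)" for f'
    using has_derivative_transform_within_open[of f f' x UNIV W g] has_derivative_transform_within_open[of g f' x UNIV W f]
      assms by auto
  then show ?thesis by (simp add: frechet_derivative_def)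
qed

lemma jacobian_injective:
  fixes f :: "real ^ 'n \<Rightarrow> real ^ 'n"
  assumes "det (jacobian f (at a)) \<noteq> 0" "jacobian f (at a) *v u = 0"
  shows "u = 0"
proof -
  obtain B where "B ** jacobian f (at a) = mat 1"
    using assms(1) unfolding invertible_det_nz[symmetric] invertible_def by blast
  then have "B *v (jacobian f (at a) *v u) = u" by (simp add: matrix_vector_mul_assoc)
  then show ?thesis using assms(2) by simp
qed

lemma differentiable_linear_compose:
  assumes "bounded_linear T" "g differentiable (at x)"
  shows "(\<lambda>x. T (g x)) differentiable (at x)"
proof -
  obtain D where "(g has_derivative D) (at x)" using assms(2) unfolding differentiable_def by (elim exE)
  from differentiableI[OF bounded_linear.has_derivative[OF assms(1) this]] show ?thesis .
qed

lemma differentiable_Pair_const: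
  assumes "g differentiable (at x)"
  shows "(\<lambda>x. (g x, c)) differentiable (at x)"
proof -
  obtain D where "(g has_derivative D) (at x)" using assms unfolding differentiable_def by (elim exE)
  from differentiableI[OF has_derivative_Pair[OF this has_derivative_const]] show ?thesis .
qed

lemma differentiable_imp_continuous_on_set:
  assumes "\<And>x. x \<in> S \<Longrightarrow> g differentiable (at x)"
  shows "continuous_on S g"
  by (intro continuous_at_imp_continuous_on ballI differentiable_imp_continuous_within assms)

text \<open>\<open>c1\<close> is the parameter derivative of the displacement on the manifold and
  \<open>A\<close> its derivative in the position. By the block form of \<open>A\<close>,
  transversal shifts are invisible to \<open>\<xi> e\<close> at first order. The reduced equations
  are therefore \<open>\<xi> e (c1 \<nu>) = 0\<close> and, if this holds identically,
  \<open>\<xi> e (q \<nu>) = 0\<close>.\<close>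

lemma bifurcation_from_manifold:
  fixes e :: "'q::finite \<Rightarrow> 'p::finite" and \<sigma> :: "real ^ 'q \<Rightarrow> real ^ 'p"
    and \<Psi> :: "(real ^ 'p) \<times> real \<Rightarrow> real ^ 'p" and A :: "real ^ 'p \<Rightarrow> real ^ 'p ^ 'p"
  defines "zz \<equiv> \<lambda>\<nu>. pair_vec e \<nu> (\<sigma> \<nu>)"
  defines "c1 \<equiv> \<lambda>\<nu>. frechet_derivative \<Psi> (at (zz \<nu>, 0)) (0, 1)"
  defines "gam \<equiv> \<lambda>\<nu>. - (matrix_inv (lower_corner e (A (zz \<nu>))) *v \<xi>_perp e (c1 \<nu>))"
  defines "q \<equiv> \<lambda>\<nu>. second_derivative \<Psi> (zz \<nu>, 0) (gam \<nu>, 1) (gam \<nu>, 1)"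
  assumes e: "inj e" and V: "open V" and \<sigma>: "\<And>\<nu>. \<nu> \<in> V \<Longrightarrow> \<sigma> differentiable (at \<nu>)"
    and B: "open B" and \<Psi>: "Ck_on 3 B \<Psi>"
    and zero: "\<And>\<nu>. \<nu> \<in> V \<Longrightarrow> (zz \<nu>, 0) \<in> B \<Longrightarrow> \<Psi> (zz \<nu>, 0) = 0"
    and A: "\<And>z h. (z, 0) \<in> B \<Longrightarrow> frechet_derivative \<Psi> (at (z, 0)) (h, 0) = A z *v h"
    and ur: "\<And>\<nu> i j. \<nu> \<in> V \<Longrightarrow> i \<in> range e \<Longrightarrow> j \<notin> range e \<Longrightarrow> A (zz \<nu>) $ i $ j = 0"
    and lr: "\<And>\<nu>. \<nu> \<in> V \<Longrightarrow> det (lower_corner e (A (zz \<nu>))) \<noteq> 0"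
    and a: "a \<in> V" "(zz a, 0) \<in> B" and \<rho>: "\<rho> > 0"
  shows "\<xi> e (c1 a) = 0 \<Longrightarrow> det (jacobian (\<lambda>\<nu>. \<xi> e (c1 \<nu>)) (at a)) \<noteq> 0 \<Longrightarrow>
      \<exists>\<epsilon>1>0. \<forall>\<epsilon>. 0 < \<bar>\<epsilon>\<bar> \<and> \<bar>\<epsilon>\<bar> < \<epsilon>1 \<longrightarrow> (\<exists>z. ((z, \<epsilon>) \<in> B \<and> \<Psi> (z, \<epsilon>) = 0) \<and> dist z (zz a) \<le> \<rho>)"
    and "(\<And>\<nu>. \<nu> \<in> V \<Longrightarrow> (zz \<nu>, 0) \<in> B \<Longrightarrow> \<xi> e (c1 \<nu>) = 0) \<Longrightarrow> \<xi> e (q a) = 0 \<Longrightarrow>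
      det (jacobian (\<lambda>\<nu>. \<xi> e (q \<nu>)) (at a)) \<noteq> 0 \<Longrightarrow>
      \<exists>\<epsilon>1>0. \<forall>\<epsilon>. 0 < \<bar>\<epsilon>\<bar> \<and> \<bar>\<epsilon>\<bar> < \<epsilon>1 \<longrightarrow> (\<exists>z. ((z, \<epsilon>) \<in> B \<and> \<Psi> (z, \<epsilon>) = 0) \<and> dist z (zz a) \<le> \<rho>)"
proof -
  define p where "p \<nu> = (zz \<nu>, 0 :: real)" for \<nu>
  \<comment> \<open>\<open>\<Psi>\<close> is controlled only on \<open>B\<close>, so \<nu> is
    restricted to the parameters whose points on the manifold lie there.\<close>
  define W where "W = V \<inter> p -` B"
  define L where "L \<nu> = lower_corner e (A (zz \<nu>))" for \<nu>
  define Li where "Li \<nu> = matrix_inv (L \<nu>)" for \<nu>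
  have \<Psi>3: "Ck_on (Suc (Suc (Suc 0))) B \<Psi>" using \<Psi> by (simp add: numeral_3_eq_3)
  have \<Psi>1: "Ck_on 1 B \<Psi>" and \<Psi>2: "Ck_on 2 B \<Psi>" by (rule Ck_on_mono[OF \<Psi>], simp)+
  have mv: "bounded_bilinear ((*v) :: real ^ 'p ^ 'p \<Rightarrow> real ^ 'p \<Rightarrow> real ^ 'p)"
    by (rule bounded_bilinear_matrix_vector_mult)
  have bl: "(\<lambda>\<nu>. T (g \<nu>)) differentiable (at \<nu>)" if "bounded_linear T" "g differentiable (at \<nu>)"
    for T :: "'x::real_normed_vector \<Rightarrow> 'y::real_normed_vector" and g :: "real ^ 'q \<Rightarrow> 'x" and \<nu>
    using that by (rule differentiable_linear_compose)
  have zzd: "zz differentiable (at \<nu>)" if "\<nu> \<in> V" for \<nu>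
  proof -
    have "zz \<nu> = pair_vec e \<nu> 0 + \<xi>_perp e (\<sigma> \<nu>)" for \<nu>
      unfolding zz_def using pair_vec_split[of e \<nu> "\<sigma> \<nu>"] unfolding pair_vec_0 .
    then have zz: "zz = (\<lambda>\<nu>. pair_vec e \<nu> 0 + \<xi>_perp e (\<sigma> \<nu>))" by (rule ext)
    show ?thesis
      unfolding zz by (intro differentiable_add bl[OF bounded_linear_pair_vec differentiable_ident]
          bl[OF bounded_linear_\<xi>_perp \<sigma>[OF that]])
  qed
  have pd: "p differentiable (at \<nu>)" if "\<nu> \<in> V" for \<nu>
    unfolding p_def[abs_def] by (rule differentiable_Pair_const[OF zzd[OF that]])
  have pc: "continuous_on V p"
    by (rule differentiable_imp_continuous_on_set[OF pd])
  have W: "open W" unfolding W_def using continuous_open_preimage[OF pc V B] .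
  have WV: "\<nu> \<in> V" "p \<nu> \<in> B" "(zz \<nu>, 0) \<in> B" if "\<nu> \<in> W" for \<nu>
    using that by (auto simp: W_def p_def)
  have aW: "a \<in> W" using a by (simp add: W_def p_def)
  have comp: "(\<lambda>\<nu>. g (p \<nu>)) differentiable (at \<nu>)" if g: "Ck_on (Suc k) B g" and "\<nu> \<in> W"
    for g :: "_ \<Rightarrow> real ^ 'p" and \<nu> k
  proof -
    have "g differentiable (at (p \<nu>))" using g WV(2)[OF that(2)] by simp
    from differentiable_chain_at[OF pd[OF WV(1)[OF that(2)]] this] show ?thesis by (simp add: comp_def)
  qed
  have c1d: "c1 differentiable (at \<nu>)" if "\<nu> \<in> W" for \<nu>
    using comp[OF Ck_on_derivative[OF \<Psi>3] that] unfolding c1_def p_def .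
  \<comment> \<open>The entries of \<open>A (zz \<nu>)\<close> are coordinates of first derivatives
    of \<open>\<Psi>\<close>; this is how they inherit its smoothness, and hence how
    \<open>gam\<close> becomes differentiable.\<close>
  have Ld: "(\<lambda>\<nu>. L \<nu> $ i $ j) differentiable (at \<nu>)" if \<nu>: "\<nu> \<in> W" for i j \<nu>
  proof (cases "i \<notin> range e \<and> j \<notin> range e")
    case True
    have "(\<lambda>\<nu>. frechet_derivative \<Psi> (at (p \<nu>)) (axis j 1, 0) $ i) differentiable (at \<nu>)"
      by (rule bl[OF bounded_linear_vec_nth comp[OF Ck_on_derivative[OF \<Psi>3] \<nu>]])
    then show ?thesis
    proof (rule differentiable_transform_open[OF _ W \<nu>])
      show "frechet_derivative \<Psi> (at (p y)) (axis j 1, 0) $ i = L y $ i $ j" if "y \<in> W" for y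
        using A[OF WV(3)[OF that], of "axis j 1"] True
        by (simp add: p_def L_def lower_corner_def matrix_vector_mult_basis column_def)
    qed
  next
    case False
    then have "(\<lambda>\<nu>. L \<nu> $ i $ j) = (\<lambda>\<nu>. if i = j then 1 else 0)"
      by (auto simp: L_def lower_corner_def fun_eq_iff)
    then show ?thesis by simp
  qed
  have Lid: "Li differentiable (at \<nu>)" if \<nu>: "\<nu> \<in> W" for \<nu>
    unfolding Li_def[abs_def]
    by (rule differentiable_matrix_inv[OF Ld[OF \<nu>] W \<nu>]) (use lr WV in \<open>auto simp: L_def\<close>)
  have gam_eq: "gam = (\<lambda>\<nu>. - (Li \<nu> *v \<xi>_perp e (c1 \<nu>)))"
    by (simp add: gam_def Li_def L_def fun_eq_iff)
  have gamd: "gam differentiable (at \<nu>)" if \<nu>: "\<nu> \<in> W" for \<nu>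
    unfolding gam_eq
    by (intro differentiable_minus bounded_bilinear_differentiable[OF mv Lid[OF \<nu>]] bl[OF bounded_linear_\<xi>_perp c1d[OF \<nu>]])
  have gam1: "(\<lambda>\<nu>. (gam \<nu>, 1 :: real)) differentiable (at \<nu>)" if "\<nu> \<in> W" for \<nu>
    by (rule differentiable_Pair_const[OF gamd[OF that]])
  have qd: "q differentiable (at \<nu>)" if \<nu>: "\<nu> \<in> W" for \<nu>
    unfolding q_def using WV(2) gam1[OF \<nu>] pd[OF WV(1)[OF \<nu>]]
      differentiable_second_derivative[OF B \<Psi> W _ \<nu>, of p "\<lambda>\<nu>. (gam \<nu>, 1)" "\<lambda>\<nu>. (gam \<nu>, 1)"]
    by (auto simp: p_def)
  have linD: "linear (frechet_derivative \<Psi> (at (p \<nu>)))" if "\<nu> \<in> W" for \<nu>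
    using \<Psi>1 WV(2)[OF that] by (intro linear_frechet_derivative) simp
  have D\<Psi>: "frechet_derivative \<Psi> (at (p \<nu>)) (h, t) = A (zz \<nu>) *v h + t *\<^sub>R c1 \<nu>" if "\<nu> \<in> W" for \<nu> h t
  proof -
    have "(h, t) = (h, 0) + t *\<^sub>R (0, 1)" by simp
    then have "frechet_derivative \<Psi> (at (p \<nu>)) (h, t) =
        frechet_derivative \<Psi> (at (p \<nu>)) (h, 0) + t *\<^sub>R frechet_derivative \<Psi> (at (p \<nu>)) (0, 1)"
      by (simp only: linear_add[OF linD[OF that]] linear_scale[OF linD[OF that]])
    then show ?thesis using A[OF WV(3)[OF that], of h] by (simp add: p_def c1_def)
  qed
  have Li: "\<xi>_perp e (Li \<nu> *v \<xi>_perp e w) = Li \<nu> *v \<xi>_perp e w" "L \<nu> *v (Li \<nu> *v w) = w" if "\<nu> \<in> W" for \<nu> w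
    using lower_corner_inverse[OF lr[OF WV(1)[OF that]]] unfolding Li_def L_def by blast+
  have AP: "\<xi> e (A (zz \<nu>) *v v) = 0" "\<xi>_perp e (A (zz \<nu>) *v v) = L \<nu> *v v" if "\<nu> \<in> W" "\<xi>_perp e v = v" for \<nu> v
    using block_mult[of e "A (zz \<nu>)" v, OF ur[OF WV(1)[OF that(1)]] that(2)] unfolding L_def by blast+
  have lp: "linear (\<xi>_perp e)" and lx: "linear (\<xi> e)"
    by (rule bounded_linear.linear[OF bounded_linear_\<xi>_perp], rule bounded_linear.linear[OF bounded_linear_\<xi>])
  have gamP: "\<xi>_perp e (gam \<nu>) = gam \<nu>" if "\<nu> \<in> W" for \<nu>
    using Li(1)[OF that, of "c1 \<nu>"] by (simp add: gam_eq linear_neg[OF lp])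
  have Lgam: "L \<nu> *v gam \<nu> = - \<xi>_perp e (c1 \<nu>)" if "\<nu> \<in> W" for \<nu>
    using Li(2)[OF that] by (simp add: gam_eq bounded_bilinear.minus_right[OF mv])
  let ?a = "pair_vec e a 0"
  have "open (\<xi> e -` W)" by (rule open_vimage[OF W linear_continuous_on[OF bounded_linear_\<xi>]])
  moreover have "?a \<in> \<xi> e -` W" using aW \<xi>_pair_vec[OF e] by simp
  ultimately obtain r where r: "r > 0" "cball ?a r \<subseteq> \<xi> e -` W"
    using open_contains_cball by blast
  let ?C = "cball ?a r"
  have rW: "\<xi> e \<zeta> \<in> W" if "\<zeta> \<in> ?C" for \<zeta> using r(2) that by blast
  have cg: "continuous_on ?C (\<lambda>\<zeta>. g (\<xi> e \<zeta>))" if "\<And>\<nu>. \<nu> \<in> W \<Longrightarrow> g differentiable (at \<nu>)"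
    for g :: "real ^ 'q \<Rightarrow> 'x::real_normed_vector"
  proof (rule continuous_on_compose2[of W g])
    show "continuous_on W g"
      by (rule differentiable_imp_continuous_on_set[OF that])
    show "continuous_on ?C (\<xi> e)" by (rule linear_continuous_on[OF bounded_linear_\<xi>])
  qed (use rW in blast)
  have c\<xi>p: "continuous_on S (\<xi>_perp e)" for S by (rule linear_continuous_on[OF bounded_linear_\<xi>_perp])
  note cz = cg[OF zzd[OF WV(1)]] and cp = cg[OF pd[OF WV(1)]]
  let ?K = "(\<lambda>\<zeta>. p (\<xi> e \<zeta>)) ` ?C"
  have K: "compact ?K" "?K \<subseteq> B"
    using compact_continuous_image[OF cp compact_cball] rW WV(2) by auto
  have \<Psi>c: "continuous_on B \<Psi>" by (rule Ck_on_continuous[OF \<Psi>])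
  have p0: "\<Psi> (p \<nu>) = 0" if "\<nu> \<in> W" for \<nu> using zero[OF WV(1,3)[OF that]] by (simp add: p_def)
  show "\<exists>\<epsilon>1>0. \<forall>\<epsilon>. 0 < \<bar>\<epsilon>\<bar> \<and> \<bar>\<epsilon>\<bar> < \<epsilon>1 \<longrightarrow> (\<exists>z. ((z, \<epsilon>) \<in> B \<and> \<Psi> (z, \<epsilon>) = 0) \<and> dist z (zz a) \<le> \<rho>)"
    if f0: "\<xi> e (c1 a) = 0" and det: "det (jacobian (\<lambda>\<nu>. \<xi> e (c1 \<nu>)) (at a)) \<noteq> 0"
  proof -
    \<comment> \<open>By the block form, \<open>gam\<close> cancels the transversal part of
      \<open>c1\<close> and the second summand creates the transversal part of
      \<open>\<zeta>\<close>. The derivative of \<open>\<Psi>\<close> in the direction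
      \<open>(b \<zeta>, 1)\<close> is thus exactly the desired limit, as \<open>lim\<close>
      states.\<close>
    define b where "b \<zeta> = gam (\<xi> e \<zeta>) + Li (\<xi> e \<zeta>) *v \<xi>_perp e \<zeta>" for \<zeta>
    have bc: "continuous_on ?C b"
      unfolding b_def by (intro continuous_on_add cg[OF gamd] bounded_bilinear.continuous_on[OF mv] cg[OF Lid] c\<xi>p)
    have "compact ((\<lambda>\<zeta>. (b \<zeta>, 1 :: real)) ` ?C)"
      by (intro compact_continuous_image compact_cball continuous_intros bc)
    from compact_imp_bounded[OF this] obtain C where C: "C > 0" "\<forall>x\<in>(\<lambda>\<zeta>. (b \<zeta>, 1 :: real)) ` ?C. norm x \<le> C"
      unfolding bounded_pos by (elim exE conjE)
    have Cb: "norm (b \<zeta>, 1 :: real) \<le> C" if "\<zeta> \<in> ?C" for \<zeta>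
      using bspec[OF C(2) imageI[OF that]] .
    have bP: "\<xi>_perp e (b \<zeta>) = b \<zeta>" if "\<zeta> \<in> ?C" for \<zeta>
      using gamP[OF rW[OF that]] Li(1)[OF rW[OF that]] by (simp add: b_def linear_add[OF lp])
    have lim: "frechet_derivative \<Psi> (at (p (\<xi> e \<zeta>))) (b \<zeta>, 1) = pair_vec e (\<xi> e (c1 (\<xi> e \<zeta>))) \<zeta>" if \<zeta>: "\<zeta> \<in> ?C" for \<zeta>
    proof (rule eq_if_parts_eq[OF e])
      let ?\<nu> = "\<xi> e \<zeta>"
      note w = rW[OF \<zeta>]
      have D: "frechet_derivative \<Psi> (at (p ?\<nu>)) (b \<zeta>, 1) = A (zz ?\<nu>) *v b \<zeta> + c1 ?\<nu>" using D\<Psi>[OF w] by simp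
      show "\<xi> e (frechet_derivative \<Psi> (at (p ?\<nu>)) (b \<zeta>, 1)) = \<xi> e (pair_vec e (\<xi> e (c1 ?\<nu>)) \<zeta>)"
        by (simp add: D linear_add[OF lx] AP(1)[OF w bP[OF \<zeta>]] \<xi>_pair_vec[OF e])
      have "L ?\<nu> *v b \<zeta> = - \<xi>_perp e (c1 ?\<nu>) + \<xi>_perp e \<zeta>"
        by (simp add: b_def matrix_vector_right_distrib Lgam[OF w] Li(2)[OF w])
      then show "\<xi>_perp e (frechet_derivative \<Psi> (at (p ?\<nu>)) (b \<zeta>, 1)) = \<xi>_perp e (pair_vec e (\<xi> e (c1 ?\<nu>)) \<zeta>)"
        by (simp add: D linear_add[OF lp] AP(2)[OF w bP[OF \<zeta>]] \<xi>_perp_pair_vec)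
    qed
    have "((\<lambda>\<nu>. \<xi> e (c1 \<nu>)) has_derivative (\<lambda>h. jacobian (\<lambda>\<nu>. \<xi> e (c1 \<nu>)) (at a) *v h)) (at a)"
      using bl[OF bounded_linear_\<xi> c1d[OF aW]] unfolding jacobian_works .
    note bif = bifurcation_zeros[where f="\<lambda>\<nu>. \<xi> e (c1 \<nu>)" and c=zz and b="\<lambda>\<zeta> _. b \<zeta>" and k=1 and C=C,
        OF e \<Psi>c r(1) f0 this jacobian_injective[OF det] cz bc _ _ \<rho>]
    show ?thesis
    proof (rule bif)
      show "norm (b \<zeta>) \<le> C" if "\<zeta> \<in> ?C" for \<zeta>
        using Cb[OF that] norm_fst_le[of "b \<zeta>" "1 :: real"] by simp
      fix \<eta> :: real assume \<eta>: "\<eta> > 0"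
      \<comment> \<open>The Taylor error is relative to \<open>norm ?y\<close>, which is at most
        \<open>\<bar>\<epsilon>\<bar> * C\<close>.\<close>
      have "\<eta> / C > 0" using \<eta> C(1) by simp
      obtain d where d0: "d > 0" and T: "\<forall>x\<in>?K. \<forall>y. norm y < d \<longrightarrow> x + y \<in> B \<and>
          norm (\<Psi> (x + y) - \<Psi> x - frechet_derivative \<Psi> (at x) y) \<le> \<eta> / C * norm y"
        using Taylor_first_order_uniform[OF B K \<Psi>1 \<open>\<eta> / C > 0\<close>] by (elim exE conjE)
      note d = d0 T[THEN bspec, THEN spec, THEN mp, THEN conjunct1] T[THEN bspec, THEN spec, THEN mp, THEN conjunct2]
      show "\<exists>\<epsilon>1>0. \<forall>\<epsilon>. 0 < \<bar>\<epsilon>\<bar> \<and> \<bar>\<epsilon>\<bar> < \<epsilon>1 \<longrightarrow> (\<forall>\<zeta>\<in>?C. (zz (\<xi> e \<zeta>) + \<epsilon> *\<^sub>R b \<zeta>, \<epsilon>) \<in> B \<and>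
        norm (\<Psi> (zz (\<xi> e \<zeta>) + \<epsilon> *\<^sub>R b \<zeta>, \<epsilon>) - \<epsilon> ^ 1 *\<^sub>R pair_vec e (\<xi> e (c1 (\<xi> e \<zeta>))) \<zeta>) \<le> \<eta> * \<bar>\<epsilon>\<bar> ^ 1)"
      proof (intro exI[of _ "d / C"] conjI allI impI ballI)
        show "d / C > 0" using d C by simp
        fix \<epsilon> :: real and \<zeta> assume \<epsilon>: "0 < \<bar>\<epsilon>\<bar> \<and> \<bar>\<epsilon>\<bar> < d / C" and \<zeta>: "\<zeta> \<in> ?C"
        let ?x = "p (\<xi> e \<zeta>)" and ?y = "\<epsilon> *\<^sub>R (b \<zeta>, 1 :: real)"
        have xK: "?x \<in> ?K" using \<zeta> by blast
        have xy: "?x + ?y = (zz (\<xi> e \<zeta>) + \<epsilon> *\<^sub>R b \<zeta>, \<epsilon>)" by (simp add: p_def)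
        have y: "norm ?y \<le> \<bar>\<epsilon>\<bar> * C" unfolding norm_scaleR using Cb[OF \<zeta>] by (intro mult_left_mono) auto
        also have "\<dots> < d" using \<epsilon> C(1) by (simp add: field_simps)
        finally have yd: "norm ?y < d" .
        show "(zz (\<xi> e \<zeta>) + \<epsilon> *\<^sub>R b \<zeta>, \<epsilon>) \<in> B" using d(2)[OF xK yd] unfolding xy .
        have "norm (\<Psi> (?x + ?y) - \<Psi> ?x - frechet_derivative \<Psi> (at ?x) ?y) \<le> \<eta> / C * (\<bar>\<epsilon>\<bar> * C)"
          using d(3)[OF xK yd] y \<open>\<eta> / C > 0\<close> by (elim order_trans) (intro mult_left_mono, auto)
        moreover have "frechet_derivative \<Psi> (at ?x) ?y = \<epsilon> *\<^sub>R pair_vec e (\<xi> e (c1 (\<xi> e \<zeta>))) \<zeta>"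
          unfolding lim[OF \<zeta>, symmetric] by (rule linear_scale[OF linD[OF rW[OF \<zeta>]]])
        ultimately show "norm (\<Psi> (zz (\<xi> e \<zeta>) + \<epsilon> *\<^sub>R b \<zeta>, \<epsilon>) - \<epsilon> ^ 1 *\<^sub>R pair_vec e (\<xi> e (c1 (\<xi> e \<zeta>))) \<zeta>) \<le> \<eta> * \<bar>\<epsilon>\<bar> ^ 1"
          unfolding xy p0[OF rW[OF \<zeta>]] using C(1) by simp
      qed
    qed
  qed
  show "\<exists>\<epsilon>1>0. \<forall>\<epsilon>. 0 < \<bar>\<epsilon>\<bar> \<and> \<bar>\<epsilon>\<bar> < \<epsilon>1 \<longrightarrow> (\<exists>z. ((z, \<epsilon>) \<in> B \<and> \<Psi> (z, \<epsilon>) = 0) \<and> dist z (zz a) \<le> \<rho>)"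
    if f10: "\<And>\<nu>. \<nu> \<in> V \<Longrightarrow> (zz \<nu>, 0) \<in> B \<Longrightarrow> \<xi> e (c1 \<nu>) = 0"
      and f0: "\<xi> e (q a) = 0" and det: "det (jacobian (\<lambda>\<nu>. \<xi> e (q \<nu>)) (at a)) \<noteq> 0"
  proof -
    \<comment> \<open>The Taylor coefficient carries the factor 1/2, so the limit is half of the
      second bifurcation function; zeros and their simplicity are the same.\<close>
    define k2 where "k2 \<nu> = (1/2) *\<^sub>R q \<nu>" for \<nu>
    \<comment> \<open>The correction beyond \<open>gam\<close> is one order smaller:
      \<open>\<Omega>\<close> cancels the transversal part of \<open>k2\<close> and creates that of
      \<open>\<zeta>\<close>, both at order \<open>\<epsilon>\<^sup>2\<close>.\<close>
    define \<Omega> where "\<Omega> \<zeta> = Li (\<xi> e \<zeta>) *v \<xi>_perp e (\<zeta> - k2 (\<xi> e \<zeta>))" for \<zeta>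
    define b where "b \<zeta> \<epsilon> = gam (\<xi> e \<zeta>) + \<epsilon> *\<^sub>R \<Omega> \<zeta>" for \<zeta> \<epsilon>
    have k2d: "k2 differentiable (at \<nu>)" if "\<nu> \<in> W" for \<nu>
      unfolding k2_def by (rule bl[OF bounded_linear_scaleR_right qd[OF that]])
    have \<Omega>c: "continuous_on ?C \<Omega>"
      unfolding \<Omega>_def
      by (intro bounded_bilinear.continuous_on[OF mv] cg[OF Lid] continuous_on_compose2[OF c\<xi>p[of UNIV]]
          continuous_on_diff continuous_on_id cg[OF k2d]) auto
    have bc: "continuous_on ?C (\<lambda>\<zeta>. b \<zeta> \<epsilon>)" for \<epsilon>
      unfolding b_def by (intro continuous_on_add cg[OF gamd] continuous_on_scaleR continuous_on_const \<Omega>c)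
    let ?I = "?C \<times> {-1..1::real}"
    have cI: "compact ?I" by (intro compact_Times compact_cball compact_Icc)
    have fstI: "continuous_on ?I (\<lambda>s. g (fst s))" if "continuous_on ?C g" for g :: "real ^ 'p \<Rightarrow> 'x::real_normed_vector"
      by (rule continuous_on_compose2[OF that]) (auto intro: continuous_intros)
    have bI: "continuous_on ?I (\<lambda>s. (b (fst s) (snd s), 1 :: real))"
      unfolding b_def by (intro continuous_intros fstI[OF cg[OF gamd]] fstI[OF \<Omega>c])
    have "compact ((\<lambda>s. (b (fst s) (snd s), 1 :: real)) ` ?I)" by (rule compact_continuous_image[OF bI cI])
    from compact_imp_bounded[OF this] obtain C where C: "C > 0"
      "\<forall>x\<in>(\<lambda>s. (b (fst s) (snd s), 1 :: real)) ` ?I. norm x \<le> C"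
      unfolding bounded_pos by (elim exE conjE)
    have Cb: "norm (b \<zeta> \<epsilon>, 1 :: real) \<le> C" if "\<zeta> \<in> ?C" "\<bar>\<epsilon>\<bar> \<le> 1" for \<zeta> \<epsilon>
    proof -
      have "(\<zeta>, \<epsilon>) \<in> ?I" using that by (simp add: abs_le_iff)
      from bspec[OF C(2) imageI[OF this]] show ?thesis by simp
    qed
    \<comment> \<open>The direction \<open>b \<zeta> \<epsilon>\<close> depends on \<epsilon> and
      becomes \<open>gam\<close> at 0. Uniform continuity of \<open>\<Theta>\<close> on the compact
      set \<open>?I\<close> makes the resulting change small, uniformly in \<zeta>.\<close>
    define \<Theta> where "\<Theta> s = second_derivative \<Psi> (p (\<xi> e (fst s))) (b (fst s) (snd s), 1) (b (fst s) (snd s), 1)" for s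
    have \<Theta>c: "continuous_on ?I \<Theta>"
      unfolding \<Theta>_def by (rule continuous_on_second_derivative[OF B \<Psi>2 fstI[OF cp] _ bI bI]) (use rW WV(2) in auto)
    have \<Theta>0: "\<Theta> (\<zeta>, 0) = q (\<xi> e \<zeta>)" for \<zeta> by (simp add: \<Theta>_def b_def q_def p_def)
    have \<Omega>P: "\<xi>_perp e (\<Omega> \<zeta>) = \<Omega> \<zeta>" if "\<zeta> \<in> ?C" for \<zeta>
      using Li(1)[OF rW[OF that]] by (simp add: \<Omega>_def)
    \<comment> \<open>The identically vanishing first bifurcation function removes the first
      coordinates, and \<open>gam\<close> removes the transversal ones; so the whole order
      \<epsilon> drops out.\<close>
    have first: "A (zz \<nu>) *v gam \<nu> + c1 \<nu> = 0" if w: "\<nu> \<in> W" for \<nu>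
    proof (rule eq_if_parts_eq[OF e])
      show "\<xi> e (A (zz \<nu>) *v gam \<nu> + c1 \<nu>) = \<xi> e 0"
        by (simp add: linear_add[OF lx] linear_0[OF lx] AP(1)[OF w gamP[OF w]] f10[OF WV(1,3)[OF w]])
      show "\<xi>_perp e (A (zz \<nu>) *v gam \<nu> + c1 \<nu>) = \<xi>_perp e 0"
        by (simp add: linear_add[OF lp] linear_0[OF lp] AP(2)[OF w gamP[OF w]] Lgam[OF w])
    qed
    have lim: "A (zz (\<xi> e \<zeta>)) *v \<Omega> \<zeta> + k2 (\<xi> e \<zeta>) = pair_vec e (\<xi> e (k2 (\<xi> e \<zeta>))) \<zeta>" if \<zeta>: "\<zeta> \<in> ?C" for \<zeta>
    proof (rule eq_if_parts_eq[OF e])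
      note w = rW[OF \<zeta>]
      show "\<xi> e (A (zz (\<xi> e \<zeta>)) *v \<Omega> \<zeta> + k2 (\<xi> e \<zeta>)) = \<xi> e (pair_vec e (\<xi> e (k2 (\<xi> e \<zeta>))) \<zeta>)"
        by (simp add: linear_add[OF lx] AP(1)[OF w \<Omega>P[OF \<zeta>]] \<xi>_pair_vec[OF e])
      show "\<xi>_perp e (A (zz (\<xi> e \<zeta>)) *v \<Omega> \<zeta> + k2 (\<xi> e \<zeta>)) = \<xi>_perp e (pair_vec e (\<xi> e (k2 (\<xi> e \<zeta>))) \<zeta>)"
        using Li(2)[OF w, of "\<xi>_perp e (\<zeta> - k2 (\<xi> e \<zeta>))", folded \<Omega>_def]
        by (simp add: linear_add[OF lp] AP(2)[OF w \<Omega>P[OF \<zeta>]] \<xi>_perp_pair_vec linear_diff[OF lp])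
    qed
    have qder: "((\<lambda>\<nu>. \<xi> e (q \<nu>)) has_derivative (\<lambda>h. jacobian (\<lambda>\<nu>. \<xi> e (q \<nu>)) (at a) *v h)) (at a)"
      using bl[OF bounded_linear_\<xi> qd[OF aW]] unfolding jacobian_works .
    have k2\<xi>: "\<xi> e (k2 \<nu>) = (1/2) *\<^sub>R \<xi> e (q \<nu>)" for \<nu> by (simp add: k2_def linear_scale[OF lx])
    have kder: "((\<lambda>\<nu>. \<xi> e (k2 \<nu>)) has_derivative (\<lambda>h. (1/2) *\<^sub>R (jacobian (\<lambda>\<nu>. \<xi> e (q \<nu>)) (at a) *v h))) (at a)"
      unfolding k2\<xi> by (rule has_derivative_scaleR_right[OF qder])
    have k0: "\<xi> e (k2 a) = 0" using f0 by (simp add: k2\<xi>)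
    have kinj: "u = 0" if "(1/2) *\<^sub>R (jacobian (\<lambda>\<nu>. \<xi> e (q \<nu>)) (at a) *v u) = 0" for u
    proof -
      have "jacobian (\<lambda>\<nu>. \<xi> e (q \<nu>)) (at a) *v u = 0" using that unfolding scaleR_eq_0_iff by simp
      then show ?thesis by (rule jacobian_injective[OF det])
    qed
    note bif = bifurcation_zeros[where f="\<lambda>\<nu>. \<xi> e (k2 \<nu>)" and c=zz and b=b and k=2 and C=C,
        OF e \<Psi>c r(1) k0 kder kinj cz bc _ _ \<rho>]
    show ?thesis
    proof (rule bif)
      show "norm (b \<zeta> \<epsilon>) \<le> C" if "\<zeta> \<in> ?C" "\<bar>\<epsilon>\<bar> \<le> 1" for \<zeta> \<epsilon>
        using Cb[OF that] norm_fst_le[of "b \<zeta> \<epsilon>" "1 :: real"] by simp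
      fix \<eta> :: real assume \<eta>: "\<eta> > 0"
      \<comment> \<open>One half of the allowed error is for the Taylor remainder, where
        \<open>norm ?y\<close> is at most \<open>\<bar>\<epsilon>\<bar> * C\<close>, and the other
        for the change of \<open>\<Theta>\<close>.\<close>
      define \<eta>' where "\<eta>' = \<eta> / (2 * C\<^sup>2)"
      have \<eta>': "\<eta>' > 0" using \<eta> C(1) by (simp add: \<eta>'_def)
      obtain d where d0: "d > 0" and T: "\<forall>x\<in>?K. \<forall>y. norm y < d \<longrightarrow> x + y \<in> B \<and>
          norm (\<Psi> (x + y) - \<Psi> x - frechet_derivative \<Psi> (at x) y - (1/2) *\<^sub>R second_derivative \<Psi> x y y) \<le> \<eta>' * (norm y)\<^sup>2"
        using Taylor_second_order_uniform[OF B K \<Psi>2 \<eta>'] by (elim exE conjE)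
      note d = d0 T[THEN bspec, THEN spec, THEN mp, THEN conjunct1] T[THEN bspec, THEN spec, THEN mp, THEN conjunct2]
      obtain d' where d': "d' > 0" "\<forall>s\<in>?I. \<forall>s'\<in>?I. dist s' s < d' \<longrightarrow> dist (\<Theta> s') (\<Theta> s) < \<eta>"
        using compact_uniformly_continuous[OF \<Theta>c cI, unfolded uniformly_continuous_on_def, THEN spec, THEN mp, OF \<eta>]
        by (elim exE conjE)
      show "\<exists>\<epsilon>1>0. \<forall>\<epsilon>. 0 < \<bar>\<epsilon>\<bar> \<and> \<bar>\<epsilon>\<bar> < \<epsilon>1 \<longrightarrow> (\<forall>\<zeta>\<in>?C. (zz (\<xi> e \<zeta>) + \<epsilon> *\<^sub>R b \<zeta> \<epsilon>, \<epsilon>) \<in> B \<and>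
        norm (\<Psi> (zz (\<xi> e \<zeta>) + \<epsilon> *\<^sub>R b \<zeta> \<epsilon>, \<epsilon>) - \<epsilon>\<^sup>2 *\<^sub>R pair_vec e (\<xi> e (k2 (\<xi> e \<zeta>))) \<zeta>) \<le> \<eta> * \<bar>\<epsilon>\<bar>\<^sup>2)"
      proof (intro exI[of _ "min (min (d / C) d') 1"] conjI allI impI ballI)
        show "min (min (d / C) d') 1 > 0" using d d' C by simp
        fix \<epsilon> :: real and \<zeta> assume "0 < \<bar>\<epsilon>\<bar> \<and> \<bar>\<epsilon>\<bar> < min (min (d / C) d') 1" and \<zeta>: "\<zeta> \<in> ?C"
        then have \<epsilon>: "\<bar>\<epsilon>\<bar> < d / C" "\<bar>\<epsilon>\<bar> < d'" "\<bar>\<epsilon>\<bar> \<le> 1" by auto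
        note w = rW[OF \<zeta>]
        let ?\<nu> = "\<xi> e \<zeta>" and ?x = "p (\<xi> e \<zeta>)" and ?y = "\<epsilon> *\<^sub>R (b \<zeta> \<epsilon>, 1 :: real)"
        have xK: "?x \<in> ?K" using \<zeta> by blast
        have xy: "?x + ?y = (zz ?\<nu> + \<epsilon> *\<^sub>R b \<zeta> \<epsilon>, \<epsilon>)" by (simp add: p_def)
        have y: "norm ?y \<le> \<bar>\<epsilon>\<bar> * C" unfolding norm_scaleR using Cb[OF \<zeta> \<epsilon>(3)] by (intro mult_left_mono) auto
        also have "\<dots> < d" using \<epsilon> C(1) by (simp add: field_simps)
        finally have yd: "norm ?y < d" .
        show "(zz ?\<nu> + \<epsilon> *\<^sub>R b \<zeta> \<epsilon>, \<epsilon>) \<in> B" using d(2)[OF xK yd] unfolding xy .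
        have D1: "frechet_derivative \<Psi> (at ?x) ?y = \<epsilon>\<^sup>2 *\<^sub>R (A (zz ?\<nu>) *v \<Omega> \<zeta>)"
        proof -
          have "A (zz ?\<nu>) *v b \<zeta> \<epsilon> + c1 ?\<nu> = \<epsilon> *\<^sub>R (A (zz ?\<nu>) *v \<Omega> \<zeta>)"
            using first[OF w] by (simp add: b_def matrix_vector_right_distrib matrix_vector_mult_scaleR algebra_simps)
          then have "frechet_derivative \<Psi> (at ?x) (b \<zeta> \<epsilon>, 1) = \<epsilon> *\<^sub>R (A (zz ?\<nu>) *v \<Omega> \<zeta>)" using D\<Psi>[OF w] by simp
          then show ?thesis by (simp only: linear_scale[OF linD[OF w]] scaleR_scaleR power2_eq_square)
        qed
        \<comment> \<open>Linearity in the second argument is immediate; symmetry carries the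
          scaling over to the first.\<close>
        have sc: "second_derivative \<Psi> ?x (\<epsilon> *\<^sub>R h) (\<epsilon> *\<^sub>R h) = \<epsilon>\<^sup>2 *\<^sub>R second_derivative \<Psi> ?x h h" for h
          using linear_scale[OF linear_second_derivative[OF \<Psi>2 WV(2)[OF w]]]
            second_derivative_symmetric[OF B \<Psi>2 WV(2)[OF w], of "\<epsilon> *\<^sub>R h" h]
          by (simp add: power2_eq_square)
        have D2: "(1/2) *\<^sub>R second_derivative \<Psi> ?x ?y ?y = \<epsilon>\<^sup>2 *\<^sub>R (k2 ?\<nu> + (1/2) *\<^sub>R (\<Theta> (\<zeta>, \<epsilon>) - \<Theta> (\<zeta>, 0)))"
          unfolding sc \<Theta>0 by (simp add: \<Theta>_def k2_def algebra_simps)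
        have "dist (\<zeta>, \<epsilon>) (\<zeta>, 0) < d'" using \<epsilon>(2) by (simp add: dist_Pair_Pair)
        then have \<Theta>\<eta>: "norm (\<Theta> (\<zeta>, \<epsilon>) - \<Theta> (\<zeta>, 0)) \<le> \<eta>"
          using d'(2)[THEN bspec, THEN bspec, THEN mp, of "(\<zeta>, 0)" "(\<zeta>, \<epsilon>)"] \<zeta> \<epsilon>(3)
          by (simp add: dist_norm abs_le_iff)
        let ?R = "\<Psi> (?x + ?y) - \<Psi> ?x - frechet_derivative \<Psi> (at ?x) ?y - (1/2) *\<^sub>R second_derivative \<Psi> ?x ?y ?y"
        have "norm ?R \<le> \<eta>' * (norm ?y)\<^sup>2" by (rule d(3)[OF xK yd])
        also have "\<dots> \<le> \<eta>' * (\<bar>\<epsilon>\<bar> * C)\<^sup>2" using y \<eta>' by (intro mult_left_mono power_mono) auto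
        also have "\<dots> = \<eta> / 2 * \<bar>\<epsilon>\<bar>\<^sup>2" using C(1) by (simp add: \<eta>'_def power_mult_distrib)
        finally have R: "norm ?R \<le> \<eta> / 2 * \<bar>\<epsilon>\<bar>\<^sup>2" .
        have S: "norm (\<epsilon>\<^sup>2 *\<^sub>R (1/2) *\<^sub>R (\<Theta> (\<zeta>, \<epsilon>) - \<Theta> (\<zeta>, 0))) \<le> \<eta> / 2 * \<bar>\<epsilon>\<bar>\<^sup>2"
          unfolding norm_scaleR using mult_left_mono[OF \<Theta>\<eta>, of "\<epsilon>\<^sup>2"] by (simp add: field_simps)
        have eq: "\<Psi> (?x + ?y) - \<epsilon>\<^sup>2 *\<^sub>R pair_vec e (\<xi> e (k2 ?\<nu>)) \<zeta> = ?R + \<epsilon>\<^sup>2 *\<^sub>R (1/2) *\<^sub>R (\<Theta> (\<zeta>, \<epsilon>) - \<Theta> (\<zeta>, 0))"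
          unfolding lim[OF \<zeta>, symmetric] D1 D2 p0[OF w] by (simp add: scaleR_add_right)
        have "norm (\<Psi> (?x + ?y) - \<epsilon>\<^sup>2 *\<^sub>R pair_vec e (\<xi> e (k2 ?\<nu>)) \<zeta>) \<le> \<eta> / 2 * \<bar>\<epsilon>\<bar>\<^sup>2 + \<eta> / 2 * \<bar>\<epsilon>\<bar>\<^sup>2"
          unfolding eq by (rule norm_triangle_mono[OF R S])
        then show "norm (\<Psi> (zz ?\<nu> + \<epsilon> *\<^sub>R b \<zeta> \<epsilon>, \<epsilon>) - \<epsilon>\<^sup>2 *\<^sub>R pair_vec e (\<xi> e (k2 ?\<nu>)) \<zeta>) \<le> \<eta> * \<bar>\<epsilon>\<bar>\<^sup>2"
          unfolding xy by simp
      qed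
    qed
  qed
qed

text \<open>Expanding the quadratic form at \<open>(gam, 1) = (gam, 0) + (0, 1)\<close> gives the
  three terms of \<open>f2\<close>. By symmetry the mixed term occurs twice, which is the factor 2
  before the derivative of \<open>g1\<close>. The assumption on \<open>\<gamma>\<close> says that it
  lies in the \<open>v\<close>-directions.\<close>

lemma f2_eq:
  fixes e :: "'q::finite \<Rightarrow> 'p::finite" and \<Psi> :: "(real ^ 'p) \<times> real \<Rightarrow> real ^ 'p"
    and \<sigma> :: "real ^ 'q \<Rightarrow> real ^ 'p"
  defines "zz \<equiv> \<lambda>\<nu>. pair_vec e \<nu> (\<sigma> \<nu>)"
  assumes B: "open B" and \<Psi>: "Ck_on 3 B \<Psi>" and \<nu>: "(zz \<nu>, 0) \<in> B"
    and 0: "\<And>z. (z, 0) \<in> B \<Longrightarrow> \<Psi> (z, 0) = g0 Fp Fm D T \<phi> z"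
    and 1: "\<And>z. (z, 0) \<in> B \<Longrightarrow> frechet_derivative \<Psi> (at (z, 0)) (0, 1) = g1 Fp Fm D T \<phi> z"
    and 2: "\<And>z. (z, 0) \<in> B \<Longrightarrow> second_derivative \<Psi> (z, 0) (0, 1) (0, 1) = 2 *\<^sub>R g2 Fp Fm D T \<phi> z"
    and \<gamma>: "\<xi>_perp e (\<gamma> Fp Fm D T \<phi> e \<sigma> \<nu>) = \<gamma> Fp Fm D T \<phi> e \<sigma> \<nu>"
  shows "f2 Fp Fm D T \<phi> e \<sigma> \<nu> = \<xi> e (second_derivative \<Psi> (zz \<nu>, 0)
    (\<gamma> Fp Fm D T \<phi> e \<sigma> \<nu>, 1) (\<gamma> Fp Fm D T \<phi> e \<sigma> \<nu>, 1))"
proof -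
  define gam where "gam = \<gamma> Fp Fm D T \<phi> e \<sigma> \<nu>"
  have \<Psi>3: "Ck_on (Suc (Suc (Suc 0))) B \<Psi>" using \<Psi> by (simp add: numeral_3_eq_3)
  have \<Psi>2: "Ck_on 2 B \<Psi>" by (rule Ck_on_mono[OF \<Psi>]) simp
  have D1: "Ck_on (Suc (Suc 0)) B (\<lambda>q. frechet_derivative \<Psi> (at q) (0, 1))" by (rule Ck_on_derivative[OF \<Psi>3])
  define d where "d = (pair_vec e \<nu> 0, 0 :: real)"
  \<comment> \<open>Embeds the \<open>v\<close>-directions, so that partial derivatives in
    \<open>v\<close> become derivatives of \<open>\<Psi>\<close>; coordinates in
    \<open>range e\<close> are dropped, as \<open>pair_vec\<close> does.\<close>
  define E where "E v = (\<xi>_perp e v, 0 :: real)" for v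
  have E: "bounded_linear E"
    unfolding E_def by (intro bounded_linear_Pair bounded_linear_\<xi>_perp bounded_linear_zero)
  have dE: "d + E v = (pair_vec e \<nu> v, 0)" for v
    using pair_vec_split[of e \<nu> v] by (simp add: d_def E_def pair_vec_0)
  have \<sigma>\<nu>: "d + E (\<sigma> \<nu>) \<in> B" "d + E (\<sigma> \<nu>) = (zz \<nu>, 0)" using \<nu> unfolding dE zz_def by auto
  let ?N = "(\<lambda>v. d + E v) -` B"
  have N: "open ?N" by (rule open_vimage[OF B]) (intro continuous_intros linear_continuous_on[OF E])
  have \<sigma>N: "\<sigma> \<nu> \<in> ?N" using \<sigma>\<nu> by simp
  have Egam: "E gam = (gam, 0)" using \<gamma> by (simp add: E_def gam_def)
  have t1: "frechet_derivative (\<lambda>v. \<xi> e (g1 Fp Fm D T \<phi> (pair_vec e \<nu> v))) (at (\<sigma> \<nu>)) gam =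
      \<xi> e (second_derivative \<Psi> (zz \<nu>, 0) (0, 1) (gam, 0))"
  proof -
    have "frechet_derivative (\<lambda>v. \<xi> e (g1 Fp Fm D T \<phi> (pair_vec e \<nu> v))) (at (\<sigma> \<nu>)) =
        frechet_derivative (\<lambda>v. 0 + \<xi> e (frechet_derivative \<Psi> (at (d + E v)) (0, 1))) (at (\<sigma> \<nu>))"
      by (rule frechet_derivative_cong_open[OF N \<sigma>N]) (use 1 dE in auto)
    moreover have df: "(\<lambda>q. frechet_derivative \<Psi> (at q) (0, 1)) differentiable (at (d + E (\<sigma> \<nu>)))"
      using D1 \<sigma>\<nu>(1) by simp
    ultimately show ?thesis
      using frechet_derivative_affine_compose[OF bounded_linear_\<xi>[of e] E df, of 0 gam]
      by (simp only: Egam \<sigma>\<nu>(2) second_derivative_def)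
  qed
  have t2: "second_derivative (\<lambda>v. \<xi> e (g0 Fp Fm D T \<phi> (pair_vec e \<nu> v))) (\<sigma> \<nu>) gam gam =
      \<xi> e (second_derivative \<Psi> (zz \<nu>, 0) (gam, 0) (gam, 0))"
  proof -
    have *: "frechet_derivative (\<lambda>v. \<xi> e (g0 Fp Fm D T \<phi> (pair_vec e \<nu> v))) (at v) =
        frechet_derivative (\<lambda>v. 0 + \<xi> e (\<Psi> (d + E v))) (at v)" if "v \<in> ?N" for v
      by (rule frechet_derivative_cong_open[OF N that]) (use 0 dE in auto)
    have "second_derivative (\<lambda>v. \<xi> e (g0 Fp Fm D T \<phi> (pair_vec e \<nu> v))) (\<sigma> \<nu>) gam gam =
        second_derivative (\<lambda>v. 0 + \<xi> e (\<Psi> (d + E v))) (\<sigma> \<nu>) gam gam"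
      unfolding second_derivative_def by (rule fun_cong[OF frechet_derivative_cong_open[OF N \<sigma>N]]) (simp only: *)
    also have "\<dots> = \<xi> e (second_derivative \<Psi> (d + E (\<sigma> \<nu>)) (E gam) (E gam))"
      by (rule second_derivative_affine_compose[OF bounded_linear_\<xi> E B \<Psi>2 \<sigma>\<nu>(1)])
    finally show ?thesis unfolding Egam \<sigma>\<nu>(2) .
  qed
  let ?Q = "second_derivative \<Psi> (zz \<nu>, 0)"
  have lin: "?Q h (k + k') = ?Q h k + ?Q h k'" for h k k'
    by (rule linear_add[OF linear_second_derivative[OF \<Psi>2 \<nu>]])
  have sym: "?Q h k = ?Q k h" for h k by (rule second_derivative_symmetric[OF B \<Psi>2 \<nu>])
  have "?Q (gam, 1) (gam, 1) = ?Q ((gam, 0) + (0, 1)) ((gam, 0) + (0, 1))" by simp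
  also have "\<dots> = ?Q (gam, 0) (gam, 0) + ?Q (0, 1) (gam, 0) + (?Q (0, 1) (gam, 0) + ?Q (0, 1) (0, 1))"
    unfolding lin sym[of "(gam, 0) + (0, 1)"] by (simp only: sym[of "(gam, 0)" "(0, 1)"])
  finally have Q: "?Q (gam, 1) (gam, 1) = 2 *\<^sub>R ?Q (0, 1) (gam, 0) + ?Q (gam, 0) (gam, 0) + ?Q (0, 1) (0, 1)"
    by (simp add: scaleR_2)
  have lx: "linear (\<xi> e)" by (rule bounded_linear.linear[OF bounded_linear_\<xi>])
  show ?thesis
    unfolding f2_def gam_def[symmetric] t1 t2 Q using 2[OF \<nu>]
    by (simp add: linear_add[OF lx] linear_scale[OF lx] zz_def)
qed

theorem theorem1:
  fixes T \<phi> \<epsilon>0 :: real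
    and D :: "(real ^ 'p::finite) set"
    and Fp Fm :: "nat \<Rightarrow> real \<Rightarrow> real ^ 'p \<Rightarrow> real ^ 'p"
    and Rp Rm :: "real \<Rightarrow> real ^ 'p \<Rightarrow> real \<Rightarrow> real ^ 'p"
    and e :: "'q::finite \<Rightarrow> 'p"
    and V :: "(real ^ 'q) set"
    and \<sigma> :: "real ^ 'q \<Rightarrow> real ^ 'p"
  assumes "0 < T" and "0 < \<phi>" and "\<phi> \<le> T" and "0 < \<epsilon>0"
    and "open D" and "bounded D"
    and F_smooth: "\<And>i F. \<lbrakk>i \<in> {0, 1, 2}; F \<in> {Fp, Fm}\<rbrakk> \<Longrightarrow>
           Ck_on 3 (UNIV \<times> D) (\<lambda>(\<theta>, x). F i \<theta> x)"
    and F_periodic: "\<And>i F x. \<lbrakk>i \<in> {0, 1, 2}; F \<in> {Fp, Fm}; x \<in> D\<rbrakk> \<Longrightarrow>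
           periodic T (\<lambda>\<theta>. F i \<theta> x)"
    and R_smooth: "\<And>R. R \<in> {Rp, Rm} \<Longrightarrow>
           Ck_on 3 (UNIV \<times> D \<times> {-\<epsilon>0<..<\<epsilon>0}) (\<lambda>(\<theta>, x, \<epsilon>). R \<theta> x \<epsilon>)"
    and R_periodic: "\<And>R x \<epsilon>. \<lbrakk>R \<in> {Rp, Rm}; x \<in> D; \<epsilon> \<in> {-\<epsilon>0<..<\<epsilon>0}\<rbrakk> \<Longrightarrow>
           periodic T (\<lambda>\<theta>. R \<theta> x \<epsilon>)"
    and "inj e"
    and "open V" and "bounded V"
    and \<sigma>_smooth: "Ck_closure 3 V \<sigma>"
    and \<sigma>_last: "\<And>\<nu> i. \<nu> \<in> closure V \<Longrightarrow> \<sigma> \<nu> $ e i = 0"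
    and Z_subset: "\<And>\<nu>. \<nu> \<in> closure V \<Longrightarrow> pair_vec e \<nu> (\<sigma> \<nu>) \<in> D"
    and Z_periodic: "\<And>\<nu>. \<nu> \<in> closure V \<Longrightarrow>
           \<exists>x. pw_solution Fp Fm Rp Rm D T \<phi> 0 x \<and> x 0 = pair_vec e \<nu> (\<sigma> \<nu>) \<and> periodic T x"
    and upper_right: "\<And>\<nu> i j. \<lbrakk>\<nu> \<in> closure V; i \<in> range e; j \<notin> range e\<rbrakk> \<Longrightarrow>
           Ydiff Fp Fm D T \<phi> (pair_vec e \<nu> (\<sigma> \<nu>)) $ i $ j = 0"
    and lower_right: "\<And>\<nu>. \<nu> \<in> closure V \<Longrightarrow>
           det (lower_corner e (Ydiff Fp Fm D T \<phi> (pair_vec e \<nu> (\<sigma> \<nu>)))) \<noteq> 0"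
  shows
    "(\<forall>\<nu>\<in>V. f1 Fp Fm D T \<phi> e \<sigma> \<nu> = 0 \<and> det (jacobian (f1 Fp Fm D T \<phi> e \<sigma>) (at \<nu>)) \<noteq> 0 \<longrightarrow>
        (\<exists>\<epsilon>1 x. 0 < \<epsilon>1 \<and> \<epsilon>1 \<le> \<epsilon>0 \<and>
           (\<forall>\<epsilon>. 0 < \<bar>\<epsilon>\<bar> \<and> \<bar>\<epsilon>\<bar> < \<epsilon>1 \<longrightarrow>
              pw_solution Fp Fm Rp Rm D T \<phi> \<epsilon> (\<lambda>\<theta>. x \<theta> \<epsilon>) \<and> periodic T (\<lambda>\<theta>. x \<theta> \<epsilon>)) \<and>
           ((\<lambda>\<epsilon>. x 0 \<epsilon>) \<longlongrightarrow> pair_vec e \<nu> (\<sigma> \<nu>)) (at 0)))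
     \<and>
     ((\<forall>\<nu>\<in>closure V. f1 Fp Fm D T \<phi> e \<sigma> \<nu> = 0) \<longrightarrow>
      (\<forall>\<nu>\<in>V. f2 Fp Fm D T \<phi> e \<sigma> \<nu> = 0 \<and> det (jacobian (f2 Fp Fm D T \<phi> e \<sigma>) (at \<nu>)) \<noteq> 0 \<longrightarrow>
        (\<exists>\<epsilon>1 x. 0 < \<epsilon>1 \<and> \<epsilon>1 \<le> \<epsilon>0 \<and>
           (\<forall>\<epsilon>. 0 < \<bar>\<epsilon>\<bar> \<and> \<bar>\<epsilon>\<bar> < \<epsilon>1 \<longrightarrow>
              pw_solution Fp Fm Rp Rm D T \<phi> \<epsilon> (\<lambda>\<theta>. x \<theta> \<epsilon>) \<and> periodic T (\<lambda>\<theta>. x \<theta> \<epsilon>)) \<and>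
           ((\<lambda>\<epsilon>. x 0 \<epsilon>) \<longlongrightarrow> pair_vec e \<nu> (\<sigma> \<nu>)) (at 0))))"
proof -
  have Vc: "\<nu> \<in> closure V" if "\<nu> \<in> V" for \<nu> using that closure_subset by blast
  have \<sigma>d: "\<sigma> differentiable (at \<nu>)" if "\<nu> \<in> V" for \<nu>
    using \<sigma>_smooth that by (simp add: numeral_3_eq_3)
  let ?zz = "\<lambda>\<nu>. pair_vec e \<nu> (\<sigma> \<nu>)"
  let ?concl = "\<lambda>\<nu>. \<exists>\<epsilon>1 x. 0 < \<epsilon>1 \<and> \<epsilon>1 \<le> \<epsilon>0 \<and>
    (\<forall>\<epsilon>. 0 < \<bar>\<epsilon>\<bar> \<and> \<bar>\<epsilon>\<bar> < \<epsilon>1 \<longrightarrow>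
      pw_solution Fp Fm Rp Rm D T \<phi> \<epsilon> (\<lambda>\<theta>. x \<theta> \<epsilon>) \<and> periodic T (\<lambda>\<theta>. x \<theta> \<epsilon>)) \<and>
    ((\<lambda>\<epsilon>. x 0 \<epsilon>) \<longlongrightarrow> pair_vec e \<nu> (\<sigma> \<nu>)) (at 0)"
  \<comment> \<open>Both parts are local at \<open>a\<close>: they are read off from a displacement
    that is defined on a ball about \<open>(?zz a, 0)\<close> only.\<close>
  have main: "(f1 Fp Fm D T \<phi> e \<sigma> a = 0 \<longrightarrow> det (jacobian (f1 Fp Fm D T \<phi> e \<sigma>) (at a)) \<noteq> 0 \<longrightarrow> ?concl a) \<and>
    ((\<forall>\<nu>\<in>closure V. f1 Fp Fm D T \<phi> e \<sigma> \<nu> = 0) \<longrightarrow> f2 Fp Fm D T \<phi> e \<sigma> a = 0 \<longrightarrow>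
      det (jacobian (f2 Fp Fm D T \<phi> e \<sigma>) (at a)) \<noteq> 0 \<longrightarrow> ?concl a)" if a: "a \<in> V" for a
  proof -
    obtain x0 where x0: "pw_solution Fp Fm Rp Rm D T \<phi> 0 x0" "x0 0 = ?zz a" using Z_periodic[OF Vc[OF a]] by blast
    obtain \<delta> \<Psi> where \<delta>: "\<delta> > 0" and \<Psi>: "Ck_on 3 (ball (x0 0, 0 :: real) \<delta>) \<Psi>"
      and sol: "\<And>z \<epsilon>. (z, \<epsilon>) \<in> ball (x0 0, 0) \<delta> \<Longrightarrow> \<Psi> (z, \<epsilon>) = 0 \<Longrightarrow>
        \<exists>x. pw_solution Fp Fm Rp Rm D T \<phi> \<epsilon> x \<and> periodic T x \<and> x 0 = z"
      and g: "\<And>z. (z, 0 :: real) \<in> ball (x0 0, 0) \<delta> \<Longrightarrow> \<Psi> (z, 0) = g0 Fp Fm D T \<phi> z"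
        "\<And>z h. (z, 0 :: real) \<in> ball (x0 0, 0) \<delta> \<Longrightarrow> frechet_derivative \<Psi> (at (z, 0)) (h, 0) = Ydiff Fp Fm D T \<phi> z *v h"
        "\<And>z. (z, 0 :: real) \<in> ball (x0 0, 0) \<delta> \<Longrightarrow> frechet_derivative \<Psi> (at (z, 0)) (0, 1) = g1 Fp Fm D T \<phi> z"
        "\<And>z. (z, 0 :: real) \<in> ball (x0 0, 0) \<delta> \<Longrightarrow> second_derivative \<Psi> (z, 0) (0, 1) (0, 1) = 2 *\<^sub>R g2 Fp Fm D T \<phi> z"
      by (rule displacement[where Fp=Fp and Fm=Fm and Rp=Rp and Rm=Rm and ?x0.0=x0
        and D=D and T=T and \<phi>=\<phi> and ?\<epsilon>0.0=\<epsilon>0, OF assms(1-5)])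
        ((rule F_smooth; assumption) | (rule F_periodic; assumption) | (rule R_smooth; assumption) |
         (rule R_periodic; assumption) | rule x0(1) | (rule that; assumption))+
    let ?B = "ball (x0 0, 0 :: real) \<delta>"
    have opB: "open ?B" by simp
    have aB: "(?zz a, 0 :: real) \<in> ?B" using \<delta> x0(2) by simp
    have zero: "\<Psi> (?zz \<nu>, 0) = 0" if \<nu>: "\<nu> \<in> V" and b: "(?zz \<nu>, 0 :: real) \<in> ?B" for \<nu>
    proof -
      obtain x where x: "pw_solution Fp Fm Rp Rm D T \<phi> 0 x" "x 0 = ?zz \<nu>" "periodic T x"
        using Z_periodic[OF Vc[OF \<nu>]] by blast
      have "g0 Fp Fm D T \<phi> (x 0) = 0"
        by (rule g0_eq_0[OF assms(2,3,5) F_smooth[of 0 Fp] F_smooth[of 0 Fm] x(1,3)]) simp_all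
      then show ?thesis using g(1)[OF b] x(2) by simp
    qed
    have ur: "Ydiff Fp Fm D T \<phi> (?zz \<nu>) $ i $ j = 0" if "\<nu> \<in> V" "i \<in> range e" "j \<notin> range e" for \<nu> i j
      by (rule upper_right[OF Vc[OF that(1)] that(2,3)])
    have lr: "det (lower_corner e (Ydiff Fp Fm D T \<phi> (?zz \<nu>))) \<noteq> 0" if "\<nu> \<in> V" for \<nu>
      by (rule lower_right[OF Vc[OF that]])
    note bif = bifurcation_from_manifold[where e=e and V=V and \<sigma>=\<sigma> and B="?B" and \<Psi>=\<Psi>
      and A="Ydiff Fp Fm D T \<phi>" and a=a, OF \<open>inj e\<close> \<open>open V\<close> \<sigma>d opB \<Psi> zero g(2) ur lr a aB]
    have concl: "?concl a" if "\<And>\<rho>. \<rho> > 0 \<Longrightarrow> \<exists>\<epsilon>1>0. \<forall>\<epsilon>. 0 < \<bar>\<epsilon>\<bar> \<and> \<bar>\<epsilon>\<bar> < \<epsilon>1 \<longrightarrow>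
      (\<exists>z. ((z, \<epsilon>) \<in> ?B \<and> \<Psi> (z, \<epsilon>) = 0) \<and> dist z (?zz a) \<le> \<rho>)"
    proof -
      have "\<exists>\<epsilon>1 z. 0 < \<epsilon>1 \<and> \<epsilon>1 \<le> \<epsilon>0 \<and> (\<forall>\<epsilon>. 0 < \<bar>\<epsilon>\<bar> \<and> \<bar>\<epsilon>\<bar> < \<epsilon>1 \<longrightarrow> (z \<epsilon>, \<epsilon>) \<in> ?B \<and> \<Psi> (z \<epsilon>, \<epsilon>) = 0) \<and>
          (z \<longlongrightarrow> ?zz a) (at 0)"
        by (rule tendsto_choice[where P="\<lambda>\<epsilon> z. (z, \<epsilon>) \<in> ?B \<and> \<Psi> (z, \<epsilon>) = 0", OF _ \<open>0 < \<epsilon>0\<close>]) (rule that)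
      then obtain \<epsilon>1 z where z: "0 < \<epsilon>1" "\<epsilon>1 \<le> \<epsilon>0" "\<forall>\<epsilon>. 0 < \<bar>\<epsilon>\<bar> \<and> \<bar>\<epsilon>\<bar> < \<epsilon>1 \<longrightarrow> (z \<epsilon>, \<epsilon>) \<in> ?B \<and> \<Psi> (z \<epsilon>, \<epsilon>) = 0"
        "(z \<longlongrightarrow> ?zz a) (at 0)" by (elim exE conjE)
      \<comment> \<open>The solution through \<open>z \<epsilon>\<close> is chosen for each
        \<epsilon> separately. The limit concerns only its value at time 0, which is
        \<open>z \<epsilon>\<close>.\<close>
      define x where "x \<theta> \<epsilon> = (SOME x. pw_solution Fp Fm Rp Rm D T \<phi> \<epsilon> x \<and> periodic T x \<and> x 0 = z \<epsilon>) \<theta>" for \<theta> \<epsilon>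
      have x: "pw_solution Fp Fm Rp Rm D T \<phi> \<epsilon> (\<lambda>\<theta>. x \<theta> \<epsilon>) \<and> periodic T (\<lambda>\<theta>. x \<theta> \<epsilon>) \<and> x 0 \<epsilon> = z \<epsilon>"
        if "0 < \<bar>\<epsilon>\<bar> \<and> \<bar>\<epsilon>\<bar> < \<epsilon>1" for \<epsilon>
      proof -
        have "\<exists>x. pw_solution Fp Fm Rp Rm D T \<phi> \<epsilon> x \<and> periodic T x \<and> x 0 = z \<epsilon>"
          using z(3)[THEN spec, THEN mp, OF that] by (intro sol) auto
        from someI_ex[OF this] show ?thesis unfolding x_def .
      qed
      have "\<forall>\<^sub>F \<epsilon> in at 0. z \<epsilon> = x 0 \<epsilon>"
        unfolding eventually_at using x z(1) by (intro exI[of _ \<epsilon>1]) auto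
      then have "((\<lambda>\<epsilon>. x 0 \<epsilon>) \<longlongrightarrow> ?zz a) (at 0)" using z(4) tendsto_cong by fastforce
      then show ?thesis using z(1,2) x by (intro exI[of _ \<epsilon>1] exI[of _ x]) auto
    qed
    \<comment> \<open>On this neighbourhood of \<open>a\<close> the functions \<open>f1\<close>,
      \<open>\<gamma>\<close> and \<open>f2\<close> coincide with expressions in
      \<open>\<Psi>\<close>, which settles their values and Jacobians at \<open>a\<close>.\<close>
    define W where "W = V \<inter> (\<lambda>\<nu>. (?zz \<nu>, 0 :: real)) -` ?B"
    have zzc: "continuous_on V ?zz"
    proof -
      have "continuous_on V \<sigma>" by (rule differentiable_imp_continuous_on_set[OF \<sigma>d])
      then have "continuous_on V (\<lambda>\<nu>. pair_vec e \<nu> 0 + \<xi>_perp e (\<sigma> \<nu>))"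
        by (intro continuous_on_add bounded_linear.continuous_on[OF bounded_linear_pair_vec] continuous_on_id
            bounded_linear.continuous_on[OF bounded_linear_\<xi>_perp])
      then show ?thesis by (rule continuous_on_eq) (metis pair_vec_split pair_vec_0)
    qed
    have W: "open W"
      unfolding W_def
      by (rule continuous_open_preimage[OF _ \<open>open V\<close> opB]) (intro continuous_on_Pair zzc continuous_on_const)
    have aW: "a \<in> W" using a aB by (simp add: W_def)
    let ?c1 = "\<lambda>\<nu>. frechet_derivative \<Psi> (at (?zz \<nu>, 0)) (0, 1)"
    have f1: "f1 Fp Fm D T \<phi> e \<sigma> \<nu> = \<xi> e (?c1 \<nu>)" if "\<nu> \<in> W" for \<nu>
      using that g(3) by (simp add: W_def f1_def)
    let ?gam = "\<lambda>\<nu>. - (matrix_inv (lower_corner e (Ydiff Fp Fm D T \<phi> (?zz \<nu>))) *v \<xi>_perp e (?c1 \<nu>))"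
    have gam: "\<gamma> Fp Fm D T \<phi> e \<sigma> \<nu> = ?gam \<nu>" if "\<nu> \<in> W" for \<nu>
      using that g(3) by (simp add: W_def \<gamma>_def)
    have lp: "linear (\<xi>_perp e)" by (rule bounded_linear.linear[OF bounded_linear_\<xi>_perp])
    have gamP: "\<xi>_perp e (\<gamma> Fp Fm D T \<phi> e \<sigma> \<nu>) = \<gamma> Fp Fm D T \<phi> e \<sigma> \<nu>" if "\<nu> \<in> W" for \<nu>
      unfolding \<gamma>_def linear_neg[OF lp]
      by (subst lower_corner_inverse(1)[OF lr]) (use that in \<open>simp_all add: W_def\<close>)
    have f2: "f2 Fp Fm D T \<phi> e \<sigma> \<nu> = \<xi> e (second_derivative \<Psi> (?zz \<nu>, 0) (?gam \<nu>, 1) (?gam \<nu>, 1))"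
      if \<nu>: "\<nu> \<in> W" for \<nu>
    proof -
      have b: "(?zz \<nu>, 0 :: real) \<in> ?B" using \<nu> by (simp add: W_def)
      show ?thesis using f2_eq[OF opB \<Psi> b g(1) g(3,4) gamP[OF \<nu>]] unfolding gam[OF \<nu>] .
    qed
    have j1: "jacobian (f1 Fp Fm D T \<phi> e \<sigma>) (at a) = jacobian (\<lambda>\<nu>. \<xi> e (?c1 \<nu>)) (at a)"
      unfolding jacobian_def by (rule arg_cong[where f=matrix], rule frechet_derivative_cong_open[OF W aW], rule f1)
    have j2: "jacobian (f2 Fp Fm D T \<phi> e \<sigma>) (at a) =
        jacobian (\<lambda>\<nu>. \<xi> e (second_derivative \<Psi> (?zz \<nu>, 0) (?gam \<nu>, 1) (?gam \<nu>, 1))) (at a)"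
      unfolding jacobian_def by (rule arg_cong[where f=matrix], rule frechet_derivative_cong_open[OF W aW], rule f2)
    have f10: "\<xi> e (?c1 \<nu>) = 0" if "\<forall>\<nu>\<in>closure V. f1 Fp Fm D T \<phi> e \<sigma> \<nu> = 0" "\<nu> \<in> V" "(?zz \<nu>, 0 :: real) \<in> ?B" for \<nu>
      using that(1) Vc[OF that(2)] f1[of \<nu>] that(2,3) by (simp add: W_def)
    show ?thesis
      unfolding j1 j2 f1[OF aW] f2[OF aW]
    proof (intro conjI impI concl)
      fix \<rho> :: real assume "\<rho> > 0" "\<xi> e (?c1 a) = 0" "det (jacobian (\<lambda>\<nu>. \<xi> e (?c1 \<nu>)) (at a)) \<noteq> 0"
      then show "\<exists>\<epsilon>1>0. \<forall>\<epsilon>. 0 < \<bar>\<epsilon>\<bar> \<and> \<bar>\<epsilon>\<bar> < \<epsilon>1 \<longrightarrow>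
          (\<exists>z. ((z, \<epsilon>) \<in> ?B \<and> \<Psi> (z, \<epsilon>) = 0) \<and> dist z (?zz a) \<le> \<rho>)"
        by - (rule bif(1); assumption)
    next
      fix \<rho> :: real assume \<rho>: "\<rho> > 0" and f10': "\<forall>\<nu>\<in>closure V. f1 Fp Fm D T \<phi> e \<sigma> \<nu> = 0"
        and h: "\<xi> e (second_derivative \<Psi> (?zz a, 0) (?gam a, 1) (?gam a, 1)) = 0"
          "det (jacobian (\<lambda>\<nu>. \<xi> e (second_derivative \<Psi> (?zz \<nu>, 0) (?gam \<nu>, 1) (?gam \<nu>, 1))) (at a)) \<noteq> 0"
      show "\<exists>\<epsilon>1>0. \<forall>\<epsilon>. 0 < \<bar>\<epsilon>\<bar> \<and> \<bar>\<epsilon>\<bar> < \<epsilon>1 \<longrightarrow>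
          (\<exists>z. ((z, \<epsilon>) \<in> ?B \<and> \<Psi> (z, \<epsilon>) = 0) \<and> dist z (?zz a) \<le> \<rho>)"
        by (rule bif(2)) (assumption | rule \<rho> h | (rule f10[OF f10']; assumption))+
    qed
  qed
  show ?thesis
    by (intro conjI ballI impI) (use main in simp_all)
qed

end
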